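(* Let $p\in\mathbb R\langle x\rangle$ be a quasi-convex free polynomial. Then either $-p$ is a (hermitian) sum of squares, or there exist a linear polynomial $\ell\in\mathbb R\langle x\rangle$ and finitely many linear polynomials $s_j\in\mathbb R\langle x\rangle$ such that $$p(x)=\ell(x)+\sum_j s_j^*(x)s_j(x).$$ Thus $p$ is a hermitian sum of squares of linear polynomials plus a linear term. Further, if there is an $N$ such that for each $n\ge N$ there is a $B\in\mathbb S_n(\mathbb R)$ such that $B\not\succeq 0$ and $\{X\in\mathbb S_n(\mathbb R^g): B-p(X)\succ 0\}$ is convex, then $-p$ is a sum of squares if and only if $p=0$.
   Context: Let $g$ be a positive integer and let $\mathbb R\langle x\rangle$ be the ring of polynomials over $\mathbb R$ in freely non-commuting variables $x=(x_1,\dots,x_g)$; its elements (free polynomials) are finite sums $p=\sum_w p_w w$ over words $w$ in $x$ with $p_w\in\mathbb R$, the empty word $\emptyset$ being the multiplicative identity. For a word $w=x_{j_1}\cdots x_{j_k}$ put $w^*=x_{j_k}\cdots x_{j_1}$, and extend to an involution by $p^*=\sum p_w w^*$. A polynomial $p$ is symmetric if $p^*=p$. $\mathbb S_n(\mathbb R)$ is the set of real symmetric $n\times n$ matrices, and $\mathbb S_n(\mathbb R^g)$ is the set of $g$-tuples $X=(X_1,\dots,X_g)$ of real symmetric $n\times n$ matrices. The evaluation is $p(X)=\sum p_w w(X)$ with $w(X)=X_{j_1}\cdots X_{j_k}$ and $\emptyset(X)=I_n$; in particular $p(0)=p_\emptyset I_n$ for $0\in\mathbb S_n(\mathbb R^g)$.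 If $p$ is symmetric then $p(X)$ is a symmetric matrix. For a symmetric matrix $S$, $S\succ0$ and $S\succeq0$ mean positive definite and positive semidefinite respectively. A symmetric $p$ is quasi-convex if $p(0)=0$ and, for each $n$ and each positive definite $n\times n$ matrix $A$, the set $\mathcal D(A)=\{X\in\mathbb S_n(\mathbb R^g): A-p(X)\succ0\}$ is convex. A symmetric polynomial $p$ is a (hermitian) sum of squares if there exist $m$ and $h_1,\dots,h_m\in\mathbb R\langle x\rangle$ with $p=\sum_j h_j^*h_j$. A linear polynomial is a real linear combination of $x_1,\dots,x_g$. *)

theory Defs
  imports
    Complex_Main
    "HOL-Library.Poly_Mapping"
    "Jordan_Normal_Form.Matrix"
begin

text \<open>
  The variables are indexed by an arbitrary finite type \<open>'g\<close>, so that g is the cardinality of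
  \<open>'g\<close> (positive, since types are nonempty). Words form the free monoid, written additively
  because the convolution product of \<open>HOL-Library.Poly_Mapping\<close> expects the exponents to form
  an additive monoid; this \<open>+\<close> is concatenation and does not commute. The type
  \<open>'g free_poly\<close> thereby inherits the structure of a non-commutative ring from
  \<open>Poly_Mapping\<close>.
\<close>

datatype 'g free_word = Word (letters: "'g list")

instantiation free_word :: (type) monoid_add
begin

definition zero_free_word :: "'a free_word" where
  "0 = Word []"

definition plus_free_word :: "'a free_word \<Rightarrow> 'a free_word \<Rightarrow> 'a free_word" where
  "u + v = Word (letters u @ letters v)"

instance
  by standard (simp_all add: zero_free_word_def plus_free_word_def)

end

type_synonym 'g free_poly = "'g free_word \<Rightarrow>\<^sub>0 real"

definition word_star :: "'g free_word \<Rightarrow> 'g free_word" where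
  "word_star w = Word (rev (letters w))"

definition star :: "'g free_poly \<Rightarrow> 'g free_poly" where
  "star p = (\<Sum>w \<in> Poly_Mapping.keys p. Poly_Mapping.single (word_star w) (Poly_Mapping.lookup p w))"

definition symmetric_poly :: "'g free_poly \<Rightarrow> bool" where
  "symmetric_poly p \<longleftrightarrow> star p = p"

definition var :: "'g \<Rightarrow> 'g free_poly" where
  "var j = Poly_Mapping.single (Word [j]) 1"

definition const :: "real \<Rightarrow> 'g free_poly" where
  "const c = Poly_Mapping.single 0 c"

definition linear_poly :: "'g::finite free_poly \<Rightarrow> bool" where
  "linear_poly p \<longleftrightarrow> (\<exists>c :: 'g \<Rightarrow> real. p = (\<Sum>j \<in> UNIV. const (c j) * var j))"

definition sum_of_squares :: "'g free_poly \<Rightarrow> bool" where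
  "sum_of_squares p \<longleftrightarrow> (\<exists>hs :: 'g free_poly list. p = (\<Sum>h \<leftarrow> hs. star h * h))"

definition sym_mats :: "nat \<Rightarrow> real mat set" where
  "sym_mats n = {S \<in> carrier_mat n n. transpose_mat S = S}"

definition sym_tuples :: "nat \<Rightarrow> ('g \<Rightarrow> real mat) set" where
  "sym_tuples n = {X. \<forall>j. X j \<in> sym_mats n}"

definition pos_def :: "nat \<Rightarrow> real mat \<Rightarrow> bool" where
  "pos_def n S \<longleftrightarrow> S \<in> sym_mats n \<and> (\<forall>v \<in> carrier_vec n. v \<noteq> 0\<^sub>v n \<longrightarrow> v \<bullet> (S *\<^sub>v v) > 0)"

definition pos_semidef :: "nat \<Rightarrow> real mat \<Rightarrow> bool" where
  "pos_semidef n S \<longleftrightarrow> S \<in> sym_mats n \<and> (\<forall>v \<in> carrier_vec n. v \<bullet> (S *\<^sub>v v) \<ge> 0)"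

definition eval_word :: "nat \<Rightarrow> 'g free_word \<Rightarrow> ('g \<Rightarrow> real mat) \<Rightarrow> real mat" where
  "eval_word n w X = foldr (\<lambda>j M. X j * M) (letters w) (1\<^sub>m n)"

text \<open>
  The dimension has to be passed explicitly, and the sum over words is taken entrywise, because
  \<open>real mat\<close> contains matrices of all sizes and so is not an instance of the class
  \<open>comm_monoid_add\<close>.
\<close>

definition eval_poly :: "nat \<Rightarrow> 'g free_poly \<Rightarrow> ('g \<Rightarrow> real mat) \<Rightarrow> real mat" where
  "eval_poly n p X =
     mat n n (\<lambda>(i, k). \<Sum>w \<in> Poly_Mapping.keys p. (Poly_Mapping.lookup p w \<cdot>\<^sub>m eval_word n w X) $$ (i, k))"

definition sublevel_set :: "nat \<Rightarrow> 'g free_poly \<Rightarrow> real mat \<Rightarrow> ('g \<Rightarrow> real mat) set" where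
  "sublevel_set n p A = {X \<in> sym_tuples n. pos_def n (A - eval_poly n p X)}"

text \<open>For the same reason the library's \<open>convex\<close> does not apply to sets of matrix tuples.\<close>

definition convex_tuples :: "('g \<Rightarrow> real mat) set \<Rightarrow> bool" where
  "convex_tuples D \<longleftrightarrow>
     (\<forall>X \<in> D. \<forall>Y \<in> D. \<forall>s \<ge> 0. \<forall>t \<ge> 0. s + t = 1 \<longrightarrow>
        (\<lambda>j. s \<cdot>\<^sub>m X j + t \<cdot>\<^sub>m Y j) \<in> D)"

definition quasi_convex :: "'g free_poly \<Rightarrow> bool" where
  "quasi_convex p \<longleftrightarrow>
     symmetric_poly p \<and>
     (\<forall>n > 0. eval_poly n p (\<lambda>_. 0\<^sub>m n n) = 0\<^sub>m n n) \<and>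
     (\<forall>n > 0. \<forall>A. pos_def n A \<longrightarrow> convex_tuples (sublevel_set n p A))"

end

theory Submission
  imports
    Defs
    "HOL-Analysis.Function_Topology"
    "HOL-Analysis.Convex"
    "HOL-Library.Nat_Bijection"
    "Jordan_Normal_Form.Determinant"
begin

text \<open>
  The proof tests quasi-convexity on one vector at a time. For a vector \<open>v\<close>, the matrix \<open>A\<close> in the
  hypothesis may be small on the line of \<open>v\<close> and as large as necessary on its complement; hence the
  numerical function \<open>\<phi>(X) = \<langle>p(X)v, v\<rangle>\<close> has convex sublevel sets \<open>{\<phi> < \<alpha>}\<close> for every
  \<open>\<alpha> > 0\<close> (\<open>level_sets_midpoint_convex\<close>).

  Suppose \<open>\<langle>p(X\<^sub>0)v\<^sub>0, v\<^sub>0\<rangle> > 0\<close> for some \<open>X\<^sub>0, v\<^sub>0\<close>. On direct sums of tuples and vectors the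
  function becomes \<open>\<phi>(X) + c\<^sup>2 g(s)\<close>, where \<open>g(s) = \<langle>p(sX\<^sub>0)v\<^sub>0, v\<^sub>0\<rangle>\<close>, with \<open>X\<close> and \<open>s\<close> independent
  and \<open>c\<close> arbitrary. Choose \<open>s\<close> where \<open>g\<close> is positive and increasing. Moving \<open>s\<close> by a multiple of
  \<open>c\<^sup>-\<^sup>2\<close> compensates the difference of \<open>\<phi>\<close> at two given points, so that both lie in the same
  sublevel set, and the error of this linear compensation vanishes as \<open>c \<rightarrow> \<infinity>\<close>. Thus \<open>\<phi>\<close> itself is
  convex (\<open>midpoint_convex_if_somewhere_positive\<close>). The second derivative of a convex \<open>\<phi>\<close> at a
  Fock-type tuple, in a direction that couples the Fock space with one extra basis vector, is a
  quadratic form in arbitrary numbers \<open>L\<^sub>j(w)\<close> whose coefficients are the coefficients of \<open>p\<close> at the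
  words \<open>u\<^sup>* x\<^sub>i x\<^sub>j w\<close>. If \<open>p\<close> had degree at least three, this form would have a nonzero
  off-diagonal entry next to a zero diagonal entry; so the degree is at most two, and the quadratic
  part is a positive semidefinite form, hence a sum of squares of linear polynomials.

  If no such \<open>X\<^sub>0, v\<^sub>0\<close> exist, then \<open>-p\<close> is positive semidefinite at every tuple, and
  \<open>sum_of_squares_if_moments_nonneg\<close> (Helton's theorem) applies. Its proof takes the sum of squares
  nearest to a given polynomial; if the two differ, the difference defines a functional that is
  nonnegative on squares and negative on the polynomial, and a GNS construction realizes a strictly
  positive perturbation of it as \<open>\<langle>w(X)v, v\<rangle>\<close>.

  For the last claim let \<open>-p\<close> be a sum of squares with a nonzero term \<open>h\<^sup>*h\<close>. The leading part of
  \<open>h\<close> is invertible at some symmetric tuple \<open>X\<close> of every large even size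
  (\<open>generic_symmetric_injective\<close>), so \<open>B - p(tX)\<close> and \<open>B - p(-tX)\<close> are positive definite for large
  \<open>t\<close>, whatever \<open>B\<close> is. Convexity then puts \<open>0\<close> into the sublevel set, which says that
  \<open>B = B - p(0)\<close> is positive definite.
\<close>

unbundle no inner_syntax

section \<open>Words of symmetric kernels acting on vectors\<close>

lemma sum_swap_1_2:
  "(\<Sum>x\<in>X. \<Sum>a\<in>A. \<Sum>b\<in>B. f x a b) = (\<Sum>a\<in>A. \<Sum>b\<in>B. \<Sum>x\<in>X. f x a b)"
  by (subst sum.swap, rule sum.cong[OF refl], rule sum.swap)

lemma sum_swap_2_2:
  "(\<Sum>k\<in>K. \<Sum>x\<in>X. \<Sum>a\<in>A. \<Sum>b\<in>B. f k x a b) = (\<Sum>a\<in>A. \<Sum>b\<in>B. \<Sum>k\<in>K. \<Sum>x\<in>X. f k x a b)"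
proof -
  have "(\<Sum>k\<in>K. \<Sum>x\<in>X. \<Sum>a\<in>A. \<Sum>b\<in>B. f k x a b) = (\<Sum>k\<in>K. \<Sum>a\<in>A. \<Sum>b\<in>B. \<Sum>x\<in>X. f k x a b)"
    by (rule sum.cong[OF refl], rule sum_swap_1_2)
  also have "\<dots> = (\<Sum>a\<in>A. \<Sum>b\<in>B. \<Sum>k\<in>K. \<Sum>x\<in>X. f k x a b)"
    by (rule sum_swap_1_2)
  finally show ?thesis .
qed

text \<open>
The value \<open>w(X)v\<close>, for a tuple \<open>X\<close> of kernels (matrices) indexed by an arbitrary set \<open>I\<close>. Working
with kernels instead of numbered matrices makes direct sums, spaces spanned by words and extra basis
vectors immediate. The scalars are kept general: complex numbers and polynomials occur besides
reals.
\<close>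

fun act :: "'i set \<Rightarrow> ('g \<Rightarrow> 'i \<Rightarrow> 'i \<Rightarrow> 'a::comm_semiring_1) \<Rightarrow> 'g list \<Rightarrow> ('i \<Rightarrow> 'a) \<Rightarrow> 'i \<Rightarrow> 'a" where
  "act I X [] v = v"
| "act I X (j # w) v = (\<lambda>i. \<Sum>k\<in>I. X j i k * act I X w v k)"

definition moment :: "'i set \<Rightarrow> ('g \<Rightarrow> 'i \<Rightarrow> 'i \<Rightarrow> 'a::comm_semiring_1) \<Rightarrow> ('i \<Rightarrow> 'a) \<Rightarrow> 'g list \<Rightarrow> 'a" where
  "moment I X v w = (\<Sum>i\<in>I. v i * act I X w v i)"

definition sym_kernels :: "'i set \<Rightarrow> ('g \<Rightarrow> 'i \<Rightarrow> 'i \<Rightarrow> 'a) \<Rightarrow> bool" where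
  "sym_kernels I X \<longleftrightarrow> (\<forall>j. \<forall>i\<in>I. \<forall>k\<in>I. X j i k = X j k i)"

lemma act_append: "act I X (u @ w) v = act I X u (act I X w v)"
  by (induction u) auto

lemma act_cong:
  assumes "\<And>j i k. i \<in> I \<Longrightarrow> k \<in> I \<Longrightarrow> X j i k = Y j i k" "\<And>i. i \<in> I \<Longrightarrow> u i = v i" "i \<in> I"
  shows "act I X w u i = act I Y w v i"
  using assms(3) by (induction w arbitrary: i) (auto simp: assms(1,2) intro!: sum.cong)

lemma moment_cong:
  assumes "\<And>j i k. i \<in> I \<Longrightarrow> k \<in> I \<Longrightarrow> X j i k = Y j i k" "\<And>i. i \<in> I \<Longrightarrow> u i = v i"
  shows "moment I X u w = moment I Y v w"
  unfolding moment_def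
proof (intro sum.cong refl)
  fix i assume "i \<in> I"
  then show "u i * act I X w u i = v i * act I Y w v i"
    using act_cong[of I X Y u v i w] assms by simp
qed

lemma act_adjoint:
  assumes "sym_kernels I X"
  shows "(\<Sum>i\<in>I. u i * act I X w v i) = (\<Sum>i\<in>I. act I X (rev w) u i * v i)"
proof (induction w arbitrary: u)
  case (Cons j w)
  have "(\<Sum>i\<in>I. u i * act I X (j # w) v i) = (\<Sum>i\<in>I. \<Sum>k\<in>I. u i * (X j i k * act I X w v k))"
    by (simp add: sum_distrib_left)
  also have "\<dots> = (\<Sum>k\<in>I. \<Sum>i\<in>I. u i * (X j i k * act I X w v k))"
    by (rule sum.swap)
  also have "\<dots> = (\<Sum>k\<in>I. (\<Sum>i\<in>I. X j k i * u i) * act I X w v k)"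
    using assms by (auto simp: sum_distrib_left sum_distrib_right sym_kernels_def mult_ac intro!: sum.cong)
  also have "\<dots> = (\<Sum>k\<in>I. act I X [j] u k * act I X w v k)" by simp
  finally show ?case by (simp only: Cons.IH rev.simps act_append)
qed simp

lemma moment_rev_append:
  assumes "sym_kernels I X"
  shows "moment I X v (rev a @ b) = (\<Sum>i\<in>I. act I X a v i * act I X b v i)"
  using act_adjoint[OF assms, of v "rev a" "act I X b v"] by (simp add: moment_def act_append)

lemma act_sum:
  "act I X w (\<lambda>i. \<Sum>s\<in>S. c s * v s i) i = (\<Sum>s\<in>S. c s * act I X w (v s) i)"
proof (induction w arbitrary: i)
  case (Cons j w)
  have "act I X (j # w) (\<lambda>i. \<Sum>s\<in>S. c s * v s i) i = (\<Sum>k\<in>I. \<Sum>s\<in>S. c s * (X j i k * act I X w (v s) k))"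
    by (simp add: Cons sum_distrib_left mult_ac)
  then show ?case
    by (simp add: sum.swap[of _ S I] sum_distrib_left)
qed simp

lemma act_expand:
  assumes "finite I" "i \<in> I"
  shows "act I X w f i = (\<Sum>k\<in>I. act I X w (\<lambda>l. if l = k then 1 else 0) i * f k)"
proof -
  have "act I X w f i = act I X w (\<lambda>l. \<Sum>k\<in>I. f k * (if l = k then 1 else 0)) i"
    by (rule act_cong) (use assms in \<open>auto simp: if_distrib[of "\<lambda>c. _ * c"] cong: if_cong\<close>)
  then show ?thesis by (simp add: act_sum mult.commute)
qed

lemma act_scale: "act I X w (\<lambda>i. c * v i) i = c * act I X w v i"
  by (induction w arbitrary: i) (simp_all add: sum_distrib_left mult_ac)

lemma act_scale_kernels: "act I (\<lambda>j i k. s * X j i k) w v i = s ^ length w * act I X w v i"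
  by (induction w arbitrary: i) (simp_all add: sum_distrib_left mult_ac)

lemma moment_scale: "moment I X (\<lambda>i. c * v i) w = c\<^sup>2 * moment I X v w"
  by (simp add: moment_def act_scale sum_distrib_left power2_eq_square mult_ac)

lemma moment_scale_kernels: "moment I (\<lambda>j i k. s * X j i k) v w = s ^ length w * moment I X v w"
  by (simp add: moment_def act_scale_kernels sum_distrib_left mult_ac)

lemma act_reindex:
  assumes "bij_betw e J I" "i \<in> J"
  shows "act J (\<lambda>j a b. X j (e a) (e b)) w (\<lambda>a. v (e a)) i = act I X w v (e i)"
  using assms(2)
proof (induction w arbitrary: i)
  case (Cons j w)
  show ?case 
    using Cons by (simp add: sum.reindex_bij_betw[OF assms(1), symmetric])
qed simp

lemma moment_reindex:
  assumes "bij_betw e J I"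
  shows "moment J (\<lambda>j a b. X j (e a) (e b)) (\<lambda>a. v (e a)) w = moment I X v w"
  unfolding moment_def sum.reindex_bij_betw[OF assms, symmetric]
  by (intro sum.cong) (auto simp: act_reindex[OF assms])

fun dsum :: "('g \<Rightarrow> 'i \<Rightarrow> 'i \<Rightarrow> 'a::comm_semiring_1) \<Rightarrow> ('g \<Rightarrow> 'k \<Rightarrow> 'k \<Rightarrow> 'a) \<Rightarrow> 'g \<Rightarrow> 'i + 'k \<Rightarrow> 'i + 'k \<Rightarrow> 'a" where
  "dsum X Y j (Inl a) (Inl b) = X j a b"
| "dsum X Y j (Inr a) (Inr b) = Y j a b"
| "dsum X Y j _ _ = 0"

lemma moment_direct_sum:
  assumes "finite I" "finite J"
  shows "moment (I <+> J) (dsum X Y) (case_sum u v) w = moment I X u w + moment J Y v w"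
proof -
  have "act (I <+> J) (dsum X Y) w (case_sum u v) = case_sum (act I X w u) (act J Y w v)"
    by (induction w) (auto simp: sum.Plus assms fun_eq_iff split: sum.split)
  then show ?thesis by (simp add: moment_def sum.Plus assms)
qed

section \<open>Pairing a polynomial with a functional on words\<close>

definition pairing :: "'g free_poly \<Rightarrow> ('g list \<Rightarrow> real) \<Rightarrow> real" where
  "pairing p f = (\<Sum>w\<in>Poly_Mapping.keys p. Poly_Mapping.lookup p w * f (letters w))"

lemma pairing_superset:
  assumes "finite S" "Poly_Mapping.keys p \<subseteq> S"
  shows "pairing p f = (\<Sum>w\<in>S. Poly_Mapping.lookup p w * f (letters w))"
  unfolding pairing_def using assms
  by (intro sum.mono_neutral_left) (auto simp: in_keys_iff)

lemma pairing_zero [simp]: "pairing 0 f = 0"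
  by (simp add: pairing_def)

lemma pairing_single [simp]: "pairing (Poly_Mapping.single w c) f = c * f (letters w)"
  by (simp add: pairing_superset[of "{w}"])

lemma pairing_add: "pairing (p + q) f = pairing p f + pairing q f"
proof -
  let ?S = "Poly_Mapping.keys p \<union> Poly_Mapping.keys q"
  have "pairing (p + q) f = (\<Sum>w\<in>?S. Poly_Mapping.lookup (p + q) w * f (letters w))"
    by (rule pairing_superset) (simp_all add: Poly_Mapping.keys_add)
  moreover have "pairing p f = (\<Sum>w\<in>?S. Poly_Mapping.lookup p w * f (letters w))"
    by (rule pairing_superset) auto
  moreover have "pairing q f = (\<Sum>w\<in>?S. Poly_Mapping.lookup q w * f (letters w))"
    by (rule pairing_superset) auto
  ultimately show ?thesis by (simp add: lookup_add algebra_simps sum.distrib)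
qed

lemma pairing_uminus: "pairing (- p) f = - pairing p f"
  using pairing_add[of p "-p" f] by simp

lemma pairing_sum: "pairing (\<Sum>x\<in>A. q x) f = (\<Sum>x\<in>A. pairing (q x) f)"
  by (induction A rule: infinite_finite_induct) (simp_all add: pairing_add)

lemma pairing_sum_list: "pairing (\<Sum>x\<leftarrow>xs. q x) f = (\<Sum>x\<leftarrow>xs. pairing (q x) f)"
  by (induction xs) (simp_all add: pairing_add)

lemma pairing_add_right: "pairing p (\<lambda>w. f w + g w) = pairing p f + pairing p g"
  by (simp add: pairing_def algebra_simps sum.distrib)

lemma pairing_scale_right: "pairing p (\<lambda>w. c * f w) = c * pairing p f"
  by (simp add: pairing_def sum_distrib_left mult_ac)

lemma pairing_delta: "pairing p (\<lambda>w. if w = u then 1 else 0) = Poly_Mapping.lookup p (Word u)"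
proof -
  have "letters w = u \<longleftrightarrow> w = Word u" for w :: "'a free_word" by (cases w) auto
  then show ?thesis by (simp add: pairing_def if_distrib[of "\<lambda>c. _ * c"] in_keys_iff cong: if_cong)
qed

lemma poly_as_sum: "p = (\<Sum>w\<in>Poly_Mapping.keys p. Poly_Mapping.single w (Poly_Mapping.lookup p w))"
  by (rule poly_mapping_eqI) (auto simp: lookup_sum lookup_single when_def in_keys_iff)

lemma word_star_involutive [simp]: "word_star (word_star w) = w"
  by (cases w) (simp add: word_star_def)

lemma letters_word_star: "letters (word_star w) = rev (letters w)"
  by (simp add: word_star_def)

lemma lookup_star: "Poly_Mapping.lookup (star p) w = Poly_Mapping.lookup p (word_star w)"
proof -
  have "Poly_Mapping.lookup (star p) w 
      = (\<Sum>u\<in>Poly_Mapping.keys p. if u = word_star w then Poly_Mapping.lookup p u else 0)"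
    unfolding star_def lookup_sum lookup_single when_def
    by (intro sum.cong) auto
  also have "\<dots> = Poly_Mapping.lookup p (word_star w)"
    by (auto simp: in_keys_iff)
  finally show ?thesis .
qed

lemma star_sum: "star (\<Sum>x\<in>A. q x) = (\<Sum>x\<in>A. star (q x))"
  by (rule poly_mapping_eqI) (simp add: lookup_star lookup_sum)

lemma star_single [simp]: "star (Poly_Mapping.single w c) = Poly_Mapping.single (word_star w) c"
  by (rule poly_mapping_eqI) (auto simp add: lookup_star lookup_single when_def)

lemma symmetric_poly_lookup: "symmetric_poly p \<Longrightarrow> Poly_Mapping.lookup p (word_star w) = Poly_Mapping.lookup p w"
  by (metis symmetric_poly_def lookup_star)

lemma star_times_sum_single:
  "star (\<Sum>a\<in>A. Poly_Mapping.single (Word a) (h a)) * (\<Sum>b\<in>A. Poly_Mapping.single (Word b) (h b))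
    = (\<Sum>a\<in>A. \<Sum>b\<in>A. Poly_Mapping.single (Word (rev a @ b)) (h a * h b))"
  by (simp add: star_sum sum_product mult_single word_star_def plus_free_word_def)

lemma inj_letters: "inj letters"
  by (metis free_word.expand injI)

text \<open>
Reindexing by letter lists turns any polynomial into the shape that \<open>star_times_sum_single\<close> expects.
\<close>

lemma poly_as_sum_letters: 
  "p = (\<Sum>a\<in>letters ` Poly_Mapping.keys p. Poly_Mapping.single (Word a) (Poly_Mapping.lookup p (Word a)))"
  by (subst poly_as_sum, subst sum.reindex) (auto intro: inj_on_subset[OF inj_letters])

text \<open>
A hermitian square is evaluated to \<open>h(X)\<^sup>T h(X)\<close>, so its quadratic form is a squared norm.
\<close>

lemma pairing_square:
  assumes "sym_kernels I X"
  shows "pairing (star h * h) (moment I X v)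
     = (\<Sum>i\<in>I. (\<Sum>w\<in>Poly_Mapping.keys h. Poly_Mapping.lookup h w * act I X (letters w) v i)\<^sup>2)"
proof -
  let ?A = "letters ` Poly_Mapping.keys h" and ?c = "\<lambda>a. Poly_Mapping.lookup h (Word a)"
  have "star h * h = (\<Sum>a\<in>?A. \<Sum>b\<in>?A. Poly_Mapping.single (Word (rev a @ b)) (?c a * ?c b))"
    using star_times_sum_single[of ?c ?A] by (simp flip: poly_as_sum_letters)
  then have "pairing (star h * h) (moment I X v) 
     = (\<Sum>a\<in>?A. \<Sum>b\<in>?A. \<Sum>i\<in>I. ?c a * act I X a v i * (?c b * act I X b v i))"
    by (simp add: pairing_sum moment_rev_append[OF assms] sum_distrib_left mult_ac)
  also have "\<dots> = (\<Sum>i\<in>I. (\<Sum>a\<in>?A. ?c a * act I X a v i) * (\<Sum>b\<in>?A. ?c b * act I X b v i))"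
    by (simp add: sum_product sum.swap[of _ I])
  also have "\<dots> = (\<Sum>i\<in>I. (\<Sum>w\<in>Poly_Mapping.keys h. Poly_Mapping.lookup h w * act I X (letters w) v i)\<^sup>2)"
    by (simp add: sum.reindex[OF inj_on_subset[OF inj_letters]] power2_eq_square)
  finally show ?thesis .
qed

section \<open>The truncated Fock space\<close>

definition words :: "nat \<Rightarrow> 'g list set" where
  "words K = {w. length w \<le> K}"

text \<open>
The sum of the creation and the annihilation operator of the letter \<open>j\<close>, in the basis of words.
\<close>

definition fock :: "'g \<Rightarrow> 'g list \<Rightarrow> 'g list \<Rightarrow> real" where
  "fock j a b = (if a = j # b \<or> b = j # a then 1 else 0)"

definition vacuum :: "'g list \<Rightarrow> real" where
  "vacuum a = (if a = [] then 1 else 0)"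

lemma finite_words [simp]: "finite (words K :: 'g::finite list set)"
  using finite_lists_length_le[of "UNIV :: 'g set" K] by (simp add: words_def)

lemma sym_fock: "sym_kernels I fock"
  by (auto simp: sym_kernels_def fock_def)

text \<open>
Each letter lengthens a word by at most one, and the only way to reach full length is to create
every letter. So \<open>w(X)\<close> maps the vacuum to \<open>w\<close> plus shorter words.
\<close>

lemma act_fock_vacuum:
  fixes w :: "'g::finite list"
  assumes "length w \<le> K" "length w \<le> length a"
  shows "act (words K) fock w vacuum a = (if a = w then 1 else 0)"
  using assms
proof (induction w arbitrary: a)
  case Nil
  then show ?case by (simp add: vacuum_def)
next
  case (Cons j w)
  have "fock j a b * act (words K) fock w vacuum b = (if b = w then if a = j # w then 1 else 0 else 0)" for b
  proof (cases "length b \<ge> length w")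
    case True
    then have "act (words K) fock w vacuum b = (if b = w then 1 else 0)"
      using Cons by simp
    moreover have "w \<noteq> j # a" using Cons.prems by auto
    ultimately show ?thesis by (auto simp: fock_def)
  next
    case False
    then have "fock j a b = 0" using Cons.prems by (auto simp: fock_def)
    then show ?thesis using False by auto
  qed
  then have "act (words K) fock (j # w) vacuum a = (\<Sum>b\<in>words K. if b = w then if a = j # w then 1 else 0 else 0)"
    by simp
  also have "\<dots> = (if a = j # w then 1 else 0)"
    using Cons.prems finite_words[of K] by (subst sum.delta) (auto simp: words_def)
  finally show ?case .
qed

text \<open>
By the triangular shape of \<open>act_fock_vacuum\<close>, the vectors \<open>w(X)\<close> applied to the vacuum are linearly
independent; a linear functional with prescribed values on them is found by recursion on the
length.
\<close>

lemma fock_dual: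
  fixes L :: "'g::finite list \<Rightarrow> real"
  shows "\<exists>l. \<forall>w. length w \<le> K \<longrightarrow> (\<Sum>a\<in>words K. l a * act (words K) fock w vacuum a) = L w"
proof -
  let ?A = "\<lambda>w a. act (words K) fock w vacuum a"
  have "\<exists>l. \<forall>w. length w < k \<longrightarrow> (\<Sum>a\<in>words K. l a * ?A w a) = L w" if "k \<le> Suc K" for k
    using that
  proof (induction k)
    case (Suc k)
    then obtain l where l: "\<And>w. length w < k \<Longrightarrow> (\<Sum>a\<in>words K. l a * ?A w a) = L w" by auto
    define l' where "l' a = l a + (if length a = k then L a - (\<Sum>b\<in>words K. l b * ?A a b) else 0)" for a
    have "(\<Sum>a\<in>words K. l' a * ?A w a) = L w" if w: "length w < Suc k" for w
    proof -
      let ?c = "L w - (\<Sum>b\<in>words K. l b * ?A w b)"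
      have "(if length a = k then L a - (\<Sum>b\<in>words K. l b * ?A a b) else 0) * ?A w a
           = (if a = w then if length w = k then ?c else 0 else 0)" for a
        using w Suc.prems by (auto simp: act_fock_vacuum)
      then have "(\<Sum>a\<in>words K. l' a * ?A w a) 
          = (\<Sum>a\<in>words K. l a * ?A w a) + (if length w = k then ?c else 0)"
        using w Suc.prems unfolding l'_def ring_distribs sum.distrib
        by (simp add: words_def[of K, THEN eqset_imp_iff])
      then show ?thesis using l[of w] w by auto
    qed
    then show ?case by blast
  qed auto
  from this[of "Suc K"] show ?thesis by (simp add: less_Suc_eq_le)
qed

section \<open>Positive semidefinite kernels\<close>

definition psd :: "'i set \<Rightarrow> ('i \<Rightarrow> 'i \<Rightarrow> real) \<Rightarrow> bool" where
  "psd I M \<longleftrightarrow> (\<forall>i\<in>I. \<forall>k\<in>I. M i k = M k i) \<and> (\<forall>f. 0 \<le> (\<Sum>i\<in>I. \<Sum>k\<in>I. f i * f k * M i k))"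

text \<open>
One step of Gaussian elimination: subtract the rank-one kernel built from the row of \<open>x\<close>. The rest is
a Schur complement, again positive semidefinite. If the pivot is zero, its whole row is zero.
\<close>

lemma psd_decomposition:
  assumes "finite I" "psd I M"
  shows "\<exists>s. \<forall>i\<in>I. \<forall>k\<in>I. M i k = (\<Sum>x\<in>I. s x i * s x k)"
  using assms
proof (induction I arbitrary: M rule: finite_induct)
  case (insert x I)
  have sym: "M i k = M k i" if "i \<in> insert x I" "k \<in> insert x I" for i k
    using insert.prems that unfolding psd_def by blast
  have pos: "0 \<le> (\<Sum>i\<in>I. \<Sum>k\<in>I. f i * f k * M i k) + 2 * t * (\<Sum>i\<in>I. f i * M x i) + t\<^sup>2 * M x x" for f t
  proof -
    define g where "g = f(x := t)"
    have g: "g i = f i" if "i \<in> I" for i using that insert.hyps by (auto simp: g_def)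
    have "0 \<le> (\<Sum>i\<in>insert x I. \<Sum>k\<in>insert x I. g i * g k * M i k)"
      using insert.prems unfolding psd_def by blast
    also have "\<dots> = (\<Sum>i\<in>I. \<Sum>k\<in>I. g i * g k * M i k) + (\<Sum>i\<in>I. g i * g x * M i x)
         + (\<Sum>k\<in>I. g x * g k * M x k) + g x * g x * M x x"
      using insert.hyps by (simp add: sum.distrib)
    also have "(\<Sum>i\<in>I. g i * g x * M i x) = t * (\<Sum>i\<in>I. f i * M x i)"
      by (simp add: sum_distrib_left g sym mult_ac g_def[THEN fun_cong, of x])
    also have "(\<Sum>k\<in>I. g x * g k * M x k) = t * (\<Sum>i\<in>I. f i * M x i)"
      by (simp add: sum_distrib_left g mult_ac g_def[THEN fun_cong, of x])
    finally show ?thesis by (simp add: g power2_eq_square g_def[THEN fun_cong, of x])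
  qed
  define d where "d = M x x"
  have d0: "d \<ge> 0" using pos[of "\<lambda>_. 0" 1] by (simp add: d_def)
  have zero: "M x i = 0" if "d = 0" "i \<in> I" for i
  proof (rule ccontr)
    assume nz: "M x i \<noteq> 0"
    have *: "0 \<le> (\<Sum>a\<in>I. \<Sum>b\<in>I. (if a = i then 1 else 0) * (if b = i then 1 else 0) * M a b) 
        + 2 * t * (\<Sum>a\<in>I. (if a = i then 1 else 0) * M x a) + t\<^sup>2 * M x x"
      for t by (rule pos)
    have "0 \<le> M i i + 2 * t * M x i" for t
    proof -
      have "(\<Sum>a\<in>I. \<Sum>b\<in>I. (if a = i then 1 else 0) * (if b = i then 1 else 0) * M a b) 
          = (\<Sum>a\<in>I. if a = i then \<Sum>b\<in>I. if b = i then M i i else 0 else 0)"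
        by (intro sum.cong refl) (auto intro: sum.neutral sum.cong)
      also have "\<dots> = M i i" using that insert.hyps by simp
      moreover have "(\<Sum>a\<in>I. (if a = i then 1 else 0) * M x a) = (\<Sum>a\<in>I. if a = i then M x i else 0)"
        by (intro sum.cong) auto
      ultimately show ?thesis 
        using that insert.hyps * [of t] by (simp add: d_def)
    qed
    from this[of "- (M i i + 1) / (2 * M x i)"] 
    have "0 \<le> M i i + 2 * (- (M i i + 1) / (2 * M x i)) * M x i" .
    moreover have "M i i + 2 * (- (M i i + 1) / (2 * M x i)) * M x i = -1" using nz by (simp add: field_simps)
    ultimately show False by simp
  qed
  define N where "N i k = M i k - M x i * M x k / d" for i k
  have "psd I N" unfolding psd_def
  proof (intro conjI ballI allI)
    fix i k assume "i \<in> I" "k \<in> I"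
    then show "N i k = N k i" using sym by (simp add: N_def mult.commute)
  next
    fix f :: "'a \<Rightarrow> real"
    let ?S = "\<Sum>i\<in>I. f i * M x i"
    have "(\<Sum>i\<in>I. \<Sum>k\<in>I. f i * f k * N i k) 
        = (\<Sum>i\<in>I. \<Sum>k\<in>I. f i * f k * M i k) - (\<Sum>i\<in>I. \<Sum>k\<in>I. (f i * M x i) * (f k * M x k) / d)"
      by (simp add: N_def algebra_simps sum_subtractf)
    also have "(\<Sum>i\<in>I. \<Sum>k\<in>I. (f i * M x i) * (f k * M x k) / d) = ?S\<^sup>2 / d"
      by (simp add: power2_eq_square sum_product sum_divide_distrib)
    also have "0 \<le> (\<Sum>i\<in>I. \<Sum>k\<in>I. f i * f k * M i k) - ?S\<^sup>2 / d"
    proof (cases "d = 0")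
      case True
      then show ?thesis using pos[of f 0] by simp
    next
      case False
      then have "2 * (- ?S / d) * ?S + (- ?S / d)\<^sup>2 * d = - ?S\<^sup>2 / d"
        by (simp add: field_simps power2_eq_square)
      then show ?thesis using pos[of f "- ?S / d"] by (simp add: d_def)
    qed
    finally show "0 \<le> (\<Sum>i\<in>I. \<Sum>k\<in>I. f i * f k * N i k)" .
  qed
  then obtain s where s: "\<And>i k. i \<in> I \<Longrightarrow> k \<in> I \<Longrightarrow> N i k = (\<Sum>x\<in>I. s x i * s x k)"
    using insert.IH by blast
  define s' where "s' y i = (if y = x then M x i / sqrt d else if i = x then 0 else s y i)" for y i
  have "M i k = (\<Sum>y\<in>insert x I. s' y i * s' y k)" if "i \<in> insert x I" "k \<in> insert x I" for i k
  proof -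
    have "(\<Sum>y\<in>I. s' y i * s' y k) = (\<Sum>y\<in>I. if i = x \<or> k = x then 0 else s y i * s y k)"
      using insert.hyps by (intro sum.cong) (auto simp: s'_def)
    also have "\<dots> = (if i = x \<or> k = x then 0 else N i k)"
      using that by (auto simp: s)
    finally have 1: "(\<Sum>y\<in>insert x I. s' y i * s' y k) = M x i * M x k / d + (if i = x \<or> k = x then 0 else N i k)"
      using insert.hyps d0 by (simp add: s'_def)
    show ?thesis
    proof (cases "d = 0")
      case True
      have z: "M x a = 0" if "a \<in> insert x I" for a using zero[OF True] True that by (auto simp: d_def)
      then show ?thesis using 1 that sym[of i k] z[of k] z[of i] by (auto simp: N_def)
    next
      case False
      then show ?thesis using 1 that sym[of i k] by (auto simp: N_def d_def[symmetric])
    qed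
  qed
  then show ?case by blast
qed auto

text \<open>
Square matrices over a field: injectivity gives a nonzero determinant, hence a two-sided inverse.
\<close>

lemma injective_kernel_inverse:
  fixes S :: "'i \<Rightarrow> 'i \<Rightarrow> real"
  assumes "finite I" and inj: "\<And>f. (\<And>i. i \<in> I \<Longrightarrow> (\<Sum>k\<in>I. S i k * f k) = 0) \<Longrightarrow> (\<forall>k\<in>I. f k = 0)"
  shows "\<exists>C. (\<forall>i\<in>I. \<forall>k\<in>I. (\<Sum>l\<in>I. C i l * S l k) = (if i = k then 1 else 0)) \<and>
             (\<forall>i\<in>I. \<forall>k\<in>I. (\<Sum>l\<in>I. S i l * C l k) = (if i = k then 1 else 0))"
proof -
  define n where "n = card I"
  obtain e where e: "bij_betw e {0..<n} I"
    using ex_bij_betw_nat_finite[OF assms(1)] n_def by blast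
  define e' where "e' = inv_into {0..<n} e"
  have e': "e' i < n" "e (e' i) = i" if "i \<in> I" for i
    using bij_betwE[OF bij_betw_inv_into[OF e]] bij_betw_inv_into_right[OF e] that 
    unfolding e'_def by (meson atLeastLessThan_iff, simp)
  have e'e: "e' (e a) = a" if "a < n" for a
    using that e by (simp add: e'_def bij_betw_inv_into_left)
  have eI: "e a \<in> I" if "a < n" for a using that bij_betwE[OF e] by auto
  define A where "A = mat n n (\<lambda>(a, b). S (e a) (e b))"
  have A: "A \<in> carrier_mat n n" by (simp add: A_def)
  have "det A \<noteq> 0"
  proof
    assume "det A = 0"
    then obtain v where v: "v \<in> carrier_vec n" "v \<noteq> 0\<^sub>v n" "A *\<^sub>v v = 0\<^sub>v n"
      using det_0_iff_vec_prod_zero_field[OF A] by blast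
    have "(\<Sum>k\<in>I. S i k * v $ e' k) = 0" if "i \<in> I" for i
    proof -
      have "(\<Sum>k\<in>I. S i k * v $ e' k) = (\<Sum>b\<in>{0..<n}. S i (e b) * v $ b)"
        by (subst sum.reindex_bij_betw[OF e, symmetric]) (simp add: e'e)
      also have "\<dots> = (A *\<^sub>v v) $ e' i"
        using v(1) that e'[OF that] by (simp add: A_def scalar_prod_def)
      finally show ?thesis using v(3) e'[OF that] by simp
    qed
    then have z: "v $ e' k = 0" if "k \<in> I" for k using inj[of "\<lambda>k. v $ e' k"] that by auto
    have "v $ a = 0" if "a < n" for a using z[OF eI[OF that]] by (simp add: e'e[OF that])
    then have "v = 0\<^sub>v n" using v(1) by (intro eq_vecI) auto
    then show False using v(2) by simp
  qed
  then obtain B where B: "B \<in> carrier_mat n n" "B * A = 1\<^sub>m n" "A * B = 1\<^sub>m n"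
    using det_non_zero_imp_unit[OF A, of "()"] unfolding Units_def ring_mat_simps by blast
  have *: "(\<Sum>l\<in>I. P $$ (e' i, e' l) * R $$ (e' l, e' k)) = (if i = k then 1 else 0)"
    if "P * R = 1\<^sub>m n" "P \<in> carrier_mat n n" "R \<in> carrier_mat n n" "i \<in> I" "k \<in> I" for P R :: "real mat" and i k
  proof -
    have "(\<Sum>l\<in>I. P $$ (e' i, e' l) * R $$ (e' l, e' k)) = (\<Sum>b\<in>{0..<n}. P $$ (e' i, b) * R $$ (b, e' k))"
      by (subst sum.reindex_bij_betw[OF e, symmetric]) (simp add: e'e)
    also have "\<dots> = (P * R) $$ (e' i, e' k)"
      using that(2-) e' by (simp add: scalar_prod_def)
    also have "\<dots> = (if i = k then 1 else 0)"
    proof -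
      have "e' i = e' k \<longleftrightarrow> i = k" using e'(2)[OF that(4)] e'(2)[OF that(5)] by metis
      then show ?thesis using e'(1)[OF that(4)] e'(1)[OF that(5)] by (simp add: that(1))
    qed
    finally show ?thesis .
  qed
  have AS: "A $$ (e' i, e' k) = S i k" if "i \<in> I" "k \<in> I" for i k
    using e'[OF that(1)] e'[OF that(2)] by (simp add: A_def)
  show ?thesis
  proof (intro exI[of _ "\<lambda>i k. B $$ (e' i, e' k)"] conjI ballI)
    fix i k assume ik: "i \<in> I" "k \<in> I"
    show "(\<Sum>l\<in>I. B $$ (e' i, e' l) * S l k) = (if i = k then 1 else 0)"
      using *[OF B(2) B(1) A ik] ik by (simp add: AS cong: sum.cong)
    show "(\<Sum>l\<in>I. S i l * B $$ (e' l, e' k)) = (if i = k then 1 else 0)"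
      using *[OF B(3) A B(1) ik] ik by (simp add: AS cong: sum.cong)
  qed
qed

section \<open>Positive polynomials are sums of squares\<close>

text \<open>
The Gelfand--Naimark--Segal construction in finite dimension. Write the Gram matrix of \<open>lam\<close> on words
of length at most \<open>d\<close> as \<open>S\<^sup>T S\<close> with \<open>S\<close> invertible. The vectors \<open>S w\<close> then carry the right inner
products, and it remains to find symmetric operators that map \<open>S w\<close> to \<open>S (j # w)\<close> for
\<open>length w < d\<close>. The bilinear form \<open>lam (rev a @ j # b)\<close> prescribes them; where it would need words
longer than \<open>2 * d\<close> it is replaced by \<open>0\<close>, which keeps it symmetric.
\<close>

lemma gns:
  fixes lam :: "'g::finite list \<Rightarrow> real"
  assumes sym: "\<And>w. lam (rev w) = lam w"
    and pd: "\<And>f. \<exists>a\<in>words d. f a \<noteq> 0 \<Longrightarrow> 0 < (\<Sum>a\<in>words d. \<Sum>b\<in>words d. f a * f b * lam (rev a @ b))"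
  shows "\<exists>X v. sym_kernels (words d :: 'g list set) X \<and>
     (\<forall>w. length w \<le> 2 * d \<longrightarrow> moment (words d :: 'g list set) X v w = lam w)"
proof -
  let ?W = "words d :: 'g list set"
  have fin: "finite ?W" by simp
  have sym': "lam (rev a @ b) = lam (rev b @ a)" for a b
    using sym[of "rev a @ b"] by simp
  have "psd ?W (\<lambda>a b. lam (rev a @ b))"
    unfolding psd_def using sym'
  proof (intro conjI ballI allI)
    fix f
    show "0 \<le> (\<Sum>a\<in>?W. \<Sum>b\<in>?W. f a * f b * lam (rev a @ b))"
      using pd[of f] by (cases "\<exists>a\<in>?W. f a \<noteq> 0") (auto intro: less_imp_le)
  qed auto
  then obtain S where S: "\<And>a b. a \<in> ?W \<Longrightarrow> b \<in> ?W \<Longrightarrow> lam (rev a @ b) = (\<Sum>x\<in>?W. S x a * S x b)"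
    using psd_decomposition[OF fin] by blast
  have "\<forall>k\<in>?W. f k = 0" if f: "\<And>i. i \<in> ?W \<Longrightarrow> (\<Sum>k\<in>?W. S i k * f k) = 0" for f
  proof -
    have "(\<Sum>a\<in>?W. \<Sum>b\<in>?W. f a * f b * lam (rev a @ b)) = (\<Sum>a\<in>?W. \<Sum>b\<in>?W. \<Sum>x\<in>?W. (S x a * f a) * (S x b * f b))"
      by (intro sum.cong refl) (simp add: S sum_distrib_left mult_ac)
    also have "\<dots> = (\<Sum>x\<in>?W. (\<Sum>a\<in>?W. S x a * f a) * (\<Sum>b\<in>?W. S x b * f b))"
      unfolding sum_product by (subst (2) sum.swap, subst sum.swap) (rule refl)
    also have "\<dots> = 0" using f by simp
    finally show ?thesis using pd[of f] by force
  qed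
  then obtain C where C: "\<And>i k. i \<in> ?W \<Longrightarrow> k \<in> ?W \<Longrightarrow> (\<Sum>l\<in>?W. C i l * S l k) = (if i = k then 1 else 0)"
      "\<And>i k. i \<in> ?W \<Longrightarrow> k \<in> ?W \<Longrightarrow> (\<Sum>l\<in>?W. S i l * C l k) = (if i = k then 1 else 0)"
    using injective_kernel_inverse[OF fin, of S] by blast
  define Lam where "Lam j a b = (if length a + length b < 2 * d then lam (rev a @ j # b) else 0)" for j a b
  define X where "X j x y = (\<Sum>a\<in>?W. \<Sum>b\<in>?W. C a x * Lam j a b * C b y)" for j x y
  have Lam_sym: "Lam j a b = Lam j b a" for j a b
    using sym'[of a "j # b"] sym'[of b "j # a"] sym[of "rev a @ j # b"] by (simp add: Lam_def add.commute)
  have symX: "sym_kernels ?W X"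
    unfolding sym_kernels_def X_def
  proof (intro allI ballI)
    fix j x y
    show "(\<Sum>a\<in>?W. \<Sum>b\<in>?W. C a x * Lam j a b * C b y) = (\<Sum>a\<in>?W. \<Sum>b\<in>?W. C a y * Lam j a b * C b x)"
      by (subst sum.swap) (simp add: Lam_sym[of j] mult_ac)
  qed
  have act: "act ?W X w (\<lambda>x. S x []) x = S x w" if "length w \<le> d" "x \<in> ?W" for w x
    using that
  proof (induction w arbitrary: x)
    case (Cons j w)
    then have w: "w \<in> ?W" "j # w \<in> ?W" by (auto simp: words_def)
    have "act ?W X (j # w) (\<lambda>x. S x []) x = (\<Sum>y\<in>?W. X j x y * S y w)"
      using Cons by simp
    also have "\<dots> = (\<Sum>y\<in>?W. \<Sum>a\<in>?W. \<Sum>b\<in>?W. C a x * Lam j a b * (C b y * S y w))"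
      by (simp add: X_def sum_distrib_left sum_distrib_right mult_ac)
    also have "\<dots> = (\<Sum>a\<in>?W. \<Sum>b\<in>?W. \<Sum>y\<in>?W. C a x * Lam j a b * (C b y * S y w))"
      by (subst sum.swap, rule sum.cong[OF refl], rule sum.swap)
    also have "\<dots> = (\<Sum>a\<in>?W. \<Sum>b\<in>?W. C a x * Lam j a b * (if b = w then 1 else 0))"
      by (simp add: C(1)[OF _ w(1)] flip: sum_distrib_left)
    also have "\<dots> = (\<Sum>a\<in>?W. C a x * Lam j a w)"
      using w by (simp add: if_distrib[of "\<lambda>c. _ * c"] cong: if_cong)
    also have "\<dots> = (\<Sum>a\<in>?W. C a x * (\<Sum>y\<in>?W. S y a * S y (j # w)))"
    proof (intro sum.cong refl)
      fix a assume a: "a \<in> ?W"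
      then have "length a + length w < 2 * d" using Cons.prems by (simp add: words_def)
      then show "C a x * Lam j a w = C a x * (\<Sum>y\<in>?W. S y a * S y (j # w))"
        using S[OF a w(2)] by (simp add: Lam_def)
    qed
    also have "\<dots> = (\<Sum>y\<in>?W. (\<Sum>a\<in>?W. S y a * C a x) * S y (j # w))"
      unfolding sum_distrib_left sum_distrib_right by (subst sum.swap) (simp only: mult_ac)
    also have "\<dots> = S x (j # w)"
      using Cons.prems by (simp add: C(2) if_distrib[of "\<lambda>c. c * _"] cong: if_cong)
    finally show ?case .
  qed simp
  have "moment ?W X (\<lambda>x. S x []) w = lam w" if "length w \<le> 2 * d" for w
  proof -
    define a where "a = rev (take d w)"
    define b where "b = drop d w"
    have ab: "w = rev a @ b" "length a \<le> d" "length b \<le> d" using that by (auto simp: a_def b_def)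
    have "moment ?W X (\<lambda>x. S x []) w = (\<Sum>x\<in>?W. S x a * S x b)"
      unfolding ab(1) moment_rev_append[OF symX] using ab by (intro sum.cong) (auto simp: act)
    then show ?thesis using S[of a b] ab by (simp add: words_def)
  qed
  then show ?thesis using symX by (intro exI[of _ X] exI[of _ "\<lambda>x. S x []"]) simp
qed

definition gram :: "nat \<Rightarrow> ('g list \<times> 'g list \<Rightarrow> real) \<Rightarrow> 'g list \<Rightarrow> 'g list \<Rightarrow> real" where
  "gram d h a b = (\<Sum>k\<in>words d. h (k, a) * h (k, b))"

text \<open>
The coefficient of \<open>w\<close> in \<open>\<Sum> a\<^sup>* G(a, b) b\<close>.
\<close>

definition collect :: "nat \<Rightarrow> ('g list \<Rightarrow> 'g list \<Rightarrow> real) \<Rightarrow> 'g list \<Rightarrow> real" where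
  "collect d G w = (\<Sum>a\<in>words d. \<Sum>b\<in>words d. if rev a @ b = w then G a b else 0)"

lemma sum_collect:
  fixes G :: "'g::finite list \<Rightarrow> 'g list \<Rightarrow> real"
  shows "(\<Sum>w\<in>words (2 * d). collect d G w * f w) = (\<Sum>a\<in>words d. \<Sum>b\<in>words d. G a b * f (rev a @ b))"
proof -
  have "(\<Sum>w\<in>words (2 * d). collect d G w * f w) 
     = (\<Sum>a\<in>words d. \<Sum>w\<in>words (2 * d). \<Sum>b\<in>words d. if rev a @ b = w then G a b * f w else 0)"
    unfolding collect_def sum_distrib_right
    by (subst sum.swap) (intro sum.cong refl, simp)
  also have "\<dots> = (\<Sum>a\<in>words d. \<Sum>b\<in>words d. \<Sum>w\<in>words (2 * d). if rev a @ b = w then G a b * f w else 0)"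
    by (rule sum.cong[OF refl], rule sum.swap)
  also have "\<dots> = (\<Sum>a\<in>words d. \<Sum>b\<in>words d. G a b * f (rev a @ b))"
  proof (intro sum.cong refl)
    fix a b :: "'g list" assume "a \<in> words d" "b \<in> words d"
    then have "rev a @ b \<in> words (2 * d)" by (simp add: words_def)
    then show "(\<Sum>w\<in>words (2 * d). if rev a @ b = w then G a b * f w else 0) = G a b * f (rev a @ b)"
      by simp
  qed
  finally show ?thesis .
qed

lemma collect_add: "collect d (\<lambda>a b. G a b + H a b) w = collect d G w + collect d H w"
  unfolding collect_def sum.distrib[symmetric] by (intro sum.cong refl) simp

lemma collect_scale: "collect d (\<lambda>a b. c * G a b) w = c * collect d G w"
  unfolding collect_def sum_distrib_left by (intro sum.cong refl) simp

lemma collect_rev: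
  assumes "\<And>a b. G a b = G b a"
  shows "collect d G (rev w) = collect d G w"
proof -
  have "(rev a @ b = rev w) = (rev b @ a = w)" for a b :: "'a list"
    by (metis rev_append rev_rev_ident)
  then show ?thesis unfolding collect_def
    by (subst sum.swap) (simp add: assms cong: if_cong)
qed

lemma psd_gram: "psd I (gram d h)"
proof -
  have "(\<Sum>i\<in>I. \<Sum>k\<in>I. f i * f k * gram d h i k) = (\<Sum>x\<in>words d. (\<Sum>i\<in>I. f i * h (x, i))\<^sup>2)" for f
  proof -
    have "(\<Sum>i\<in>I. \<Sum>k\<in>I. f i * f k * gram d h i k) 
       = (\<Sum>i\<in>I. \<Sum>k\<in>I. \<Sum>x\<in>words d. (f i * h (x, i)) * (f k * h (x, k)))"
      by (simp add: gram_def sum_distrib_left mult_ac)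
    also have "\<dots> = (\<Sum>x\<in>words d. \<Sum>i\<in>I. \<Sum>k\<in>I. (f i * h (x, i)) * (f k * h (x, k)))"
      by (subst (2) sum.swap, subst sum.swap) (rule refl)
    finally show ?thesis by (simp add: power2_eq_square sum_product)
  qed
  then show ?thesis unfolding psd_def by (auto simp: gram_def mult.commute intro: sum_nonneg)
qed

text \<open>
Sums of as many squares as there are words of length at most \<open>d\<close> already form a convex cone; so the
number of squares can be fixed, and a nearest sum of squares sought over a fixed finite set of
parameters.
\<close>

lemma psd_as_gram:
  fixes G :: "'g::finite list \<Rightarrow> 'g list \<Rightarrow> real"
  assumes "psd (words d) G"
  shows "\<exists>h. \<forall>w. collect d (gram d h) w = collect d G w"
proof -
  obtain s :: "'g list \<Rightarrow> 'g list \<Rightarrow> real" 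
    where "\<And>a b. a \<in> words d \<Longrightarrow> b \<in> words d \<Longrightarrow> G a b = (\<Sum>x\<in>words d. s x a * s x b)"
    using psd_decomposition[OF finite_words assms] by auto
  then have "collect d (gram d (\<lambda>(x, a). s x a)) w = collect d G w" for w
    unfolding collect_def by (intro sum.cong refl) (simp add: gram_def)
  then show ?thesis by blast
qed

definition gram_error :: "nat \<Rightarrow> ('g list \<Rightarrow> real) \<Rightarrow> ('g list \<times> 'g list \<Rightarrow> real) \<Rightarrow> real" where
  "gram_error d Q h = (\<Sum>w\<in>words (2 * d). (collect d (gram d h) w - Q w)\<^sup>2)"

text \<open>
At the Fock tuple a sum of squares takes the value \<open>\<Sum>\<^sub>k \<parallel>h\<^sub>k(X)v\<parallel>\<^sup>2\<close> on the vacuum \<open>v\<close>, and by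
\<open>fock_dual\<close> every coefficient of \<open>h\<^sub>k\<close> is controlled by \<open>\<parallel>h\<^sub>k(X)v\<parallel>\<close>. Hence no cancellation can keep
a sum of squares bounded while the coefficients of its terms grow.
\<close>

lemma gram_error_coercive:
  fixes Q :: "'g::finite list \<Rightarrow> real"
  shows "\<exists>R. \<forall>h. gram_error d Q h \<le> E \<longrightarrow> (\<forall>k\<in>words d. \<forall>a\<in>words d. \<bar>h (k, a)\<bar> \<le> R)"
proof -
  let ?W = "words d :: 'g list set" and ?A = "\<lambda>w. act (words d :: 'g list set) fock w vacuum"
  have "\<exists>l. \<forall>w. length w \<le> d \<longrightarrow> (\<Sum>x\<in>?W. l x * ?A w x) = (if w = a then 1 else 0)" for a
    by (rule fock_dual)
  then obtain l where l: "\<And>a w. length w \<le> d \<Longrightarrow> (\<Sum>x\<in>?W. l a x * ?A w x) = (if w = a then 1 else 0)"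
    by metis
  define M where "M = (\<Sum>a\<in>?W. \<Sum>x\<in>?W. (l a x)\<^sup>2) 
    * (\<Sum>w\<in>words (2 * d). (\<bar>Q w\<bar> + sqrt E) * \<bar>moment ?W fock vacuum w\<bar>)"
  have "\<bar>h (k, a)\<bar> \<le> M + 1" if E: "gram_error d Q h \<le> E" and k: "k \<in> ?W" and a: "a \<in> ?W" for h k a
  proof -
    define u where "u k x = (\<Sum>b\<in>?W. h (k, b) * ?A b x)" for k x
    have "(\<Sum>x\<in>?W. l a x * u k x) = (\<Sum>b\<in>?W. h (k, b) * (\<Sum>x\<in>?W. l a x * ?A b x))"
      unfolding u_def sum_distrib_left by (subst sum.swap) (simp add: mult_ac)
    also have "\<dots> = (\<Sum>b\<in>?W. if b = a then h (k, b) else 0)"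
      by (intro sum.cong refl) (use l[of _ a] in \<open>auto simp: words_def\<close>)
    also have "\<dots> = h (k, a)" using a by simp
    finally have hu: "h (k, a) = (\<Sum>x\<in>?W. l a x * u k x)" by simp
    have C: "\<bar>collect d (gram d h) w\<bar> \<le> \<bar>Q w\<bar> + sqrt E" if w: "w \<in> words (2 * d)" for w
    proof -
      have "(collect d (gram d h) w - Q w)\<^sup>2 \<le> gram_error d Q h"
        unfolding gram_error_def by (rule member_le_sum[OF w]) auto
      then have "\<bar>collect d (gram d h) w - Q w\<bar> \<le> sqrt E"
        using E by (intro real_le_rsqrt) (simp add: power2_abs)
      then show ?thesis by linarith
    qed
    have "(h (k, a))\<^sup>2 \<le> (\<Sum>x\<in>?W. (l a x)\<^sup>2) * (\<Sum>x\<in>?W. (u k x)\<^sup>2)"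
      unfolding hu by (rule Cauchy_Schwarz_ineq_sum)
    also have "\<dots> \<le> (\<Sum>a\<in>?W. \<Sum>x\<in>?W. (l a x)\<^sup>2) * (\<Sum>k\<in>?W. \<Sum>x\<in>?W. (u k x)\<^sup>2)"
      using a k by (intro mult_mono member_le_sum[of a ?W "\<lambda>a. \<Sum>x\<in>?W. (l a x)\<^sup>2"] 
          member_le_sum[of k ?W "\<lambda>k. \<Sum>x\<in>?W. (u k x)\<^sup>2"] sum_nonneg) auto
    also have "(\<Sum>k\<in>?W. \<Sum>x\<in>?W. (u k x)\<^sup>2) 
        = (\<Sum>k\<in>?W. \<Sum>x\<in>?W. \<Sum>a\<in>?W. \<Sum>b\<in>?W. h (k, a) * h (k, b) * (?A a x * ?A b x))"
      unfolding u_def power2_eq_square sum_product by (simp add: mult_ac)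
    also have "\<dots> = (\<Sum>a\<in>?W. \<Sum>b\<in>?W. \<Sum>k\<in>?W. \<Sum>x\<in>?W. h (k, a) * h (k, b) * (?A a x * ?A b x))"
      by (rule sum_swap_2_2)
    also have "\<dots> = (\<Sum>a\<in>?W. \<Sum>b\<in>?W. gram d h a b * moment ?W fock vacuum (rev a @ b))"
      by (simp add: gram_def moment_rev_append[OF sym_fock] sum_product)
    also have "\<dots> = (\<Sum>w\<in>words (2 * d). collect d (gram d h) w * moment ?W fock vacuum w)"
      by (simp add: sum_collect)
    also have "\<dots> \<le> (\<Sum>w\<in>words (2 * d). (\<bar>Q w\<bar> + sqrt E) * \<bar>moment ?W fock vacuum w\<bar>)"
    proof (intro sum_mono)
      fix w :: "'g list" assume "w \<in> words (2 * d)"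
      then have "\<bar>collect d (gram d h) w\<bar> * \<bar>moment ?W fock vacuum w\<bar> 
          \<le> (\<bar>Q w\<bar> + sqrt E) * \<bar>moment ?W fock vacuum w\<bar>"
        by (intro mult_right_mono C) auto
      moreover have "collect d (gram d h) w * moment ?W fock vacuum w 
          \<le> \<bar>collect d (gram d h) w\<bar> * \<bar>moment ?W fock vacuum w\<bar>"
        by (simp flip: abs_mult)
      ultimately show "collect d (gram d h) w * moment ?W fock vacuum w 
          \<le> (\<bar>Q w\<bar> + sqrt E) * \<bar>moment ?W fock vacuum w\<bar>"
        by (rule order_trans[rotated])
    qed
    finally have "(h (k, a))\<^sup>2 \<le> M" 
      unfolding M_def by (simp add: mult_left_mono sum_nonneg)
    moreover have "\<bar>h (k, a)\<bar> \<le> (h (k, a))\<^sup>2 + 1"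
      using zero_le_power2[of "\<bar>h (k, a)\<bar> - 1/2"] by (simp add: power2_diff power2_eq_square algebra_simps) 
    ultimately show ?thesis by linarith
  qed
  then show ?thesis by blast
qed

text \<open>
Tychonoff's theorem. The box restricts all coordinates, so that no finite index set has to be singled out.
\<close>

lemma compact_box: "compact {h :: 'x \<Rightarrow> real. \<forall>p. h p \<in> {-R..R}}"
proof -
  have "compactin (product_topology (\<lambda>_::'x. euclidean :: real topology) UNIV) (PiE UNIV (\<lambda>_. {-R..R}))"
    unfolding compactin_PiE by simp
  then have "compactin euclidean (PiE (UNIV :: 'x set) (\<lambda>_. {-R..R}))"
    by (simp add: euclidean_product_topology)
  moreover have "PiE (UNIV :: 'x set) (\<lambda>_. {-R..R}) = {h. \<forall>p. h p \<in> {-R..R}}"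
    by (auto simp: PiE_def Pi_def)
  ultimately show ?thesis by (simp add: compactin_euclidean_iff)
qed

text \<open>
Families with an error not larger than that of the zero family lie in a box by
\<open>gram_error_coercive\<close>, and a continuous function attains its minimum on a box.
\<close>

lemma gram_error_minimum:
  fixes Q :: "'g::finite list \<Rightarrow> real"
  shows "\<exists>h. \<forall>h'. gram_error d Q h \<le> gram_error d Q h'"
proof -
  let ?W = "words d :: 'g list set"
  obtain R where R: "\<And>h k a. gram_error d Q h \<le> gram_error d Q (\<lambda>_. 0) \<Longrightarrow> k \<in> ?W \<Longrightarrow> a \<in> ?W \<Longrightarrow> \<bar>h (k, a)\<bar> \<le> R"
    using gram_error_coercive[of d Q "gram_error d Q (\<lambda>_. 0)"] by blast
  have R0: "R \<ge> 0" using R[of "\<lambda>_. 0" "[]" "[]"] by (simp add: words_def)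
  let ?B = "{h :: 'g list \<times> 'g list \<Rightarrow> real. \<forall>p. h p \<in> {-R..R}}"
  have "continuous_on ?B (gram_error d Q)"
    unfolding gram_error_def collect_def gram_def
  proof (intro continuous_on_sum continuous_on_power continuous_on_diff continuous_on_const)
    fix a b w :: "'g list"
    have "continuous_on ?B (\<lambda>h. h p)" for p :: "'g list \<times> 'g list"
      by (rule continuous_on_product_coordinates[THEN continuous_on_subset]) auto
    then show "continuous_on ?B (\<lambda>h. if rev a @ b = w then \<Sum>k\<in>words d. h (k, a) * h (k, b) else 0)"
      by (cases "rev a @ b = w") (auto intro!: continuous_on_sum continuous_on_mult)
  qed
  moreover have "(\<lambda>_. 0) \<in> ?B" using R0 by simp
  ultimately obtain h where h: "h \<in> ?B" "\<And>h'. h' \<in> ?B \<Longrightarrow> gram_error d Q h \<le> gram_error d Q h'"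
    using continuous_attains_inf[OF compact_box[of R], of "gram_error d Q"] by (metis (no_types, lifting) empty_iff)
  have "gram_error d Q h \<le> gram_error d Q h'" for h'
  proof (cases "gram_error d Q h' \<le> gram_error d Q (\<lambda>_. 0)")
    case True
    \<comment> \<open>coordinates outside the relevant index set do not influence the error, but must lie in the box\<close>
    define h'' where "h'' p = (if p \<in> ?W \<times> ?W then h' p else 0)" for p
    have "h'' \<in> ?B"
    proof (intro CollectI allI)
      fix p show "h'' p \<in> {-R..R}"
        using R[OF True, of "fst p" "snd p"] R0 by (cases p) (auto simp: h''_def abs_le_iff)
    qed
    moreover have "gram_error d Q h'' = gram_error d Q h'"
      unfolding gram_error_def collect_def gram_def
      by (intro sum.cong refl arg_cong[where f="\<lambda>x. x\<^sup>2"] arg_cong2[where f=minus] if_cong) (auto simp: h''_def)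
    ultimately show ?thesis using h(2) by metis
  next
    case False
    moreover have "gram_error d Q h \<le> gram_error d Q (\<lambda>_. 0)" using h(2) R0 by simp
    ultimately show ?thesis by simp
  qed
  then show ?thesis by blast
qed

lemma nonneg_from_first_order:
  fixes s t :: real
  assumes "\<And>e. 0 < e \<Longrightarrow> e \<le> 1 \<Longrightarrow> 0 \<le> 2 * e * s + e\<^sup>2 * t"
  shows "0 \<le> s"
proof (rule ccontr)
  assume "\<not> 0 \<le> s"
  then have s: "s < 0" by simp
  \<comment> \<open>small enough that the quadratic term cannot outweigh the linear one\<close>
  define e where "e = min 1 (- s / (\<bar>t\<bar> + 1))"
  have e: "0 < e" "e \<le> 1" using s by (auto simp: e_def divide_neg_pos)
  have "e * (\<bar>t\<bar> + 1) \<le> - s / (\<bar>t\<bar> + 1) * (\<bar>t\<bar> + 1)"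
    by (intro mult_right_mono) (auto simp: e_def)
  then have "e * (\<bar>t\<bar> + 1) \<le> - s" by simp
  moreover have "e * t \<le> e * (\<bar>t\<bar> + 1)" using e by (intro mult_left_mono) auto
  ultimately have "2 * s + e * t < 0" using s by linarith
  then have "e * (2 * s + e * t) < 0" using e by (simp add: mult_pos_neg)
  then show False using assms[OF e] by (simp add: power2_eq_square algebra_simps)
qed

text \<open>
At a nearest sum of squares the error \<open>r\<close>, read as a functional by means of the coordinatewise inner
product, is nonnegative on squares and zero on the nearest point itself. Its value on \<open>Q\<close> is
therefore minus its squared norm.
\<close>

lemma separating_functional:
  fixes Q :: "'g::finite list \<Rightarrow> real"
  assumes sym: "\<And>w. Q (rev w) = Q w" and pos: "\<And>h. gram_error d Q h \<noteq> 0"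
  shows "\<exists>r. (\<forall>w. r (rev w) = r w) \<and>
    (\<forall>f. 0 \<le> (\<Sum>a\<in>words d. \<Sum>b\<in>words d. f a * f b * r (rev a @ b))) \<and>
    (\<Sum>w\<in>words (2 * d). Q w * r w) < 0"
proof -
  obtain h where h: "\<And>h'. gram_error d Q h \<le> gram_error d Q h'"
    using gram_error_minimum by blast
  define r where "r w = collect d (gram d h) w - Q w" for w
  let ?S = "\<lambda>c. \<Sum>w\<in>words (2 * d). c w * r w"
  have step: "0 \<le> 2 * e * ?S (collect d G) + e\<^sup>2 * (\<Sum>w\<in>words (2 * d). (collect d G w)\<^sup>2)"
    if psd: "psd (words d) (\<lambda>a b. gram d h a b + e * G a b)" for G e
  proof -
    obtain h' where h': "\<And>w. collect d (gram d h') w = collect d (\<lambda>a b. gram d h a b + e * G a b) w"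
      using psd_as_gram[OF psd] by auto
    have "gram_error d Q h \<le> gram_error d Q h'" by (rule h)
    also have "gram_error d Q h' = (\<Sum>w\<in>words (2 * d). (r w + e * collect d G w)\<^sup>2)"
      by (simp add: gram_error_def h' collect_add collect_scale r_def algebra_simps)
    also have "\<dots> = gram_error d Q h + (2 * e * ?S (collect d G) + e\<^sup>2 * (\<Sum>w\<in>words (2 * d). (collect d G w)\<^sup>2))"
      by (simp add: gram_error_def r_def[symmetric] power2_sum sum.distrib sum_distrib_left power_mult_distrib mult_ac)
    finally show ?thesis by simp
  qed
  have "0 \<le> (\<Sum>a\<in>words d. \<Sum>b\<in>words d. f a * f b * r (rev a @ b))" for f
  proof -
    have "psd (words d) (\<lambda>a b. gram d h a b + e * (f a * f b))" if "e > 0" for e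
    proof -
      have "0 \<le> (\<Sum>a\<in>words d. \<Sum>b\<in>words d. g a * g b * (gram d h a b + e * (f a * f b)))" for g
      proof -
        have "(\<Sum>a\<in>words d. \<Sum>b\<in>words d. g a * g b * (gram d h a b + e * (f a * f b))) 
          = (\<Sum>a\<in>words d. \<Sum>b\<in>words d. g a * g b * gram d h a b) + e * (\<Sum>a\<in>words d. g a * f a)\<^sup>2"
          by (simp add: algebra_simps sum.distrib power2_eq_square sum_product sum_distrib_left)
        then show ?thesis using psd_gram[of "words d" d h] that by (simp add: psd_def)
      qed
      then show ?thesis using psd_gram[of "words d" d h] by (simp add: psd_def mult.commute)
    qed
    then have "0 \<le> ?S (collect d (\<lambda>a b. f a * f b))"
    proof -
      assume psd: "\<And>e. 0 < e \<Longrightarrow> psd (words d) (\<lambda>a b. gram d h a b + e * (f a * f b))"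
      show ?thesis
        by (rule nonneg_from_first_order[OF step[OF psd]])
    qed
    then show ?thesis by (simp add: sum_collect)
  qed
  moreover have "0 \<le> ?S (collect d (\<lambda>a b. - gram d h a b))"
  proof (rule nonneg_from_first_order[OF step])
    fix e :: real assume e: "0 < e" "e \<le> 1"
    have "(\<Sum>a\<in>words d. \<Sum>b\<in>words d. g a * g b * (gram d h a b + e * - gram d h a b))
        = (1 - e) * (\<Sum>a\<in>words d. \<Sum>b\<in>words d. g a * g b * gram d h a b)" for g
      by (simp add: algebra_simps sum_distrib_left sum_subtractf)
    then show "psd (words d) (\<lambda>a b. gram d h a b + e * - gram d h a b)"
      using psd_gram[of "words d" d h] e by (simp add: psd_def)
  qed
  then have "?S (collect d (gram d h)) \<le> 0"
    using collect_scale[of d "-1" "gram d h"] by (simp add: sum_negf)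
  moreover have "?S Q = ?S (collect d (gram d h)) - gram_error d Q h"
    by (simp add: gram_error_def r_def power2_eq_square algebra_simps flip: sum_subtractf)
  moreover have "gram_error d Q h > 0"
    using pos[of h] by (simp add: gram_error_def sum_nonneg less_le)
  moreover have "r (rev w) = r w" for w
    unfolding r_def sym by (subst collect_rev) (auto simp: gram_def mult.commute)
  ultimately show ?thesis by (intro exI[of _ r]) auto
qed

text \<open>
Helton's theorem on positive noncommutative polynomials. The separating functional is only
nonnegative on squares; adding a small multiple of the vacuum state of the Fock tuple makes it
strictly positive, as \<open>gns\<close> requires, without losing the negative value on \<open>q\<close>.
\<close>

theorem sum_of_squares_if_moments_nonneg:
  fixes q :: "'g::finite free_poly"
  assumes "symmetric_poly q"
    and nonneg: "\<And>(I :: 'g list set) X v. finite I \<Longrightarrow> sym_kernels I X \<Longrightarrow> 0 \<le> pairing q (moment I X v)"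
  shows "sum_of_squares q"
proof -
  define Q where "Q w = Poly_Mapping.lookup q (Word w)" for w
  define d where "d = Max (insert 0 ((length \<circ> letters) ` Poly_Mapping.keys q))"
  have d: "length (letters w) \<le> d" if "w \<in> Poly_Mapping.keys q" for w
    unfolding d_def using that by (intro Max_ge) auto
  have keys: "Poly_Mapping.keys q \<subseteq> Word ` words (2 * d)"
  proof
    fix w assume "w \<in> Poly_Mapping.keys q"
    then have "letters w \<in> words (2 * d)" using d[of w] by (simp add: words_def)
    then show "w \<in> Word ` words (2 * d)" by (metis free_word.collapse imageI)
  qed
  have pairing_q: "pairing q f = (\<Sum>w\<in>words (2 * d). Q w * f w)" for f
    by (subst pairing_superset[OF _ keys]) (auto simp: sum.reindex inj_on_def Q_def)
  have sym: "Q (rev w) = Q w" for w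
    using symmetric_poly_lookup[OF assms(1), of "Word w"] by (simp add: Q_def word_star_def)
  show ?thesis
  proof (cases "\<exists>h. gram_error d Q h = 0")
    case True
    then obtain h where "gram_error d Q h = 0" by blast
    then have h: "collect d (gram d h) w = Q w" if "w \<in> words (2 * d)" for w
      using that unfolding gram_error_def by (subst (asm) sum_nonneg_eq_0_iff) auto
    define s where "s k = (\<Sum>a\<in>words d. Poly_Mapping.single (Word a) (h (k, a)))" for k
    have "q = (\<Sum>k\<in>words d. star (s k) * s k)"
    proof (rule poly_mapping_eqI)
      fix w
      have "Poly_Mapping.lookup (\<Sum>k\<in>words d. star (s k) * s k) w 
        = (\<Sum>k\<in>words d. \<Sum>a\<in>words d. \<Sum>b\<in>words d. if rev a @ b = letters w then h (k, a) * h (k, b) else 0)"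
        unfolding lookup_sum s_def star_times_sum_single lookup_single when_def
        by (intro sum.cong refl) (metis free_word.collapse free_word.sel)
      also have "\<dots> = collect d (gram d h) (letters w)"
        unfolding collect_def gram_def
        by (subst sum_swap_1_2, (rule sum.cong[OF refl])+) simp
      also have "\<dots> = Poly_Mapping.lookup q w"
      proof (cases "letters w \<in> words (2 * d)")
        case True
        then show ?thesis by (simp add: h Q_def)
      next
        case False
        then have "collect d (gram d h) (letters w) = 0"
          unfolding collect_def
            by (intro sum.neutral ballI) (auto simp: words_def dest!: arg_cong[where f=length])
        moreover have "w \<notin> Poly_Mapping.keys q" using False keys by force
        ultimately show ?thesis by (simp add: in_keys_iff)
      qed
      finally show "Poly_Mapping.lookup q w = Poly_Mapping.lookup (\<Sum>k\<in>words d. star (s k) * s k) w" by simp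
    qed
    moreover obtain ks :: "'g list list" where "set ks = words d" "distinct ks"
      using finite_distinct_list[OF finite_words] by blast
    ultimately have "q = (\<Sum>x\<leftarrow>map s ks. star x * x)"
      by (simp add: sum.distinct_set_conv_list[symmetric] comp_def)
    then show ?thesis unfolding sum_of_squares_def by blast
  next
    case False
    then obtain r where r: "\<And>w. r (rev w) = r w"
      "\<And>f. 0 \<le> (\<Sum>a\<in>words d. \<Sum>b\<in>words d. f a * f b * r (rev a @ b))"
      "(\<Sum>w\<in>words (2 * d). Q w * r w) < 0"
      using separating_functional[of Q d, OF sym] by blast
    let ?W = "words d :: 'g list set"
    let ?m = "moment ?W fock vacuum"
    define e where "e = - (\<Sum>w\<in>words (2 * d). Q w * r w) / (\<bar>\<Sum>w\<in>words (2 * d). Q w * ?m w\<bar> + 1)"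
    have e0: "e > 0" using r(3) unfolding e_def by (intro divide_pos_pos) auto
    have "e * (\<Sum>w\<in>words (2 * d). Q w * ?m w) \<le> e * \<bar>\<Sum>w\<in>words (2 * d). Q w * ?m w\<bar>"
      using e0 by (intro mult_left_mono) auto
    also have "\<dots> < e * (\<bar>\<Sum>w\<in>words (2 * d). Q w * ?m w\<bar> + 1)" using e0 by simp
    also have "\<dots> = - (\<Sum>w\<in>words (2 * d). Q w * r w)" by (simp add: e_def)
    finally have neg: "(\<Sum>w\<in>words (2 * d). Q w * (r w + e * ?m w)) < 0"
      by (simp add: algebra_simps sum.distrib sum_distrib_left)
    have "\<exists>X v. sym_kernels ?W X \<and> (\<forall>w. length w \<le> 2 * d \<longrightarrow> moment ?W X v w = r w + e * ?m w)"
    proof (rule gns)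
      fix w show "r (rev w) + e * ?m (rev w) = r w + e * ?m w"
        using moment_rev_append[OF sym_fock, of ?W vacuum w "[]"] moment_rev_append[OF sym_fock, of ?W vacuum "[]" w]
        by (simp add: r mult.commute)
    next
      fix f :: "'g list \<Rightarrow> real" assume "\<exists>a\<in>?W. f a \<noteq> 0"
      then obtain a where a: "a \<in> ?W" "f a \<noteq> 0" by blast
      obtain l where l: "\<And>w. length w \<le> d \<Longrightarrow> (\<Sum>x\<in>?W. l x * act ?W fock w vacuum x) = (if w = a then 1 else 0)"
        using fock_dual[of d "\<lambda>w. if w = a then 1 else 0"] by blast
      let ?u = "\<lambda>x. \<Sum>b\<in>?W. f b * act ?W fock b vacuum x"
      have "(\<Sum>x\<in>?W. l x * ?u x) = (\<Sum>b\<in>?W. f b * (\<Sum>x\<in>?W. l x * act ?W fock b vacuum x))"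
        unfolding sum_distrib_left by (subst sum.swap) (simp add: mult_ac)
      also have "\<dots> = (\<Sum>b\<in>?W. if b = a then f b else 0)"
        by (intro sum.cong refl) (use l in \<open>auto simp: words_def\<close>)
      also have "\<dots> \<noteq> 0" using a by simp
      finally have "\<exists>x\<in>?W. ?u x \<noteq> 0" by (metis (no_types, lifting) mult_zero_right sum.neutral)
      then have "0 < (\<Sum>x\<in>?W. (?u x)\<^sup>2)"
        by (auto intro!: sum_pos2)
      also have "\<dots> = (\<Sum>x\<in>?W. \<Sum>a\<in>?W. \<Sum>b\<in>?W. f a * f b * (act ?W fock a vacuum x * act ?W fock b vacuum x))"
        by (simp add: power2_eq_square sum_product mult_ac)
      also have "\<dots> = (\<Sum>a\<in>?W. \<Sum>b\<in>?W. \<Sum>x\<in>?W. f a * f b * (act ?W fock a vacuum x * act ?W fock b vacuum x))"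
        by (rule sum_swap_1_2)
      also have "\<dots> = (\<Sum>a\<in>?W. \<Sum>b\<in>?W. f a * f b * ?m (rev a @ b))"
        by (simp add: moment_rev_append[OF sym_fock] sum_distrib_left)
      finally have "0 < e * (\<Sum>a\<in>?W. \<Sum>b\<in>?W. f a * f b * ?m (rev a @ b))" using e0 by simp
      then show "0 < (\<Sum>a\<in>?W. \<Sum>b\<in>?W. f a * f b * (r (rev a @ b) + e * ?m (rev a @ b)))"
        using r(2)[of f] by (simp add: algebra_simps sum.distrib sum_distrib_left)
    qed
    then obtain X v where X: "sym_kernels ?W X" "\<And>w. length w \<le> 2 * d \<Longrightarrow> moment ?W X v w = r w + e * ?m w"
      by blast
    have "pairing q (moment ?W X v) < 0"
      unfolding pairing_q using neg X(2) by (simp add: words_def)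
    then show ?thesis using nonneg[OF finite_words X(1), of v] by simp
  qed
qed

section \<open>Evaluations as quadratic forms of matrices\<close>

definition quad :: "'i set \<Rightarrow> ('i \<Rightarrow> 'i \<Rightarrow> real) \<Rightarrow> ('i \<Rightarrow> real) \<Rightarrow> real" where
  "quad I M f = (\<Sum>i\<in>I. \<Sum>k\<in>I. f i * f k * M i k)"

definition poly_kernel :: "'i set \<Rightarrow> 'g free_poly \<Rightarrow> ('g \<Rightarrow> 'i \<Rightarrow> 'i \<Rightarrow> real) \<Rightarrow> 'i \<Rightarrow> 'i \<Rightarrow> real" where
  "poly_kernel I p X i k = pairing p (\<lambda>w. act I X w (\<lambda>l. if l = k then 1 else 0) i)"

lemma quad_add: "quad I (\<lambda>i k. M i k + N i k) f = quad I M f + quad I N f"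
  by (simp add: quad_def algebra_simps sum.distrib)

lemma quad_diff: "quad I (\<lambda>i k. M i k - N i k) f = quad I M f - quad I N f"
  by (simp add: quad_def algebra_simps sum_subtractf)

lemma quad_scale: "quad I (\<lambda>i k. c * M i k) f = c * quad I M f"
  by (simp add: quad_def sum_distrib_left mult_ac)

lemma quad_rank_one: "quad I (\<lambda>i k. u i * u k) f = (\<Sum>i\<in>I. f i * u i)\<^sup>2"
  by (simp add: quad_def power2_eq_square sum_product mult_ac)

lemma quad_identity: "finite I \<Longrightarrow> quad I (\<lambda>i k. if i = k then 1 else 0) f = (\<Sum>i\<in>I. (f i)\<^sup>2)"
  by (simp add: quad_def power2_eq_square if_distrib[of "\<lambda>c. _ * c"] cong: if_cong)

lemma quad_poly_kernel:
  assumes "finite I"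
  shows "quad I (poly_kernel I p X) f = pairing p (moment I X f)"
proof -
  have mom: "moment I X f w = (\<Sum>i\<in>I. \<Sum>k\<in>I. f i * f k * act I X w (\<lambda>l. if l = k then 1 else 0) i)" for w
    unfolding moment_def
  proof (intro sum.cong refl)
    fix i assume "i \<in> I"
    then show "f i * act I X w f i = (\<Sum>k\<in>I. f i * f k * act I X w (\<lambda>l. if l = k then 1 else 0) i)"
      by (subst act_expand[OF assms]) (simp_all add: sum_distrib_left mult_ac)
  qed
  have "quad I (poly_kernel I p X) f = (\<Sum>i\<in>I. \<Sum>k\<in>I. \<Sum>w\<in>Poly_Mapping.keys p.
      Poly_Mapping.lookup p w * (f i * f k * act I X (letters w) (\<lambda>l. if l = k then 1 else 0) i))"
    by (simp add: quad_def poly_kernel_def pairing_def sum_distrib_left mult_ac)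
  also have "\<dots> = (\<Sum>w\<in>Poly_Mapping.keys p. \<Sum>i\<in>I. \<Sum>k\<in>I. 
      Poly_Mapping.lookup p w * (f i * f k * act I X (letters w) (\<lambda>l. if l = k then 1 else 0) i))"
    by (rule sum_swap_1_2[symmetric])
  also have "\<dots> = pairing p (moment I X f)"
    by (simp add: pairing_def mom sum_distrib_left)
  finally show ?thesis .
qed

lemma poly_kernel_sym:
  assumes "finite I" "sym_kernels I X" "symmetric_poly p" "i \<in> I" "k \<in> I"
  shows "poly_kernel I p X i k = poly_kernel I p X k i"
proof -
  let ?d = "\<lambda>k l. if l = k then 1 else (0::real)"
  have *: "act I X w (?d k) i = act I X (rev w) (?d i) k" for w
    using act_adjoint[OF assms(2), of "?d i" w "?d k"] assms(1,4,5)
    by (simp add: if_distrib[of "\<lambda>c. _ * c"] if_distrib[of "\<lambda>c. c * _"] cong: if_cong)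
  have keys: "word_star w \<in> Poly_Mapping.keys p \<longleftrightarrow> w \<in> Poly_Mapping.keys p" for w
    by (simp add: in_keys_iff symmetric_poly_lookup[OF assms(3)])
  show ?thesis
    unfolding poly_kernel_def pairing_def
    by (rule sum.reindex_bij_witness[of _ word_star word_star])
       (simp_all add: keys * symmetric_poly_lookup[OF assms(3)] letters_word_star)
qed

lemma abs_quad_le:
  assumes "finite I"
  shows "\<bar>quad I M f\<bar> \<le> (\<Sum>i\<in>I. \<Sum>k\<in>I. \<bar>M i k\<bar>) * (\<Sum>i\<in>I. (f i)\<^sup>2)"
proof -
  let ?W = "\<Sum>i\<in>I. (f i)\<^sup>2"
  have wi: "(f i)\<^sup>2 \<le> ?W" if "i \<in> I" for i
    using assms that by (intro member_le_sum) auto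
  have "\<bar>quad I M f\<bar> \<le> (\<Sum>i\<in>I. \<Sum>k\<in>I. \<bar>f i * f k * M i k\<bar>)"
    unfolding quad_def by (intro order_trans[OF sum_abs] sum_mono sum_abs)
  also have "\<dots> \<le> (\<Sum>i\<in>I. \<Sum>k\<in>I. ?W * \<bar>M i k\<bar>)"
  proof (intro sum_mono)
    fix i k assume ik: "i \<in> I" "k \<in> I"
    have "2 * \<bar>f i * f k\<bar> \<le> (f i)\<^sup>2 + (f k)\<^sup>2"
      using sum_squares_bound[of "\<bar>f i\<bar>" "\<bar>f k\<bar>"] by (simp add: abs_mult)
    then have "\<bar>f i * f k\<bar> \<le> ?W" using wi[OF ik(1)] wi[OF ik(2)] by linarith
    then show "\<bar>f i * f k * M i k\<bar> \<le> ?W * \<bar>M i k\<bar>"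
      unfolding abs_mult[of "f i * f k"] by (rule mult_right_mono) simp
  qed
  also have "\<dots> = (\<Sum>i\<in>I. \<Sum>k\<in>I. \<bar>M i k\<bar>) * ?W"
  proof -
    have "(\<Sum>i\<in>I. \<Sum>k\<in>I. c * g i k) = (\<Sum>i\<in>I. \<Sum>k\<in>I. g i k) * c" for c :: real and g
      by (simp add: sum_distrib_left mult.commute)
    then show ?thesis .
  qed
  finally show ?thesis .
qed

text \<open>
Split \<open>f = a v + w\<close> with \<open>w\<close> orthogonal to \<open>v\<close>. The penalty equals \<open>R \<parallel>w\<parallel>\<^sup>2\<close>, the form is positive on
\<open>v\<close>, and a large \<open>R\<close> absorbs both the form on \<open>w\<close> and the cross term.
\<close>

lemma rank_one_penalty:
  assumes "finite I" and sym: "\<And>i k. i \<in> I \<Longrightarrow> k \<in> I \<Longrightarrow> M i k = M k i"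
    and pos: "quad I M v > 0" and s: "s = (\<Sum>i\<in>I. (v i)\<^sup>2)" "s > 0"
  shows "\<exists>R0. \<forall>R\<ge>R0. \<forall>f. (\<exists>i\<in>I. f i \<noteq> 0) \<longrightarrow>
           0 < quad I M f + R * ((\<Sum>i\<in>I. (f i)\<^sup>2) - (\<Sum>i\<in>I. f i * v i)\<^sup>2 / s)"
proof -
  define m where "m = quad I M v"
  define c where "c = (\<Sum>i\<in>I. \<Sum>k\<in>I. \<bar>M i k\<bar>)"
  define u where "u i = (\<Sum>k\<in>I. M i k * v k)" for i
  define N where "N = (\<Sum>i\<in>I. (u i)\<^sup>2)"
  have "0 < quad I M f + R * ((\<Sum>i\<in>I. (f i)\<^sup>2) - (\<Sum>i\<in>I. f i * v i)\<^sup>2 / s)"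
    if R: "R \<ge> 2 * N / m + c + 1" and f: "\<exists>i\<in>I. f i \<noteq> 0" for R f
  proof -
    define a where "a = (\<Sum>i\<in>I. f i * v i) / s"
    define w where "w i = f i - a * v i" for i
    define W where "W = (\<Sum>i\<in>I. (w i)\<^sup>2)"
    define t where "t = (\<Sum>i\<in>I. w i * u i)"
    have fv: "(\<Sum>i\<in>I. f i * v i) = a * s" using s by (simp add: a_def)
    have "W = (\<Sum>i\<in>I. (f i)\<^sup>2) - 2 * a * (\<Sum>i\<in>I. f i * v i) + a\<^sup>2 * (\<Sum>i\<in>I. (v i)\<^sup>2)"
      by (simp add: W_def w_def power2_diff sum.distrib sum_subtractf sum_distrib_left power_mult_distrib mult_ac)
    then have W: "(\<Sum>i\<in>I. (f i)\<^sup>2) - (\<Sum>i\<in>I. f i * v i)\<^sup>2 / s = W"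
      using s(2) unfolding fv s(1)[symmetric] by (simp add: power2_eq_square)
    have "quad I M f = quad I M (\<lambda>i. a * v i + w i)" by (simp add: w_def)
    also have "\<dots> = a\<^sup>2 * m + a * (\<Sum>i\<in>I. \<Sum>k\<in>I. v i * w k * M i k) + a * (\<Sum>i\<in>I. \<Sum>k\<in>I. w i * v k * M i k) + quad I M w"
      by (simp add: quad_def m_def algebra_simps sum.distrib sum_distrib_left power2_eq_square)
    also have "(\<Sum>i\<in>I. \<Sum>k\<in>I. v i * w k * M i k) = t"
      unfolding t_def u_def sum_distrib_left by (subst sum.swap) (intro sum.cong refl, simp add: sym mult_ac)
    also have "(\<Sum>i\<in>I. \<Sum>k\<in>I. w i * v k * M i k) = t"
      unfolding t_def u_def sum_distrib_left by (simp add: mult_ac)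
    finally have qf: "quad I M f = a\<^sup>2 * m + 2 * a * t + quad I M w" by simp
    have W0: "W \<ge> 0" by (simp add: W_def sum_nonneg)
    have wi: "(w i)\<^sup>2 \<le> W" if "i \<in> I" for i
      unfolding W_def using assms(1) that by (intro member_le_sum) auto
    have "\<bar>quad I M w\<bar> \<le> c * W" unfolding c_def W_def by (rule abs_quad_le[OF assms(1)])
    then have qw: "quad I M w \<ge> - (c * W)" by linarith
    have m0: "m > 0" using pos by (simp add: m_def)
    have tN: "t\<^sup>2 \<le> W * N" unfolding t_def W_def N_def by (rule Cauchy_Schwarz_ineq_sum)
    have "0 \<le> (m / 2) * (a + 2 * t / m)\<^sup>2" using m0 by simp
    also have "\<dots> = a\<^sup>2 * m / 2 + 2 * a * t + 2 * t\<^sup>2 / m"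
      using m0 by (simp add: power2_eq_square field_simps)
    also have "2 * t\<^sup>2 / m \<le> 2 * N / m * W"
      using tN m0 by (simp add: divide_right_mono mult.commute)
    finally have at: "2 * a * t \<ge> - (a\<^sup>2 * m / 2) - 2 * N / m * W" by linarith
    have "R * W \<ge> (2 * N / m + c + 1) * W" using R W0 by (rule mult_right_mono)
    then have "quad I M f + R * W \<ge> a\<^sup>2 * m / 2 + W"
      using qf qw at by (simp add: algebra_simps)
    moreover have "a\<^sup>2 * m / 2 + W > 0"
    proof (cases "a = 0")
      case True
      obtain i where "i \<in> I" "f i \<noteq> 0" using f by blast
      then have "0 < (w i)\<^sup>2" by (simp add: w_def True)
      also have "\<dots> \<le> W" by (rule wi[OF \<open>i \<in> I\<close>])
      finally have "W > 0" .
      then show ?thesis using m0 by (simp add: add_nonneg_pos)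
    next
      case False
      then show ?thesis using m0 W0 by (simp add: add_pos_nonneg)
    qed
    ultimately show ?thesis using W by simp
  qed
  then show ?thesis by blast
qed

lemma eval_word_carrier:
  assumes "\<And>j. X j \<in> carrier_mat n n"
  shows "eval_word n w X \<in> carrier_mat n n"
proof -
  have "foldr (\<lambda>j M. X j * M) l (1\<^sub>m n) \<in> carrier_mat n n" for l
    by (induction l) (auto intro: mult_carrier_mat assms)
  then show ?thesis by (simp add: eval_word_def)
qed

lemma mult_mat_vec_eval_word:
  assumes "\<And>j. X j \<in> carrier_mat n n" "v \<in> carrier_vec n" "i < n"
  shows "(eval_word n (Word w) X *\<^sub>v v) $ i = act {..<n} (\<lambda>j a b. X j $$ (a, b)) w (\<lambda>a. v $ a) i"
  using assms(3)
proof (induction w arbitrary: i)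
  case Nil
  then show ?case using assms(2) by (simp add: eval_word_def)
next
  case (Cons j w)
  note E = eval_word_carrier[of X, OF assms(1)]
  have "eval_word n (Word (j # w)) X *\<^sub>v v = X j *\<^sub>v (eval_word n (Word w) X *\<^sub>v v)"
    using assoc_mult_mat_vec[of "X j" n n "eval_word n (Word w) X" n v] assms(1)[of j] E[of "Word w"] assms(2)
    by (simp add: eval_word_def)
  moreover have "dim_vec (eval_word n (Word w) X *\<^sub>v v) = n" "dim_row (X j) = n" "dim_col (X j) = n"
    using E[of "Word w"] assms(1)[of j] by auto
  ultimately show ?case using Cons
    by (simp add: scalar_prod_def lessThan_atLeast0 del: dim_mult_mat_vec)
qed

lemma eval_poly_index:
  assumes "\<And>j. X j \<in> carrier_mat n n" "i < n" "k < n"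
  shows "eval_poly n p X $$ (i, k) = poly_kernel {..<n} p (\<lambda>j a b. X j $$ (a, b)) i k"
proof -
  have "eval_word n w X $$ (i, k) 
     = act {..<n} (\<lambda>j a b. X j $$ (a, b)) (letters w) (\<lambda>l. if l = k then 1 else 0) i" for w
  proof -
    have "eval_word n w X $$ (i, k) = (eval_word n w X *\<^sub>v unit_vec n k) $ i"
      using eval_word_carrier[of X n w, OF assms(1)] assms(2,3) by (simp add: scalar_prod_right_unit)
    also have "\<dots> = act {..<n} (\<lambda>j a b. X j $$ (a, b)) (letters w) (\<lambda>a. unit_vec n k $ a) i"
      using mult_mat_vec_eval_word[where w = "letters w" and X = X and v = "unit_vec n k"] assms by simp
    also have "\<dots> = act {..<n} (\<lambda>j a b. X j $$ (a, b)) (letters w) (\<lambda>l. if l = k then 1 else 0) i"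
      using assms by (intro act_cong) auto
    finally show ?thesis .
  qed
  moreover have "dim_row (eval_word n w X) = n" "dim_col (eval_word n w X) = n" for w
    using eval_word_carrier[of X n w, OF assms(1)] by auto
  ultimately show ?thesis
    using assms by (simp add: eval_poly_def poly_kernel_def pairing_def)
qed

lemma pos_def_iff_quad:
  assumes "S \<in> sym_mats n"
  shows "pos_def n S \<longleftrightarrow> (\<forall>f. (\<exists>i\<in>{..<n}. f i \<noteq> 0) \<longrightarrow> 0 < quad {..<n} (\<lambda>i k. S $$ (i, k)) f)"
proof -
  have S: "S \<in> carrier_mat n n" using assms by (simp add: sym_mats_def)
  have q: "v \<bullet> (S *\<^sub>v v) = quad {..<n} (\<lambda>i k. S $$ (i, k)) (\<lambda>i. v $ i)" if "v \<in> carrier_vec n" for v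
    using S that by (simp add: quad_def scalar_prod_def lessThan_atLeast0 sum_distrib_left mult_ac)
  show ?thesis
  proof
    assume P: "pos_def n S"
    show "\<forall>f. (\<exists>i\<in>{..<n}. f i \<noteq> 0) \<longrightarrow> 0 < quad {..<n} (\<lambda>i k. S $$ (i, k)) f"
    proof (intro allI impI)
      fix f :: "nat \<Rightarrow> real" assume "\<exists>i\<in>{..<n}. f i \<noteq> 0"
      then obtain i where i: "i < n" "f i \<noteq> 0" by auto
      have v: "vec n f \<in> carrier_vec n" by simp
      have "vec n f \<noteq> 0\<^sub>v n" using i by (metis index_vec index_zero_vec(1))
      then have "0 < vec n f \<bullet> (S *\<^sub>v vec n f)" using P v unfolding pos_def_def by blast
      also have "\<dots> = quad {..<n} (\<lambda>i k. S $$ (i, k)) f"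
        unfolding q[OF v] quad_def by (intro sum.cong refl) simp
      finally show "0 < quad {..<n} (\<lambda>i k. S $$ (i, k)) f" .
    qed
  next
    assume R: "\<forall>f. (\<exists>i\<in>{..<n}. f i \<noteq> 0) \<longrightarrow> 0 < quad {..<n} (\<lambda>i k. S $$ (i, k)) f"
    show "pos_def n S" unfolding pos_def_def
    proof (intro conjI assms ballI impI)
      fix v :: "real vec" assume v: "v \<in> carrier_vec n" "v \<noteq> 0\<^sub>v n"
      have "\<exists>i\<in>{..<n}. v $ i \<noteq> 0"
      proof (rule ccontr)
        assume "\<not> (\<exists>i\<in>{..<n}. v $ i \<noteq> 0)"
        then have "v = 0\<^sub>v n" using v(1) by (intro eq_vecI) auto
        then show False using v(2) by simp
      qed
      then show "0 < v \<bullet> (S *\<^sub>v v)" using R q[OF v(1)] by simp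
    qed
  qed
qed

lemma sym_mats_iff:
  "S \<in> sym_mats n \<longleftrightarrow> S \<in> carrier_mat n n \<and> (\<forall>i<n. \<forall>k<n. S $$ (i, k) = S $$ (k, i))"
proof
  assume "S \<in> sym_mats n"
  then have S: "S \<in> carrier_mat n n" "transpose_mat S = S" by (auto simp: sym_mats_def)
  have "S $$ (i, k) = S $$ (k, i)" if "i < n" "k < n" for i k
    using S(1) that arg_cong[OF S(2), of "\<lambda>T. T $$ (k, i)"] by simp
  then show "S \<in> carrier_mat n n \<and> (\<forall>i<n. \<forall>k<n. S $$ (i, k) = S $$ (k, i))" using S by blast
next
  assume "S \<in> carrier_mat n n \<and> (\<forall>i<n. \<forall>k<n. S $$ (i, k) = S $$ (k, i))"
  then show "S \<in> sym_mats n" unfolding sym_mats_def by (auto intro!: eq_matI)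
qed

lemma sublevel_set_iff:
  assumes p: "symmetric_poly p" and A: "A \<in> sym_mats n" and X: "X \<in> sym_tuples n"
  shows "X \<in> sublevel_set n p A \<longleftrightarrow> (\<forall>f. (\<exists>i\<in>{..<n}. f i \<noteq> 0) \<longrightarrow>
    pairing p (moment {..<n} (\<lambda>j a b. X j $$ (a, b)) f) < quad {..<n} (\<lambda>i k. A $$ (i, k)) f)"
proof -
  let ?K = "\<lambda>j a b. X j $$ (a, b)"
  have Xc: "X j \<in> carrier_mat n n" for j using X by (auto simp: sym_tuples_def sym_mats_def)
  have symX: "sym_kernels {..<n} ?K" using X by (auto simp: sym_tuples_def sym_mats_iff sym_kernels_def)
  have Ac: "A \<in> carrier_mat n n" using A by (simp add: sym_mats_def)
  have E: "eval_poly n p X \<in> carrier_mat n n" by (simp add: eval_poly_def)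
  have ind: "(A - eval_poly n p X) $$ (i, k) = A $$ (i, k) - poly_kernel {..<n} p ?K i k" if "i < n" "k < n" for i k
    using that Ac E eval_poly_index[OF Xc that] by simp
  have S: "A - eval_poly n p X \<in> sym_mats n"
    unfolding sym_mats_iff
  proof (intro conjI allI impI)
    show "A - eval_poly n p X \<in> carrier_mat n n" using Ac E by (intro minus_carrier_mat)
    fix i k assume "i < n" "k < n"
    then show "(A - eval_poly n p X) $$ (i, k) = (A - eval_poly n p X) $$ (k, i)"
      using A poly_kernel_sym[OF _ symX p, of i k] by (simp add: ind sym_mats_iff)
  qed
  have "quad {..<n} (\<lambda>i k. (A - eval_poly n p X) $$ (i, k)) f 
      = quad {..<n} (\<lambda>i k. A $$ (i, k)) f - pairing p (moment {..<n} ?K f)" for f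
  proof -
    have "quad {..<n} (\<lambda>i k. (A - eval_poly n p X) $$ (i, k)) f 
      = quad {..<n} (\<lambda>i k. A $$ (i, k) - poly_kernel {..<n} p ?K i k) f"
      unfolding quad_def by (intro sum.cong refl) (simp add: ind)
    then show ?thesis by (simp add: quad_diff quad_poly_kernel)
  qed
  then show ?thesis unfolding sublevel_set_def using X pos_def_iff_quad[OF S] by simp
qed

section \<open>Quasi-convexity tested on one vector\<close>

text \<open>
The matrix \<open>A\<close> has the value \<open>\<alpha>\<close> on \<open>v\<close> and acts as \<open>R\<close> times the identity on the orthogonal
complement of \<open>v\<close>. For large \<open>R\<close> it is positive definite, and its sublevel set contains both given
tuples.
\<close>

lemma level_sets_midpoint_convex_nat:
  fixes n :: nat
  assumes qc: "quasi_convex p" and X: "sym_kernels {..<n} X" and Y: "sym_kernels {..<n} Y"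
    and "\<alpha> > 0" and v: "\<exists>i\<in>{..<n}. v i \<noteq> 0"
    and Xv: "pairing p (moment {..<n} X v) < \<alpha>" and Yv: "pairing p (moment {..<n} Y v) < \<alpha>"
  shows "pairing p (moment {..<n} (\<lambda>j i k. (X j i k + Y j i k) / 2) v) < \<alpha>"
proof -
  let ?I = "{..<n}"
  define s where "s = (\<Sum>i\<in>?I. (v i)\<^sup>2)"
  have s: "s > 0" 
  proof -
    obtain i where "i \<in> ?I" "v i \<noteq> 0" using v by blast
    then show ?thesis unfolding s_def by (intro sum_pos2[of _ i]) auto
  qed
  have p: "symmetric_poly p" using qc by (simp add: quasi_convex_def)
  have n: "n > 0" using v by auto
  define P where "P i k = \<alpha> / s\<^sup>2 * (v i * v k)" for i k
  have Psym: "P i k = P k i" for i k by (simp add: P_def mult.commute)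
  have quadP: "quad ?I P f = \<alpha> / s\<^sup>2 * (\<Sum>i\<in>?I. f i * v i)\<^sup>2" for f
    unfolding P_def quad_scale quad_rank_one ..
  have Pv: "quad ?I P v = \<alpha>" using s by (simp add: quadP flip: power2_eq_square s_def)
  have penalty: "\<exists>R0. \<forall>R\<ge>R0. \<forall>f. (\<exists>i\<in>?I. f i \<noteq> 0) \<longrightarrow>
      0 < quad ?I P f - pairing p (moment ?I Z f) + R * ((\<Sum>i\<in>?I. (f i)\<^sup>2) - (\<Sum>i\<in>?I. f i * v i)\<^sup>2 / s)"
    if "sym_kernels ?I Z" "pairing p (moment ?I Z v) < \<alpha>" for Z
  proof -
    have "\<exists>R0. \<forall>R\<ge>R0. \<forall>f. (\<exists>i\<in>?I. f i \<noteq> 0) \<longrightarrow>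
      0 < quad ?I (\<lambda>i k. P i k - poly_kernel ?I p Z i k) f 
          + R * ((\<Sum>i\<in>?I. (f i)\<^sup>2) - (\<Sum>i\<in>?I. f i * v i)\<^sup>2 / s)"
    proof (rule rank_one_penalty[OF _ _ _ s_def s])
      show "P i k - poly_kernel ?I p Z i k = P k i - poly_kernel ?I p Z k i" if "i \<in> ?I" "k \<in> ?I" for i k
        using poly_kernel_sym[OF _ \<open>sym_kernels ?I Z\<close> p that] by (simp add: Psym)
      show "0 < quad ?I (\<lambda>i k. P i k - poly_kernel ?I p Z i k) v"
        using that(2) by (simp add: quad_diff quad_poly_kernel Pv)
    qed simp
    then show ?thesis by (simp add: quad_diff quad_poly_kernel)
  qed
  obtain R1 where R1: "\<And>R f. R \<ge> R1 \<Longrightarrow> \<exists>i\<in>?I. f i \<noteq> 0 \<Longrightarrow>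
      0 < quad ?I P f - pairing p (moment ?I X f) + R * ((\<Sum>i\<in>?I. (f i)\<^sup>2) - (\<Sum>i\<in>?I. f i * v i)\<^sup>2 / s)"
    using penalty[OF X Xv] by blast
  obtain R2 where R2: "\<And>R f. R \<ge> R2 \<Longrightarrow> \<exists>i\<in>?I. f i \<noteq> 0 \<Longrightarrow>
      0 < quad ?I P f - pairing p (moment ?I Y f) + R * ((\<Sum>i\<in>?I. (f i)\<^sup>2) - (\<Sum>i\<in>?I. f i * v i)\<^sup>2 / s)"
    using penalty[OF Y Yv] by blast
  obtain R3 where R3: "\<And>R f. R \<ge> R3 \<Longrightarrow> \<exists>i\<in>?I. f i \<noteq> 0 \<Longrightarrow>
      0 < quad ?I P f + R * ((\<Sum>i\<in>?I. (f i)\<^sup>2) - (\<Sum>i\<in>?I. f i * v i)\<^sup>2 / s)"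
  proof -
    have "\<exists>R0. \<forall>R\<ge>R0. \<forall>f. (\<exists>i\<in>?I. f i \<noteq> 0) \<longrightarrow>
      0 < quad ?I P f + R * ((\<Sum>i\<in>?I. (f i)\<^sup>2) - (\<Sum>i\<in>?I. f i * v i)\<^sup>2 / s)"
      by (rule rank_one_penalty[OF _ _ _ s_def s]) (use Pv \<open>\<alpha> > 0\<close> Psym in simp_all)
    then show ?thesis using that by blast
  qed
  define R where "R = max R1 (max R2 R3)"
  have R: "R \<ge> R1" "R \<ge> R2" "R \<ge> R3" by (auto simp: R_def)
  define A where "A = mat n n (\<lambda>(i, k). P i k + R * ((if i = k then 1 else 0) - 1 / s * (v i * v k)))"
  have A: "A \<in> sym_mats n" by (auto simp: sym_mats_iff A_def P_def mult.commute)
  have quadA: "quad ?I (\<lambda>i k. A $$ (i, k)) f 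
      = quad ?I P f + R * ((\<Sum>i\<in>?I. (f i)\<^sup>2) - (\<Sum>i\<in>?I. f i * v i)\<^sup>2 / s)" for f
  proof -
    have "quad ?I (\<lambda>i k. A $$ (i, k)) f 
      = quad ?I (\<lambda>i k. P i k + R * ((if i = k then 1 else 0) - 1 / s * (v i * v k))) f"
      unfolding quad_def by (intro sum.cong refl) (simp add: A_def)
    then show ?thesis
      unfolding quad_add quad_scale quad_diff quad_rank_one by (simp add: quad_identity)
  qed
  have Apos: "pos_def n A" 
    unfolding pos_def_iff_quad[OF A] quadA using R3[OF R(3)] by blast
  let ?M = "\<lambda>Z j. mat n n (\<lambda>(i, k). Z j i k)"
  have tup: "?M Z \<in> sym_tuples n" if "sym_kernels ?I Z" for Z :: "'a \<Rightarrow> nat \<Rightarrow> nat \<Rightarrow> real"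
    using that by (auto simp: sym_tuples_def sym_mats_iff sym_kernels_def)
  have mom: "moment ?I (\<lambda>j a b. ?M Z j $$ (a, b)) f = moment ?I Z f" for Z :: "'a \<Rightarrow> nat \<Rightarrow> nat \<Rightarrow> real" and f
    by (rule ext, rule moment_cong) auto
  have mem: "?M Z \<in> sublevel_set n p A \<longleftrightarrow> (\<forall>f. (\<exists>i\<in>?I. f i \<noteq> 0) \<longrightarrow>
      pairing p (moment ?I Z f) < quad ?I (\<lambda>i k. A $$ (i, k)) f)" if "sym_kernels ?I Z" for Z
    using sublevel_set_iff[OF p A tup[OF that]] by (simp add: mom)
  have MX: "?M X \<in> sublevel_set n p A"
    unfolding mem[OF X] quadA
  proof (intro allI impI)
    fix f :: "nat \<Rightarrow> real" assume "\<exists>i\<in>?I. f i \<noteq> 0"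
    from R1[OF R(1) this] show "pairing p (moment ?I X f)
        < quad ?I P f + R * ((\<Sum>i\<in>?I. (f i)\<^sup>2) - (\<Sum>i\<in>?I. f i * v i)\<^sup>2 / s)"
      by simp
  qed
  have MY: "?M Y \<in> sublevel_set n p A"
    unfolding mem[OF Y] quadA
  proof (intro allI impI)
    fix f :: "nat \<Rightarrow> real" assume "\<exists>i\<in>?I. f i \<noteq> 0"
    from R2[OF R(2) this] show "pairing p (moment ?I Y f)
        < quad ?I P f + R * ((\<Sum>i\<in>?I. (f i)\<^sup>2) - (\<Sum>i\<in>?I. f i * v i)\<^sup>2 / s)"
      by simp
  qed
  have "convex_tuples (sublevel_set n p A)"
    using qc n Apos by (simp add: quasi_convex_def)
  from this[unfolded convex_tuples_def, rule_format, OF MX MY, of "1/2" "1/2"]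
  have "(\<lambda>j. (1/2) \<cdot>\<^sub>m ?M X j + (1/2) \<cdot>\<^sub>m ?M Y j) \<in> sublevel_set n p A"
    by simp
  moreover have "(\<lambda>j. (1/2) \<cdot>\<^sub>m ?M X j + (1/2) \<cdot>\<^sub>m ?M Y j) = ?M (\<lambda>j i k. (X j i k + Y j i k) / 2)"
    by (intro ext eq_matI) (auto simp: field_simps)
  ultimately have "?M (\<lambda>j i k. (X j i k + Y j i k) / 2) \<in> sublevel_set n p A" by simp
  moreover have "sym_kernels ?I (\<lambda>j i k. (X j i k + Y j i k) / 2)"
    using X Y by (auto simp: sym_kernels_def)
  ultimately have "pairing p (moment ?I (\<lambda>j i k. (X j i k + Y j i k) / 2) v) < quad ?I (\<lambda>i k. A $$ (i, k)) v"
    using mem v by blast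
  also have "\<dots> = \<alpha>"
    using s by (simp add: quadA Pv power2_eq_square flip: s_def)
       (simp add: s_def power2_eq_square)
  finally show ?thesis .
qed

lemma level_sets_midpoint_convex:
  assumes qc: "quasi_convex p" and "finite I" and X: "sym_kernels I X" and Y: "sym_kernels I Y"
    and "\<alpha> > 0"
    and Xv: "pairing p (moment I X v) < \<alpha>" and Yv: "pairing p (moment I Y v) < \<alpha>"
  shows "pairing p (moment I (\<lambda>j i k. (X j i k + Y j i k) / 2) v) < \<alpha>"
proof (cases "\<exists>i\<in>I. v i \<noteq> 0")
  case True
  obtain e where e: "bij_betw e {..<card I} I"
    using ex_bij_betw_nat_finite[OF \<open>finite I\<close>] lessThan_atLeast0 by metis
  have sym: "sym_kernels {..<card I} (\<lambda>j a b. Z j (e a) (e b))" if "sym_kernels I Z" for Z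
    using that bij_betwE[OF e] by (auto simp: sym_kernels_def)
  have reindex: "moment {..<card I} (\<lambda>j a b. Z j (e a) (e b)) (\<lambda>a. v (e a)) = moment I Z v" for Z
    by (rule ext, rule moment_reindex[OF e])
  have "\<exists>a\<in>{..<card I}. v (e a) \<noteq> 0" using True e by (metis bij_betw_imp_surj_on imageE)
  from level_sets_midpoint_convex_nat[OF qc sym[OF X] sym[OF Y] \<open>\<alpha> > 0\<close> this] Xv Yv
  have "pairing p (moment {..<card I} (\<lambda>j a b. (X j (e a) (e b) + Y j (e a) (e b)) / 2) (\<lambda>a. v (e a))) < \<alpha>"
    by (simp add: reindex)
  then show ?thesis using reindex[of "\<lambda>j i k. (X j i k + Y j i k) / 2"] by simp
next
  case False
  then have "moment I (\<lambda>j i k. (X j i k + Y j i k) / 2) v = (\<lambda>_. 0)"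
    by (auto simp: moment_def fun_eq_iff)
  then show ?thesis using \<open>\<alpha> > 0\<close> by (simp add: pairing_def)
qed

lemma eventually_slope_below:
  fixes g :: "real \<Rightarrow> real"
  assumes "(g has_real_derivative D) (at s)" "h * D < B"
  shows "\<forall>\<^sub>F e in at_right 0. (g (s + h * e) - g s) / e < B"
proof -
  have "((\<lambda>e. g (s + h * e)) has_real_derivative D * h) (at 0)"
    by (rule DERIV_chain2[where f = g and g = "\<lambda>e. s + h * e"]) (use assms(1) in \<open>auto intro!: derivative_eq_intros\<close>)
  then have "((\<lambda>e. (g (s + h * e) - g s) / e) \<longlongrightarrow> D * h) (at 0)"
    by (simp add: has_field_derivative_iff)
  then have "((\<lambda>e. (g (s + h * e) - g s) / e) \<longlongrightarrow> D * h) (at_right 0)"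
    by (rule filterlim_mono) (auto simp: at_le)
  then show ?thesis using assms(2) by (intro order_tendstoD) (auto simp: mult.commute)
qed

text \<open>
Here \<open>1 / e\<close> plays the role of \<open>c\<^sup>2\<close>: the vector is \<open>v\<close> together with \<open>v0\<close> scaled by \<open>1 / \<surd>e\<close>. The
parameter \<open>s\<close> is shifted by \<open>h e\<close> and \<open>- h e\<close>, which changes \<open>g / e\<close> by about \<open>(b - a) / 2\<close> and
\<open>(a - b) / 2\<close>, so that both points reach the level of their average; their midpoint has the
unshifted parameter \<open>s\<close>.
\<close>

lemma midpoint_convex_if_somewhere_positive:
  fixes X0 :: "'g \<Rightarrow> 'i \<Rightarrow> 'i \<Rightarrow> real" and X :: "'g \<Rightarrow> 'k \<Rightarrow> 'k \<Rightarrow> real"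
  assumes qc: "quasi_convex p" and p0: "Poly_Mapping.lookup p 0 = 0"
    and X0: "finite I0" "sym_kernels I0 X0" "pairing p (moment I0 X0 v0) > 0"
    and XY: "finite I" "sym_kernels I X" "sym_kernels I Y"
  shows "2 * pairing p (moment I (\<lambda>j i k. (X j i k + Y j i k) / 2) v)
      \<le> pairing p (moment I X v) + pairing p (moment I Y v)"
proof -
  define g where "g s = pairing p (moment I0 (\<lambda>j i k. s * X0 j i k) v0)" for s
  define a where "a = pairing p (moment I X v)"
  define b where "b = pairing p (moment I Y v)"
  have g_sum: "g s = (\<Sum>w\<in>Poly_Mapping.keys p. Poly_Mapping.lookup p w * (s ^ length (letters w) * moment I0 X0 v0 (letters w)))" for s
    by (simp add: g_def pairing_def moment_scale_kernels)
  define g' where "g' s = (\<Sum>w\<in>Poly_Mapping.keys p. Poly_Mapping.lookup p w 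
      * (real (length (letters w)) * s ^ (length (letters w) - 1) * moment I0 X0 v0 (letters w)))" for s
  have deriv: "(g has_real_derivative g' s) (at s)" for s
    unfolding g_sum[abs_def] g'_def by (auto intro!: derivative_eq_intros sum.cong)
  have "g 0 = 0"
    unfolding g_sum
  proof (intro sum.neutral ballI)
    fix w assume w: "w \<in> Poly_Mapping.keys p"
    then have "w \<noteq> 0" using p0 by (auto simp: in_keys_iff)
    then have "length (letters w) \<noteq> 0" by (metis free_word.collapse length_0_conv zero_free_word_def)
    then show "Poly_Mapping.lookup p w * (0 ^ length (letters w) * moment I0 X0 v0 (letters w)) = 0" by simp
  qed
  have "g 1 > 0" using X0(3) by (simp add: g_def)
  obtain s where s: "g s > 0" "g' s > 0"
  proof -
    \<comment> \<open>Between the last point where \<open>g\<close> is not positive and \<open>1\<close>, apply the mean value theorem.\<close>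
    let ?Z = "{0..1} \<inter> {s. g s \<le> 0}"
    have "continuous_on UNIV g" using deriv by (auto intro: continuous_at_imp_continuous_on DERIV_isCont)
    then have "compact ?Z"
      by (intro compact_Int_closed compact_Icc closed_Collect_le continuous_on_const)
    moreover have "0 \<in> ?Z" using \<open>g 0 = 0\<close> by simp
    ultimately obtain s0 where s0: "s0 \<in> ?Z" "\<And>s. s \<in> ?Z \<Longrightarrow> s \<le> s0"
      using compact_attains_sup[of ?Z] by blast
    then have "s0 < 1" using \<open>g 1 > 0\<close> by (cases "s0 = 1") auto
    then obtain \<xi> where \<xi>: "s0 < \<xi>" "\<xi> < 1" "g 1 - g s0 = (1 - s0) * g' \<xi>"
      using MVT2[of s0 1 g g'] deriv by auto
    have "\<not> g \<xi> \<le> 0" using s0(2)[of \<xi>] s0(1) \<xi>(1,2) by auto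
    then have "g \<xi> > 0" by simp
    moreover have "0 < (1 - s0) * g' \<xi>" using \<xi>(3) s0(1) \<open>g 1 > 0\<close> by simp
    then have "g' \<xi> > 0" using \<open>s0 < 1\<close> by (simp add: zero_less_mult_iff)
    ultimately show ?thesis using that by blast
  qed
  define h where "h = (b - a) / (2 * g' s)"
  let ?mid = "pairing p (moment I (\<lambda>j i k. (X j i k + Y j i k) / 2) v)"
  have "?mid \<le> (a + b) / 2 + \<epsilon>" if "\<epsilon> > 0" for \<epsilon>
  proof -
    have "\<forall>\<^sub>F e in at_right 0. (g (s + h * e) - g s) / e < (b - a) / 2 + \<epsilon>"
      by (rule eventually_slope_below[OF deriv]) (use s that in \<open>simp add: h_def\<close>)
    moreover have "\<forall>\<^sub>F e in at_right 0. (g (s + (- h) * e) - g s) / e < (a - b) / 2 + \<epsilon>"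
      by (rule eventually_slope_below[OF deriv]) (use s that in \<open>simp add: h_def field_simps\<close>)
    moreover have "\<forall>\<^sub>F e in at_right 0. 0 < e \<and> e < g s / (\<bar>a + b\<bar> + 1)"
      using s(1) by (intro eventually_conj eventually_at_right_less eventually_at_right_real[THEN eventually_mono]) auto
    ultimately have "\<forall>\<^sub>F e in at_right 0. (g (s + h * e) - g s) / e < (b - a) / 2 + \<epsilon> \<and>
       (g (s + (- h) * e) - g s) / e < (a - b) / 2 + \<epsilon> \<and> 0 < e \<and> e < g s / (\<bar>a + b\<bar> + 1)"
      by eventually_elim simp
    then obtain e where e: "(g (s + h * e) - g s) / e < (b - a) / 2 + \<epsilon>"
      "(g (s - h * e) - g s) / e < (a - b) / 2 + \<epsilon>" "0 < e" "e < g s / (\<bar>a + b\<bar> + 1)"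
      by (auto dest!: eventually_happens)
    define \<alpha> where "\<alpha> = (a + b) / 2 + \<epsilon> + g s / e"
    have "\<bar>a + b\<bar> + 1 < g s / e" using e(3,4) by (simp add: field_simps)
    moreover have "- \<bar>a + b\<bar> \<le> (a + b) / 2" by (cases "a + b \<ge> 0") auto
    ultimately have "- \<bar>a + b\<bar> + (\<bar>a + b\<bar> + 1) < (a + b) / 2 + g s / e"
      by (rule add_le_less_mono[rotated])
    then have "0 < (a + b) / 2 + g s / e" by simp
    then have "\<alpha> > 0" using that by (simp add: \<alpha>_def)
    let ?J = "I <+> I0"
    let ?v = "case_sum v (\<lambda>i. sqrt (1 / e) * v0 i)"
    let ?Z = "\<lambda>Z t. dsum Z (\<lambda>j i k. t * X0 j i k)"
    have pair: "pairing p (moment ?J (?Z Z t) ?v) = pairing p (moment I Z v) + g t / e"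
      for Z :: "'g \<Rightarrow> 'k \<Rightarrow> 'k \<Rightarrow> real" and t
    proof -
      have "moment ?J (?Z Z t) ?v = (\<lambda>w. moment I Z v w + 1 / e * moment I0 (\<lambda>j i k. t * X0 j i k) v0 w)"
        using e(3) by (simp add: fun_eq_iff moment_direct_sum X0(1) XY(1) moment_scale)
      then show ?thesis unfolding g_def by (simp only: pairing_add_right pairing_scale_right) simp
    qed
    have sym: "sym_kernels ?J (?Z Z t)" if "sym_kernels I Z" for Z :: "'g \<Rightarrow> 'k \<Rightarrow> 'k \<Rightarrow> real" and t
      using that X0(2) by (auto simp: sym_kernels_def)
    have shift: "x - y < (b - a) / 2 + \<epsilon> \<Longrightarrow> a + x < (a + b) / 2 + \<epsilon> + y"
      "x - y < (a - b) / 2 + \<epsilon> \<Longrightarrow> b + x < (a + b) / 2 + \<epsilon> + y" for x y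
      by (simp_all add: field_simps)
    have "pairing p (moment ?J (\<lambda>j i k. (?Z X (s + h * e) j i k + ?Z Y (s - h * e) j i k) / 2) ?v) < \<alpha>"
    proof (rule level_sets_midpoint_convex[OF qc])
      show "pairing p (moment ?J (?Z X (s + h * e)) ?v) < \<alpha>"
        unfolding pair \<alpha>_def a_def[symmetric] by (rule shift(1)[OF e(1)[unfolded diff_divide_distrib[of "g (s + h * e)"]]])
      show "pairing p (moment ?J (?Z Y (s - h * e)) ?v) < \<alpha>"
        unfolding pair \<alpha>_def b_def[symmetric] by (rule shift(2)[OF e(2)[unfolded diff_divide_distrib[of "g (s - h * e)"]]])
    qed (use X0(1) XY \<open>\<alpha> > 0\<close> sym in auto)
    also have "(\<lambda>j i k. (?Z X (s + h * e) j i k + ?Z Y (s - h * e) j i k) / 2)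
        = ?Z (\<lambda>j i k. (X j i k + Y j i k) / 2) s"
    proof (intro ext)
      fix j i k show "(?Z X (s + h * e) j i k + ?Z Y (s - h * e) j i k) / 2
        = ?Z (\<lambda>j i k. (X j i k + Y j i k) / 2) s j i k"
        by (cases i; cases k) (auto simp: algebra_simps)
    qed
    finally show ?thesis unfolding pair \<alpha>_def by simp
  qed
  then have "?mid \<le> (a + b) / 2" by (rule field_le_epsilon)
  then show ?thesis by (simp add: a_def b_def)
qed

section \<open>Convex polynomials are quadratic\<close>

text \<open>
Sums, over all pairs \<open>i, j\<close> of adjacent letters of \<open>w\<close>, the product of \<open>L i\<close> at the reversed prefix
before the pair and \<open>L j\<close> at the suffix after it. The argument \<open>u\<close> accumulates the reversed
prefix.
\<close>

fun cut_sum :: "('g \<Rightarrow> 'g list \<Rightarrow> real) \<Rightarrow> 'g list \<Rightarrow> 'g list \<Rightarrow> real" where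
  "cut_sum L u (i # j # w) = L i u * L j w + cut_sum L (i # u) (j # w)"
| "cut_sum L u _ = 0"

lemma cut_sum_cong:
  assumes "\<And>j x. length x \<le> length u + length w \<Longrightarrow> L j x = L' j x"
  shows "cut_sum L u w = cut_sum L' u w"
  using assms by (induction L u w rule: cut_sum.induct) auto

text \<open>
The basis vector \<open>None\<close> is annihilated by the Fock tuple, and \<open>direction\<close> connects it with the words.
A walk that uses the direction exactly twice and returns to the words must therefore use it in
two consecutive steps.
\<close>

fun extended_fock :: "'g \<Rightarrow> 'g list option \<Rightarrow> 'g list option \<Rightarrow> real" where
  "extended_fock j (Some a) (Some b) = fock j a b"
| "extended_fock j _ _ = 0"

fun direction :: "('g \<Rightarrow> 'g list \<Rightarrow> real) \<Rightarrow> 'g \<Rightarrow> 'g list option \<Rightarrow> 'g list option \<Rightarrow> real" where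
  "direction l j (Some a) None = l j a"
| "direction l j None (Some a) = l j a"
| "direction l j _ _ = 0"

definition extended_words :: "nat \<Rightarrow> 'g list option set" where
  "extended_words K = insert None (Some ` words K)"

lemma sum_extended_words:
  fixes f :: "'g::finite list option \<Rightarrow> 'a::comm_monoid_add"
  shows "(\<Sum>i\<in>extended_words K. f i) = f None + (\<Sum>a\<in>words K. f (Some a))"
  unfolding extended_words_def by (subst sum.insert) (auto simp: sum.reindex)

lemma poly_act: "poly (act I T w V i) t = act I (\<lambda>j i k. poly (T j i k) t) w (\<lambda>i. poly (V i) t) i"
  by (induction w arbitrary: i) (simp_all add: poly_sum)

lemma coeff_linear_mult:
  "coeff ([:x, h:] * q) 0 = x * coeff q 0"
  "coeff ([:x, h:] * q) (Suc n) = x * coeff q (Suc n) + h * coeff q n"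
  by simp_all

context
  fixes l :: "'g::finite \<Rightarrow> 'g list \<Rightarrow> real" and K :: nat
begin

abbreviation "pencil \<equiv> \<lambda>j i k. [:extended_fock j i k, direction l j i k:]"
abbreviation "start \<equiv> \<lambda>i :: 'g list option. if i = Some [] then 1 else (0 :: real poly)"
abbreviation "l_moment j w \<equiv> \<Sum>a\<in>words K. l j a * act (words K) fock w vacuum a"

lemma coeff_0_pencil:
  "coeff (act (extended_words K) pencil w start (Some a)) 0 = act (words K) fock w vacuum a"
  by (induction w arbitrary: a)
     (auto simp: vacuum_def sum_extended_words coeff_sum coeff_linear_mult)

lemma coeff_1_pencil_Some:
  "coeff (act (extended_words K) pencil w start (Some a)) (Suc 0) = 0"
  and coeff_0_pencil_None: "coeff (act (extended_words K) pencil w start None) 0 = 0"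
  by (induction w arbitrary: a)
     (auto simp: sum_extended_words coeff_sum coeff_linear_mult)

lemma coeff_1_pencil_None:
  "coeff (act (extended_words K) pencil w start None) (Suc 0) = (case w of [] \<Rightarrow> 0 | j # w' \<Rightarrow> l_moment j w')"
  by (cases w) (auto simp: sum_extended_words coeff_sum coeff_linear_mult coeff_0_pencil)

text \<open>
The coefficient of \<open>t\<^sup>2\<close> along \<open>X + t H\<close>: the first use of \<open>H\<close> leads to \<open>None\<close>, the second leads
back, and the letters in between would give zero. Moving the letters to the left of the pair to the other side
of the inner product reverses them.
\<close>

lemma coeff_2_pencil:
  "(\<Sum>a\<in>words K. act (words K) fock u vacuum a * coeff (act (extended_words K) pencil w start (Some a)) 2)
     = cut_sum l_moment u w"
proof (induction w arbitrary: u)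
  case Nil
  then show ?case by (auto intro!: sum.neutral)
next
  case (Cons i w)
  let ?A = "\<lambda>w. act (words K) fock w vacuum"
  let ?c = "\<lambda>w n i. coeff (act (extended_words K) pencil w start i) n"
  have "?c (i # w) 2 (Some a) = l i a * ?c w (Suc 0) None + (\<Sum>b\<in>words K. fock i a b * ?c w 2 (Some b))" for a
    by (simp add: sum_extended_words coeff_sum numeral_2_eq_2 coeff_linear_mult coeff_1_pencil_Some)
  then have "(\<Sum>a\<in>words K. ?A u a * ?c (i # w) 2 (Some a))
     = (\<Sum>a\<in>words K. ?A u a * (l i a * ?c w (Suc 0) None)) + (\<Sum>a\<in>words K. ?A u a * act (words K) fock [i] (\<lambda>b. ?c w 2 (Some b)) a)"
    by (simp only: distrib_left sum.distrib act.simps)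
  also have "(\<Sum>a\<in>words K. ?A u a * act (words K) fock [i] (\<lambda>b. ?c w 2 (Some b)) a)
     = (\<Sum>b\<in>words K. ?A (i # u) b * ?c w 2 (Some b))"
    using act_adjoint[where I = "words K" and X = fock and u = "?A u" and w = "[i]"
        and v = "\<lambda>b. ?c w 2 (Some b)", OF sym_fock] by simp
  also have "\<dots> = cut_sum l_moment (i # u) w" by (rule Cons.IH)
  also have "(\<Sum>a\<in>words K. ?A u a * (l i a * ?c w (Suc 0) None)) 
      = l_moment i u * (case w of [] \<Rightarrow> 0 | j # w' \<Rightarrow> l_moment j w')"
    unfolding coeff_1_pencil_None by (simp add: sum_distrib_right mult_ac)
  finally show ?case by (cases w) simp_all
qed

lemma coeff_2_moment_pencil:
  "coeff (moment (extended_words K) pencil start w) 2 = cut_sum l_moment [] w"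
proof -
  have "coeff (moment (extended_words K) pencil start w) 2
     = (\<Sum>a\<in>words K. act (words K) fock [] vacuum a * coeff (act (extended_words K) pencil w start (Some a)) 2)"
    unfolding moment_def coeff_sum
    unfolding sum_extended_words by (auto simp: vacuum_def intro!: sum.cong)
  then show ?thesis by (simp only: coeff_2_pencil)
qed

end

text \<open>
Divide the second difference by \<open>t\<^sup>2\<close> and let \<open>t\<close> tend to \<open>0\<close>.
\<close>

lemma coeff_2_nonneg_if_midpoint_convex:
  fixes R :: "real poly"
  assumes "\<And>t. 2 * poly R 0 \<le> poly R t + poly R (- t)"
  shows "coeff R 2 \<ge> 0"
proof -
  obtain c0 c1 c2 S where R: "R = pCons c0 (pCons c1 (pCons c2 S))"
    by (metis pCons_cases)
  have "0 \<le> 2 * c2 + t * (poly S t - poly S (- t))" if "t > 0" for t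
  proof -
    have "0 \<le> t\<^sup>2 * (2 * c2 + t * (poly S t - poly S (- t)))"
      using assms[of t] by (simp add: R algebra_simps power2_eq_square)
    then show ?thesis using that by (simp add: zero_le_mult_iff)
  qed
  then have "\<forall>\<^sub>F t in at_right 0. 0 \<le> 2 * c2 + t * (poly S t - poly S (- t))"
    by (simp add: eventually_at_filter)
  moreover have "((\<lambda>t. 2 * c2 + t * (poly S t - poly S (- t))) \<longlongrightarrow> 2 * c2 + 0 * (poly S 0 - poly S (- 0))) (at_right 0)"
    by (intro tendsto_intros)
  ultimately have "0 \<le> 2 * c2 + 0 * (poly S 0 - poly S (- 0))"
    by (intro tendsto_lowerbound) auto
  then show ?thesis by (simp add: R numeral_2_eq_2)
qed

text \<open>
Along the Fock tuple perturbed by \<open>t\<close> times the direction, the quadratic form of \<open>p\<close> at the vacuum is a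
polynomial in \<open>t\<close>. Convexity makes its second coefficient nonnegative, and by \<open>fock_dual\<close> the
direction can be chosen so that it realizes any given \<open>L\<close> on the words that occur in \<open>p\<close>.
\<close>

lemma cut_sum_nonneg_if_midpoint_convex:
  fixes p :: "'g::finite free_poly" and L :: "'g \<Rightarrow> 'g list \<Rightarrow> real"
  assumes conv: "\<And>(I :: 'g list option set) X Y v. finite I \<Longrightarrow> sym_kernels I X \<Longrightarrow> sym_kernels I Y \<Longrightarrow>
    2 * pairing p (moment I (\<lambda>j i k. (X j i k + Y j i k) / 2) v) \<le> pairing p (moment I X v) + pairing p (moment I Y v)"
  shows "0 \<le> pairing p (cut_sum L [])"
proof -
  define K where "K = Max (insert 0 ((length \<circ> letters) ` Poly_Mapping.keys p))"
  have K: "length (letters w) \<le> K" if "w \<in> Poly_Mapping.keys p" for w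
    unfolding K_def using that by (intro Max_ge) auto
  have "\<exists>l. \<forall>w. length w \<le> K \<longrightarrow> (\<Sum>a\<in>words K. l a * act (words K) fock w vacuum a) = L j w" for j
    by (rule fock_dual)
  then obtain l where l: "\<And>j w. length w \<le> K \<Longrightarrow> (\<Sum>a\<in>words K. l j a * act (words K) fock w vacuum a) = L j w"
    by metis
  let ?J = "extended_words K :: 'g list option set"
  define X where "X t = (\<lambda>j i k. extended_fock j i k + t * direction l j i k)" for t
  have symX: "sym_kernels ?J (X t)" for t
  proof -
    have "extended_fock j i k = extended_fock j k i" "direction l j i k = direction l j k i" for j i k
      by (cases i; cases k; auto simp: fock_def)+
    then show ?thesis unfolding sym_kernels_def X_def by metis
  qed
  define v where "v = (\<lambda>i. if i = Some ([] :: 'g list) then 1 else (0 :: real))"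
  define R where "R = (\<Sum>w\<in>Poly_Mapping.keys p. smult (Poly_Mapping.lookup p w) (moment ?J (pencil l) start (letters w)))"
  have R: "poly R t = pairing p (moment ?J (X t) v)" for t
  proof -
    have "poly (moment ?J (pencil l) start w) t = moment ?J (X t) v w" for w
      unfolding moment_def poly_sum poly_mult poly_act
      by (intro sum.cong refl) (simp add: v_def X_def if_distrib[of "\<lambda>q. poly q t"] cong: if_cong)
    then show ?thesis by (simp add: R_def poly_sum pairing_def)
  qed
  have "coeff R 2 \<ge> 0"
  proof (rule coeff_2_nonneg_if_midpoint_convex)
    fix t
    have "(\<lambda>j i k. (X t j i k + X (- t) j i k) / 2) = X 0"
      by (simp add: X_def fun_eq_iff)
    then show "2 * poly R 0 \<le> poly R t + poly R (- t)"
      unfolding R using conv[of ?J "X t" "X (- t)" v] symX by (simp add: extended_words_def)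
  qed
  also have "coeff R 2 = pairing p (cut_sum (\<lambda>j w. \<Sum>a\<in>words K. l j a * act (words K) fock w vacuum a) [])"
    by (simp add: R_def coeff_sum coeff_2_moment_pencil pairing_def)
  also have "\<dots> = pairing p (cut_sum L [])"
    unfolding pairing_def
  proof (intro sum.cong refl arg_cong2[where f = times] cut_sum_cong)
    fix w j and x :: "'g list" assume "w \<in> Poly_Mapping.keys p" "length x \<le> length ([] :: 'g list) + length (letters w)"
    then show "(\<Sum>a\<in>words K. l j a * act (words K) fock x vacuum a) = L j x"
      using K[of w] by (intro l) simp
  qed
  finally show ?thesis .
qed

text \<open>
After the first letter the prefix is not empty; a nonzero contribution then needs \<open>g0\<close> as reversed prefix and an empty suffix.
\<close>

lemma cut_sum_two_point:
  assumes "g0 \<noteq> []" "length u + length w \<le> length g0 + 2"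
    and L: "\<And>j x. L j x = (if j = i0 \<and> x = [] then 1 else 0) + (if j = j0 \<and> x = g0 then s else 0)"
  shows "u \<noteq> [] \<Longrightarrow> cut_sum L u w = (if 2 \<le> length w \<and> rev u @ w = rev g0 @ [j0, i0] then s else 0)"
  using assms(2)
proof (induction w arbitrary: u)
  case (Cons i w)
  show ?case
  proof (cases w)
    case w: (Cons j w')
    have IH: "cut_sum L (i # u) w = (if 2 \<le> length w \<and> rev u @ i # w = rev g0 @ [j0, i0] then s else 0)"
      using Cons.IH[of "i # u"] Cons.prems by simp
    show ?thesis
    proof (cases "w' = []")
      case True
      have "rev u @ [i, j] = rev g0 @ [j0, i0] \<longleftrightarrow> u = g0 \<and> i = j0 \<and> j = i0" by auto
      then show ?thesis using Cons.prems(1) assms(1) by (auto simp: w True L)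
    next
      case False
      then have "length u < length g0" using Cons.prems w by (cases w') auto
      then have "L i u = 0" using Cons.prems(1) by (auto simp: L)
      then show ?thesis using IH w False by (cases w') auto
    qed
  qed simp
qed simp

text \<open>
Let \<open>x\<^sub>i x\<^sub>j g\<close> be a longest word of \<open>p\<close>, of length at least three, so that \<open>g\<close> is not empty. Take \<open>L\<close>
with the value \<open>1\<close> at \<open>(i, [])\<close> and \<open>s\<close> at \<open>(j, g)\<close>. The square of the second entry belongs to a word
that is too long for \<open>p\<close>, so the form is affine in \<open>s\<close>, with slope twice the coefficient of the
word.
\<close>

lemma cubic_coefficients_vanish:
  fixes p :: "'g::finite free_poly"
  assumes "symmetric_poly p" and nonneg: "\<And>L. 0 \<le> pairing p (cut_sum L [])"
    and w: "w \<in> Poly_Mapping.keys p"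
  shows "length (letters w) \<le> 2"
proof (rule ccontr)
  assume long: "\<not> length (letters w) \<le> 2"
  define k where "k = Max ((length \<circ> letters) ` Poly_Mapping.keys p)"
  have "k \<in> (length \<circ> letters) ` Poly_Mapping.keys p" unfolding k_def using w by (intro Max_in) auto
  then obtain w0 where w0: "w0 \<in> Poly_Mapping.keys p" "length (letters w0) = k" by auto
  have k: "length (letters w) \<le> k" if "w \<in> Poly_Mapping.keys p" for w
    unfolding k_def using that by (intro Max_ge) auto
  have "Suc (Suc (Suc 0)) \<le> length (letters w0)" using k[OF w] long w0(2) by simp
  then obtain i0 j0 i1 g1 where "letters w0 = i0 # j0 # i1 # g1" by (auto simp: Suc_le_length_iff)
  then obtain g0 where g0: "letters w0 = i0 # j0 # g0" "g0 \<noteq> []" by blast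
  define c where "c = Poly_Mapping.lookup p w0"
  define d where "d = Poly_Mapping.lookup p (Word [i0, i0])"
  have "0 \<le> d + 2 * s * c" for s
  proof -
    define L where "L j x = (if j = i0 \<and> x = [] then 1 else 0) + (if j = j0 \<and> x = g0 then s else 0)" for j x
    have "cut_sum L [] w = (if w = [i0, i0] then 1 else 0) + (s * (if w = i0 # j0 # g0 then 1 else 0)
        + s * (if w = rev g0 @ [j0, i0] then 1 else 0))" if "length w \<le> length g0 + 2" for w
    proof (cases w rule: remdups_adj.cases)
      case (3 i j w')
      have "cut_sum L [i] (j # w') = (if 2 \<le> length (j # w') \<and> rev [i] @ j # w' = rev g0 @ [j0, i0] then s else 0)"
        by (rule cut_sum_two_point[OF g0(2) _ L_def]) (use that 3 in auto)
      moreover have "length w' \<ge> 1" if "i # j # w' = rev g0 @ [j0, i0]"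
        using arg_cong[OF that, of length] g0(2) by (cases w'; cases g0) auto
      ultimately have "cut_sum L [i] (j # w') = (if i # j # w' = rev g0 @ [j0, i0] then s else 0)" by auto
      then show ?thesis using g0(2) by (auto simp: 3 L_def)
    qed (use g0(2) in \<open>auto dest!: arg_cong[where f = length]\<close>)
    moreover have "length (letters w) \<le> length g0 + 2" if "w \<in> Poly_Mapping.keys p" for w
      using k[OF that] w0(2) g0 by simp
    ultimately have "pairing p (cut_sum L []) 
      = pairing p (\<lambda>w. (if w = [i0, i0] then 1 else 0) + (s * (if w = i0 # j0 # g0 then 1 else 0)
        + s * (if w = rev g0 @ [j0, i0] then 1 else 0)))"
      unfolding pairing_def by (intro sum.cong refl) simp
    also have "\<dots> = d + (s * c + s * Poly_Mapping.lookup p (Word (rev g0 @ [j0, i0])))"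
      unfolding pairing_add_right pairing_scale_right pairing_delta by (simp add: c_def d_def flip: g0(1))
    also have "Word (rev g0 @ [j0, i0]) = word_star w0" by (simp add: word_star_def g0)
    also have "Poly_Mapping.lookup p (word_star w0) = c" using symmetric_poly_lookup[OF assms(1)] by (simp add: c_def)
    finally show ?thesis using nonneg[of L] by (simp add: mult.commute)
  qed
  note line = this
  have "c = 0"
  proof (rule ccontr)
    assume "c \<noteq> 0"
    then have "2 * (- (d + 1) / (2 * c)) * c = - (d + 1)" by (simp add: field_simps)
    then show False using line[of "- (d + 1) / (2 * c)"] by linarith
  qed
  then show False using w0(1) by (simp add: c_def in_keys_iff)
qed

text \<open>
If \<open>L\<close> vanishes except at the empty word, only the words of length two contribute to the cut sums.
\<close>

lemma quadratic_part_psd: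
  fixes p :: "'g::finite free_poly"
  assumes "symmetric_poly p" and nonneg: "\<And>L. 0 \<le> pairing p (cut_sum L [])"
  shows "psd UNIV (\<lambda>i j. Poly_Mapping.lookup p (Word [i, j]))"
proof -
  have "(\<Sum>i\<in>UNIV. \<Sum>j\<in>UNIV. f i * f j * Poly_Mapping.lookup p (Word [i, j])) 
      = pairing p (cut_sum (\<lambda>j x. if x = [] then f j else 0) [])" for f :: "'g \<Rightarrow> real"
  proof -
    let ?L = "\<lambda>j (x :: 'g list). if x = [] then f j else 0"
    have z: "cut_sum ?L u w = 0" if "u \<noteq> []" for u w
      using that by (induction ?L u w rule: cut_sum.induct) auto
    have "cut_sum ?L [] w = (\<Sum>i\<in>UNIV. \<Sum>j\<in>UNIV. f i * f j * (if w = [i, j] then 1 else 0))" for w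
    proof (cases w rule: remdups_adj.cases)
      case (3 i j w')
      have "(\<Sum>a\<in>UNIV. \<Sum>b\<in>UNIV. f a * f b * (if w = [a, b] then 1 else 0)) 
          = (\<Sum>a\<in>UNIV. if a = i then \<Sum>b\<in>UNIV. if b = j then f i * (if w' = [] then f j else 0) else 0 else 0)"
        by (intro sum.cong refl) (auto simp: 3 if_distrib[of "\<lambda>c. _ * c"] cong: if_cong intro!: sum.neutral)
      also have "\<dots> = f i * (if w' = [] then f j else 0)" by simp
      also have "\<dots> = cut_sum ?L [] w" by (simp add: 3 z)
      finally show ?thesis by simp
    qed auto
    then have "pairing p (cut_sum ?L []) 
        = (\<Sum>w\<in>Poly_Mapping.keys p. \<Sum>i\<in>UNIV. \<Sum>j\<in>UNIV. Poly_Mapping.lookup p w * (f i * f j * (if letters w = [i, j] then 1 else 0)))"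
      by (simp add: pairing_def sum_distrib_left)
    also have "\<dots> = (\<Sum>i\<in>UNIV. \<Sum>j\<in>UNIV. \<Sum>w\<in>Poly_Mapping.keys p. Poly_Mapping.lookup p w * (f i * f j * (if letters w = [i, j] then 1 else 0)))"
      by (rule sum_swap_1_2)
    also have "\<dots> = (\<Sum>i\<in>UNIV. \<Sum>j\<in>UNIV. f i * f j * pairing p (\<lambda>w. if w = [i, j] then 1 else 0))"
      by (simp add: pairing_def sum_distrib_left mult_ac)
    finally show ?thesis by (simp add: pairing_delta)
  qed
  moreover have "Poly_Mapping.lookup p (Word [i, j]) = Poly_Mapping.lookup p (Word [j, i])" for i j
    using symmetric_poly_lookup[OF assms(1), of "Word [i, j]"] by (simp add: word_star_def)
  ultimately show ?thesis unfolding psd_def using nonneg by auto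
qed

lemma linear_poly_iff: "linear_poly p \<longleftrightarrow> (\<exists>c. p = (\<Sum>j\<in>UNIV. Poly_Mapping.single (Word [j]) (c j)))"
  by (simp add: linear_poly_def const_def var_def mult_single)

text \<open>
The decomposition of the coefficient matrix of the quadratic part into rank-one kernels is its decomposition into squares of linear polynomials.
\<close>

lemma linear_plus_squares:
  fixes p :: "'g::finite free_poly"
  assumes deg: "\<And>w. w \<in> Poly_Mapping.keys p \<Longrightarrow> length (letters w) \<le> 2"
    and p0: "Poly_Mapping.lookup p 0 = 0"
    and psd: "psd UNIV (\<lambda>i j. Poly_Mapping.lookup p (Word [i, j]))"
  shows "\<exists>l ss. linear_poly l \<and> (\<forall>s\<in>set ss. linear_poly s) \<and> p = l + (\<Sum>s\<leftarrow>ss. star s * s)"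
proof -
  obtain s where s: "\<And>i j. Poly_Mapping.lookup p (Word [i, j]) = (\<Sum>x\<in>UNIV. s (x::'g) i * s x j)"
    using psd_decomposition[OF finite_UNIV psd] by auto
  define S where "S x = (\<Sum>j\<in>UNIV. Poly_Mapping.single (Word [j]) (s x j))" for x
  define l where "l = (\<Sum>j\<in>UNIV. Poly_Mapping.single (Word [j]) (Poly_Mapping.lookup p (Word [j])))"
  obtain xs :: "'g list" where xs: "set xs = UNIV" "distinct xs"
    using finite_distinct_list[OF finite_UNIV] by blast
  have SS: "star (S x) * S x = (\<Sum>i\<in>UNIV. \<Sum>j\<in>UNIV. Poly_Mapping.single (Word [i, j]) (s x i * s x j))" for x
    by (simp add: S_def star_sum sum_product mult_single word_star_def plus_free_word_def)
  have "p = l + (\<Sum>x\<in>UNIV. star (S x) * S x)"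
  proof (rule poly_mapping_eqI)
    fix w
    have "Poly_Mapping.lookup (l + (\<Sum>x\<in>UNIV. star (S x) * S x)) w
        = (\<Sum>j\<in>UNIV. if Word [j] = w then Poly_Mapping.lookup p w else 0)
        + (\<Sum>x\<in>UNIV. \<Sum>i\<in>UNIV. \<Sum>j\<in>UNIV. if Word [i, j] = w then s x i * s x j else 0)"
      unfolding lookup_add l_def SS lookup_sum lookup_single when_def 
      by (intro arg_cong2[where f = plus] sum.cong refl) auto
    also have "(\<Sum>x\<in>UNIV. \<Sum>i\<in>UNIV. \<Sum>j\<in>UNIV. if Word [i, j] = w then s x i * s x j else 0)
        = (\<Sum>i\<in>UNIV. \<Sum>j\<in>UNIV. if Word [i, j] = w then Poly_Mapping.lookup p w else 0)"
      by (subst sum_swap_1_2) (intro sum.cong refl, auto simp: s)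
    also have "(\<Sum>j\<in>UNIV. if Word [j] = w then Poly_Mapping.lookup p w else 0) + \<dots> = Poly_Mapping.lookup p w"
    proof (cases w)
      case (Word u)
      show ?thesis
      proof (cases u rule: remdups_adj.cases)
        case 1
        then show ?thesis using p0 Word by (simp add: zero_free_word_def)
      next
        case (2 i)
        then show ?thesis using Word by simp
      next
        case (3 i j u')
        show ?thesis
        proof (cases "u' = []")
          case True
          have "(\<Sum>a\<in>UNIV. \<Sum>b\<in>UNIV. if Word [a, b] = w then Poly_Mapping.lookup p w else 0) 
              = (\<Sum>a\<in>UNIV. if a = i then \<Sum>b\<in>UNIV. if b = j then Poly_Mapping.lookup p w else 0 else 0)"
            by (intro sum.cong refl) (auto simp: Word 3 True intro!: sum.neutral sum.cong)
          then show ?thesis using Word 3 True by simp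
        next
          case False
          then have "Poly_Mapping.lookup p w = 0" 
            using deg[of w] Word 3 by (cases u') (auto simp: in_keys_iff)
          then show ?thesis by (simp cong: if_cong)
        qed
      qed
    qed
    finally show "Poly_Mapping.lookup p w = Poly_Mapping.lookup (l + (\<Sum>x\<in>UNIV. star (S x) * S x)) w" by simp
  qed
  also have "(\<Sum>x\<in>UNIV. star (S x) * S x) = (\<Sum>t\<leftarrow>map S xs. star t * t)"
    using xs by (simp add: sum.distinct_set_conv_list[symmetric] comp_def)
  finally show ?thesis
    by (intro exI[of _ l] exI[of _ "map S xs"]) (auto simp: linear_poly_iff l_def S_def)
qed

section \<open>Homogeneous polynomials with injective values\<close>

text \<open>
The scalar by which a word in weighted cyclic shifts acts on the basis vector \<open>i\<close>.
\<close>

fun path_weight :: "('g \<Rightarrow> nat \<Rightarrow> 'a::comm_semiring_1) \<Rightarrow> nat \<Rightarrow> nat \<Rightarrow> 'g list \<Rightarrow> 'a" where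
  "path_weight a m i [] = 1"
| "path_weight a m i (j # w) = a j ((i + length w) mod m) * path_weight a m i w"

definition cyclic_shift :: "nat \<Rightarrow> ('g \<Rightarrow> nat \<Rightarrow> 'a::comm_semiring_1) \<Rightarrow> 'g \<Rightarrow> nat \<Rightarrow> nat \<Rightarrow> 'a" where
  "cyclic_shift m a j r c = (if r = Suc c mod m then a j c else 0)"

lemma Suc_mod_inj:
  assumes "c < m" "c' < m" "Suc c mod m = Suc c' mod m"
  shows "c = c'"
  using assms by (auto simp: mod_Suc split: if_splits)

lemma act_cyclic_shift:
  assumes "i < m"
  shows "act {..<m} (cyclic_shift m a) w v ((i + length w) mod m) = path_weight a m i w * v i"
proof (induction w)
  case Nil
  then show ?case using assms by simp
next
  case (Cons j w)
  let ?q = "(i + length w) mod m"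
  have q: "?q < m" using assms by simp
  have "cyclic_shift m a j ((i + length (j # w)) mod m) c = (if c = ?q then a j c else 0)" if "c < m" for c
  proof -
    have "(i + length (j # w)) mod m = Suc ?q mod m" by (simp add: mod_Suc_eq)
    moreover have "Suc ?q mod m = Suc c mod m \<longleftrightarrow> c = ?q" using Suc_mod_inj[OF that q] by metis
    ultimately show ?thesis by (simp only: cyclic_shift_def)
  qed
  then have "act {..<m} (cyclic_shift m a) (j # w) v ((i + length (j # w)) mod m)
     = (\<Sum>c\<in>{..<m}. if c = ?q then a j c * act {..<m} (cyclic_shift m a) w v c else 0)"
    unfolding act.simps by (intro sum.cong refl) auto
  also have "\<dots> = a j ?q * act {..<m} (cyclic_shift m a) w v ?q"
    using q by simp
  finally show ?case by (simp add: Cons mult.assoc)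
qed

text \<open>
With weights \<open>T ^ (2 ^ e (j, c))\<close> the weight of a word is a power of \<open>T\<close> whose exponent encodes in
binary the set of steps (letter and position) that the word makes. As long as the word does not
wind around the cycle, the positions are distinct and the set determines the word.
\<close>

fun path_code :: "('g \<times> nat \<Rightarrow> nat) \<Rightarrow> nat \<Rightarrow> nat \<Rightarrow> 'g list \<Rightarrow> nat set" where
  "path_code e m i [] = {}"
| "path_code e m i (j # w) = insert (e (j, (i + length w) mod m)) (path_code e m i w)"

lemma finite_path_code [simp]: "finite (path_code e m i w)"
  by (induction w) auto

lemma path_code_later:
  assumes "inj e" "length w \<le> l" "l < m"
  shows "e (j, (i + l) mod m) \<notin> path_code e m i w"
  using assms(2)
proof (induction w)
  case (Cons k w)
  have "(i + l) mod m \<noteq> (i + length w) mod m"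
  proof
    assume "(i + l) mod m = (i + length w) mod m"
    then have "m dvd (i + l) - (i + length w)"
      using Cons.prems mod_eq_dvd_iff_nat[of "i + length w" "i + l" m] by simp
    then have "m dvd l - length w" by simp
    then show False using Cons.prems assms(3) by (auto dest: dvd_imp_le)
  qed
  then show ?case using Cons assms(1) by (auto simp: inj_eq)
qed simp

lemma path_weight_monom:
  assumes "inj e" "length w \<le> m"
  shows "path_weight (\<lambda>j c. monom 1 (2 ^ e (j, c))) m i w = monom (1 :: 'a :: comm_semiring_1) (set_encode (path_code e m i w))"
  using assms(2)
proof (induction w)
  case Nil
  then show ?case by (simp add: monom_0)
next
  case (Cons j w)
  then show ?case using path_code_later[OF assms(1), of w "length w" m j i]
    by (simp add: mult_monom)
qed

lemma path_code_inj:
  assumes "inj e" "length w = length w'" "length w \<le> m" "path_code e m i w = path_code e m i w'"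
  shows "w = w'"
  using assms(2-4)
proof (induction w w' rule: list_induct2)
  case (Cons j w j' w')
  have notin: "e (k, (i + length w) mod m) \<notin> path_code e m i w" "e (k, (i + length w) mod m) \<notin> path_code e m i w'" for k
    using path_code_later[OF assms(1)] Cons by auto
  then have "e (j, (i + length w) mod m) = e (j', (i + length w) mod m)"
    using Cons.prems(2) Cons.hyps by (metis insert_iff path_code.simps(2))
  then have "j = j'" using assms(1) by (auto simp: inj_eq)
  moreover have "path_code e m i w = path_code e m i w'"
    using Cons.prems(2) Cons.hyps notin \<open>j = j'\<close> by (metis insert_ident path_code.simps(2))
  ultimately show ?case using Cons by simp
qed simp

text \<open>
For monomial weights the sums are nonzero polynomials in \<open>T\<close>, because distinct words contribute
distinct exponents; a common non-root \<open>T\<close> exists.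
\<close>

lemma generic_path_weights:
  fixes c :: "'g::finite list \<Rightarrow> real"
  assumes "finite A" "A \<noteq> {}" "\<And>w. w \<in> A \<Longrightarrow> length w = d" "\<And>w. w \<in> A \<Longrightarrow> c w \<noteq> 0" "d \<le> m"
  shows "\<exists>a :: 'g \<Rightarrow> nat \<Rightarrow> real. \<forall>i<m. (\<Sum>w\<in>A. c w * path_weight a m i w) \<noteq> 0"
proof -
  obtain idx :: "'g \<Rightarrow> nat" where idx: "inj idx"
    using finite_imp_inj_to_nat_seg[of "UNIV :: 'g set"] by auto
  define e where "e = (\<lambda>(j, c). prod_encode (idx j, c))"
  have e: "inj e" using idx by (auto simp: e_def inj_def)
  define q :: "nat \<Rightarrow> real poly" where 
    "q i = (\<Sum>w\<in>A. smult (c w) (path_weight (\<lambda>j c. monom 1 (2 ^ e (j, c))) m i w))" for i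
  have "q i \<noteq> 0" for i
  proof -
    obtain w0 where w0: "w0 \<in> A" using assms(2) by blast
    have "coeff (q i) (set_encode (path_code e m i w0)) = (\<Sum>w\<in>A. if w = w0 then c w else 0)"
      unfolding q_def coeff_sum
    proof (intro sum.cong refl)
      fix w assume "w \<in> A"
      then have "set_encode (path_code e m i w) = set_encode (path_code e m i w0) \<longleftrightarrow> w = w0"
        using path_code_inj[OF e, of w w0 m i] w0 assms(3,5) by (auto simp: set_encode_eq)
      then show "coeff (smult (c w) (path_weight (\<lambda>j c. monom 1 (2 ^ e (j, c))) m i w)) (set_encode (path_code e m i w0))
           = (if w = w0 then c w else 0)"
        using \<open>w \<in> A\<close> assms(3,5) by (simp add: path_weight_monom[OF e])
    qed
    also have "\<dots> \<noteq> 0" using w0 assms(1,4) by simp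
    finally show ?thesis by auto
  qed
  then have "(\<Prod>i<m. q i) \<noteq> 0" by simp
  then have "finite {x. poly (\<Prod>i<m. q i) x = 0}" by (rule poly_roots_finite)
  then obtain x where "poly (\<Prod>i<m. q i) x \<noteq> 0" 
    using infinite_UNIV_char_0[where 'a = real] by (metis (mono_tags, lifting) UNIV_eq_I mem_Collect_eq)
  then have x: "poly (q i) x \<noteq> 0" if "i < m" for i using that by (auto simp: poly_prod)
  have "poly (path_weight (\<lambda>j c. monom 1 (2 ^ e (j, c))) m i w) x = path_weight (\<lambda>j c. x ^ (2 ^ e (j, c))) m i w" for i w
    by (induction w) (simp_all add: poly_monom)
  then have "poly (q i) x = (\<Sum>w\<in>A. c w * path_weight (\<lambda>j c. x ^ (2 ^ e (j, c))) m i w)" for i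
    by (simp add: q_def poly_sum)
  then show ?thesis using x by metis
qed

text \<open>
At a weighted cyclic shift \<open>S\<close> the homogeneous polynomial is again a weighted shift, with nonzero
weights, hence injective. To pass to hermitian matrices, split \<open>S = P + K\<close> into symmetric and skew
parts and consider \<open>P + z \<i> K\<close>: it is \<open>S\<close> at \<open>z = - \<i>\<close> and hermitian at real \<open>z\<close>. The determinant of
the polynomial at this tuple is a polynomial in \<open>z\<close> that does not vanish at \<open>- \<i>\<close>, so it has a real
non-root.
\<close>

lemma generic_hermitian_injective:
  fixes c :: "'g::finite list \<Rightarrow> real"
  assumes "finite A" "A \<noteq> {}" "\<And>w. w \<in> A \<Longrightarrow> length w = d" "\<And>w. w \<in> A \<Longrightarrow> c w \<noteq> 0" "d \<le> m"
  shows "\<exists>(P :: 'g \<Rightarrow> nat \<Rightarrow> nat \<Rightarrow> real) K. 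
    (\<forall>j r k. P j r k = P j k r) \<and> (\<forall>j r k. K j r k = - K j k r) \<and>
    (\<forall>v. (\<forall>r<m. (\<Sum>w\<in>A. complex_of_real (c w) * act {..<m} (\<lambda>j r k. Complex (P j r k) (K j r k)) w v r) = 0)
        \<longrightarrow> (\<forall>r<m. v r = 0))"
proof -
  obtain a :: "'g \<Rightarrow> nat \<Rightarrow> real" where a: "\<And>i. i < m \<Longrightarrow> (\<Sum>w\<in>A. c w * path_weight a m i w) \<noteq> 0"
    using generic_path_weights[of A d c m] assms by blast
  let ?S = "cyclic_shift m a"
  define P where "P j r k = (?S j r k + ?S j k r) / 2" for j r k
  define K where "K j r k = (?S j r k - ?S j k r) / 2" for j r k
  define H where "H j r k = [:complex_of_real (P j r k), \<i> * complex_of_real (K j r k):]" for j r k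
  define M where "M z = mat m m (\<lambda>(r, k). \<Sum>w\<in>A. complex_of_real (c w) * 
      act {..<m} (\<lambda>j r k. poly (H j r k) z) w (\<lambda>l. if l = k then 1 else 0) r)" for z
  define D where "D = det (mat m m (\<lambda>(r, k). \<Sum>w\<in>A. smult (complex_of_real (c w)) 
      (act {..<m} H w (\<lambda>l. if l = k then 1 else 0) r)))"
  have polyD: "poly D z = det (M z)" for z
  proof -
    interpret comm_ring_hom "\<lambda>q :: complex poly. poly q z" by unfold_locales auto
    have "map_mat (\<lambda>q. poly q z) (mat m m (\<lambda>(r, k). \<Sum>w\<in>A. smult (complex_of_real (c w)) 
      (act {..<m} H w (\<lambda>l. if l = k then 1 else 0) r))) = M z"
    proof (rule eq_matI)
      have "poly (if l = k then 1 else 0) z = (if l = k then 1 else 0)" for l k :: nat by simp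
      then show "map_mat (\<lambda>q. poly q z) (mat m m (\<lambda>(r, k). \<Sum>w\<in>A. smult (complex_of_real (c w)) 
          (act {..<m} H w (\<lambda>l. if l = k then 1 else 0) r))) $$ (r, k) = M z $$ (r, k)"
        if "r < dim_row (M z)" "k < dim_col (M z)" for r k
        using that by (simp only: M_def dim_row_mat dim_col_mat index_map_mat index_mat split poly_sum poly_smult poly_act)
    qed (simp_all add: M_def)
    then show ?thesis unfolding D_def by (simp only: hom_det[symmetric])
  qed
  have Mv: "(M z *\<^sub>v vec m v) $ r = (\<Sum>w\<in>A. complex_of_real (c w) * act {..<m} (\<lambda>j r k. poly (H j r k) z) w v r)" 
    if "r < m" for z v r
  proof -
    have "(M z *\<^sub>v vec m v) $ r = (\<Sum>k<m. \<Sum>w\<in>A. complex_of_real (c w) * 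
      (act {..<m} (\<lambda>j r k. poly (H j r k) z) w (\<lambda>l. if l = k then 1 else 0) r * v k))"
      using that by (simp add: M_def scalar_prod_def lessThan_atLeast0 sum_distrib_right sum_distrib_left mult_ac)
    also have "\<dots> = (\<Sum>w\<in>A. complex_of_real (c w) * act {..<m} (\<lambda>j r k. poly (H j r k) z) w v r)"
      unfolding act_expand[OF finite_lessThan, of r m _ _ v, unfolded lessThan_iff, OF that]
      by (subst sum.swap) (simp add: sum_distrib_left)
    finally show ?thesis .
  qed
  have inj_iff: "det (M z) \<noteq> 0 \<longleftrightarrow> (\<forall>v. (\<forall>r<m. (\<Sum>w\<in>A. complex_of_real (c w) * 
      act {..<m} (\<lambda>j r k. poly (H j r k) z) w v r) = 0) \<longrightarrow> (\<forall>r<m. v r = 0))" for z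
  proof -
    have M: "M z \<in> carrier_mat m m" by (simp add: M_def)
    have "det (M z) \<noteq> 0 \<longleftrightarrow> (\<forall>x\<in>carrier_vec m. M z *\<^sub>v x = 0\<^sub>v m \<longrightarrow> x = 0\<^sub>v m)"
      using det_0_iff_vec_prod_zero_field[OF M] by blast
    also have "\<dots> \<longleftrightarrow> (\<forall>v. M z *\<^sub>v vec m v = 0\<^sub>v m \<longrightarrow> vec m v = 0\<^sub>v m)"
    proof safe
      fix x :: "complex vec" assume *: "\<forall>v. M z *\<^sub>v vec m v = 0\<^sub>v m \<longrightarrow> vec m v = 0\<^sub>v m" 
        and x: "x \<in> carrier_vec m" "M z *\<^sub>v x = 0\<^sub>v m"
      have "vec m (\<lambda>i. x $ i) = x" using x(1) by (intro eq_vecI) auto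
      then show "x = 0\<^sub>v m" using * x(2) by metis
    qed auto
    also have "\<dots> \<longleftrightarrow> (\<forall>v. (\<forall>r<m. (M z *\<^sub>v vec m v) $ r = 0) \<longrightarrow> (\<forall>r<m. v r = 0))"
    proof -
      have "M z *\<^sub>v vec m v = 0\<^sub>v m \<longleftrightarrow> (\<forall>r<m. (M z *\<^sub>v vec m v) $ r = 0)" for v
        using M by (auto simp: vec_eq_iff)
      moreover have "vec m v = 0\<^sub>v m \<longleftrightarrow> (\<forall>r<m. v r = 0)" for v :: "nat \<Rightarrow> complex"
        by (auto simp: vec_eq_iff)
      ultimately show ?thesis by simp
    qed
    finally show ?thesis by (simp add: Mv)
  qed
  have "det (M (- \<i>)) \<noteq> 0"
    unfolding inj_iff
  proof (intro allI impI)
    fix v r assume v: "\<forall>r<m. (\<Sum>w\<in>A. complex_of_real (c w) * act {..<m} (\<lambda>j r k. poly (H j r k) (- \<i>)) w v r) = 0" "r < m"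
    have "poly (H j r k) (- \<i>) = complex_of_real (?S j r k)" for j r k
      by (simp add: H_def P_def K_def complex_eq_iff field_simps)
    then have H: "(\<lambda>j r k. poly (H j r k) (- \<i>)) = cyclic_shift m (\<lambda>j k. complex_of_real (a j k))"
      by (simp add: fun_eq_iff cyclic_shift_def)
    have pw: "path_weight (\<lambda>j k. complex_of_real (a j k)) m r w = complex_of_real (path_weight a m r w)" for w
      by (induction w) simp_all
    have "(r + d) mod m < m" using v(2) by simp
    then have "0 = (\<Sum>w\<in>A. complex_of_real (c w) * act {..<m} (cyclic_shift m (\<lambda>j k. complex_of_real (a j k))) w v ((r + d) mod m))"
      using v(1) by (simp add: H)
    also have "\<dots> = (\<Sum>w\<in>A. complex_of_real (c w * path_weight a m r w) * v r)"
    proof (intro sum.cong refl)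
      fix w assume "w \<in> A"
      then show "complex_of_real (c w) * act {..<m} (cyclic_shift m (\<lambda>j k. complex_of_real (a j k))) w v ((r + d) mod m)
          = complex_of_real (c w * path_weight a m r w) * v r"
        using act_cyclic_shift[OF v(2), of "\<lambda>j k. complex_of_real (a j k)" w v] assms(3) by (simp add: pw)
    qed
    also have "\<dots> = complex_of_real (\<Sum>w\<in>A. c w * path_weight a m r w) * v r"
      by (simp add: sum_distrib_right)
    finally show "v r = 0" using a[OF v(2)] by (auto simp del: of_real_sum)
  qed
  then have "D \<noteq> 0" using polyD[of "- \<i>"] by auto
  then have "finite {z. poly D z = 0}" by (rule poly_roots_finite)
  moreover have "infinite (range complex_of_real)"
    by (simp add: finite_image_iff inj_of_real infinite_UNIV_char_0)
  ultimately obtain x :: real where "poly D (complex_of_real x) \<noteq> 0"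
    by (metis (mono_tags, lifting) finite_subset image_subset_iff mem_Collect_eq)
  then have inj: "det (M (complex_of_real x)) \<noteq> 0" by (simp add: polyD)
  define K' where "K' j r k = x * K j r k" for j r k
  have H: "(\<lambda>j r k. poly (H j r k) (complex_of_real x)) = (\<lambda>j r k. Complex (P j r k) (K' j r k))"
    by (simp add: fun_eq_iff H_def K'_def complex_eq_iff)
  have "\<forall>j r k. P j r k = P j k r" "\<forall>j r k. K' j r k = - K' j k r"
    by (simp_all add: P_def K_def K'_def field_simps)
  with inj[unfolded inj_iff H] show ?thesis by blast
qed

text \<open>
The real form of the complex matrices \<open>P + \<i> K\<close>; \<open>False\<close> marks real parts and \<open>True\<close> imaginary parts.
\<close>

fun realify :: "('g \<Rightarrow> 'i \<Rightarrow> 'i \<Rightarrow> real) \<Rightarrow> ('g \<Rightarrow> 'i \<Rightarrow> 'i \<Rightarrow> real) \<Rightarrow> 'g \<Rightarrow> 'i \<times> bool \<Rightarrow> 'i \<times> bool \<Rightarrow> real" where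
  "realify P K j (r, b) (k, b') = (if b = b' then P j r k else if b then K j r k else - K j r k)"

lemma act_realify:
  assumes "finite I"
  shows "Complex (act (I \<times> UNIV) (realify P K) w f (r, False)) (act (I \<times> UNIV) (realify P K) w f (r, True))
    = act I (\<lambda>j r k. Complex (P j r k) (K j r k)) w (\<lambda>r. Complex (f (r, False)) (f (r, True))) r"
proof (induction w arbitrary: r)
  case (Cons j w)
  let ?f = "act (I \<times> UNIV) (realify P K) w f"
  have sum_pairs: "(\<Sum>x\<in>I \<times> UNIV. g x) = (\<Sum>k\<in>I. g (k, False) + g (k, True))" for g :: "'a \<times> bool \<Rightarrow> real"
    by (simp add: sum.cartesian_product' UNIV_bool add.commute)
  show ?case
    unfolding act.simps Cons[symmetric] sum_pairs
    by (simp add: complex_eq_iff Re_sum Im_sum sum.distrib sum_subtractf sum_negf)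
qed simp

text \<open>
The real form of a hermitian tuple of size \<open>m\<close> is a symmetric tuple of size \<open>2 * m\<close>, and an injective
complex matrix has an injective real form.
\<close>

lemma generic_symmetric_injective:
  fixes c :: "'g::finite list \<Rightarrow> real"
  assumes "finite A" "A \<noteq> {}" "\<And>w. w \<in> A \<Longrightarrow> length w = d" "\<And>w. w \<in> A \<Longrightarrow> c w \<noteq> 0" "d \<le> m"
  shows "\<exists>X. sym_kernels {..<2 * m} X \<and>
    (\<forall>f. (\<forall>i<2 * m. (\<Sum>w\<in>A. c w * act {..<2 * m} X w f i) = 0) \<longrightarrow> (\<forall>i<2 * m. f i = 0))"
proof -
  obtain P K where P: "\<And>j r k. P j r k = P j k r" and K: "\<And>j r k. K j r k = - K j k r" 
    and inj: "\<And>v. (\<And>r. r < m \<Longrightarrow> (\<Sum>w\<in>A. complex_of_real (c w) * 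
        act {..<m} (\<lambda>j r k. Complex (P j r k) (K j r k)) w v r) = 0) \<Longrightarrow> (\<forall>r<m. v r = 0)"
    using generic_hermitian_injective[of A d c m] assms by (smt (verit))
  let ?I = "{..<m} \<times> (UNIV :: bool set)"
  have card: "card ?I = 2 * m" by (simp add: card_cartesian_product)
  have fin: "finite ?I" by simp
  from ex_bij_betw_nat_finite[OF fin, unfolded card, folded lessThan_atLeast0]
  obtain e where e: "bij_betw e {..<2 * m} ?I" by blast
  have "realify P K j x y = realify P K j y x" for j x y
  proof -
    obtain r b k b' where "x = (r, b)" "y = (k, b')" by fastforce
    then show ?thesis using P[of j r k] K[of j r k] by auto
  qed
  then have "sym_kernels {..<2 * m} (\<lambda>j a b. realify P K j (e a) (e b))"
    by (simp add: sym_kernels_def)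
  moreover have "\<forall>i<2 * m. f i = 0"
    if f: "\<And>i. i < 2 * m \<Longrightarrow> (\<Sum>w\<in>A. c w * act {..<2 * m} (\<lambda>j a b. realify P K j (e a) (e b)) w f i) = 0" for f
  proof -
    define g where "g x = f (inv_into {..<2 * m} e x)" for x
    have g: "g (e i) = f i" if "i < 2 * m" for i
      using that e by (simp add: g_def bij_betw_inv_into_left)
    have act: "act {..<2 * m} (\<lambda>j a b. realify P K j (e a) (e b)) w f i = act ?I (realify P K) w g (e i)"
      if "i < 2 * m" for w i
    proof -
      have "act {..<2 * m} (\<lambda>j a b. realify P K j (e a) (e b)) w f i 
          = act {..<2 * m} (\<lambda>j a b. realify P K j (e a) (e b)) w (\<lambda>a. g (e a)) i"
        by (rule act_cong) (use g that in auto)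
      then show ?thesis using act_reindex[OF e, of i "realify P K" w g] that by simp
    qed
    have zero: "(\<Sum>w\<in>A. c w * act ?I (realify P K) w g x) = 0" if "x \<in> ?I" for x
    proof -
      have "x \<in> e ` {..<2 * m}" using that bij_betw_imp_surj_on[OF e] by simp
      then obtain i where "i < 2 * m" "e i = x" by auto
      then show ?thesis using f[of i] act[of i] by simp
    qed
    have "\<forall>r<m. Complex (g (r, False)) (g (r, True)) = 0"
    proof (rule inj)
      fix r assume "r < m"
      then have "(\<Sum>w\<in>A. c w * act ?I (realify P K) w g (r, b)) = 0" for b using zero by simp
      then show "(\<Sum>w\<in>A. complex_of_real (c w) * act {..<m} (\<lambda>j r k. Complex (P j r k) (K j r k)) w
          (\<lambda>r. Complex (g (r, False)) (g (r, True))) r) = 0"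
        by (simp add: act_realify[symmetric] complex_eq_iff Re_sum Im_sum)
    qed
    then have gz: "g x = 0" if "x \<in> ?I" for x
      using that by (cases x; cases "snd x") (auto simp: complex_eq_iff)
    show ?thesis
    proof (intro allI impI)
      fix i assume i: "i < 2 * m"
      then have "e i \<in> ?I" using bij_betwE[OF e] by blast
      then show "f i = 0" using g[OF i] gz by simp
    qed
  qed
  ultimately show ?thesis by blast
qed

section \<open>Negatives of sums of squares\<close>

definition homogeneous_kernel :: "'i set \<Rightarrow> ('g \<Rightarrow> 'i \<Rightarrow> 'i \<Rightarrow> real) \<Rightarrow> 'g free_poly \<Rightarrow> nat \<Rightarrow> 'i \<Rightarrow> 'i \<Rightarrow> real" where
  "homogeneous_kernel I X h e i k = (\<Sum>w\<in>{w \<in> Poly_Mapping.keys h. length (letters w) = e}.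
     Poly_Mapping.lookup h w * act I X (letters w) (\<lambda>l. if l = k then 1 else 0) i)"

lemma homogeneous_kernel_apply:
  assumes "finite I" "i \<in> I"
  shows "(\<Sum>k\<in>I. homogeneous_kernel I X h e i k * f k)
     = (\<Sum>w\<in>{w \<in> Poly_Mapping.keys h. length (letters w) = e}. Poly_Mapping.lookup h w * act I X (letters w) f i)"
  unfolding homogeneous_kernel_def act_expand[OF assms, of X _ f] sum_distrib_right sum_distrib_left
  by (subst sum.swap) (simp add: mult.assoc)

lemma kernel_l1_bound:
  "(\<Sum>i\<in>I. \<bar>\<Sum>k\<in>I. M i k * f k\<bar>) \<le> (\<Sum>i\<in>I. \<Sum>k\<in>I. \<bar>M i k\<bar>) * (\<Sum>k\<in>I. \<bar>f k :: real\<bar>)"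
  if "finite I"
proof -
  have "(\<Sum>i\<in>I. \<bar>\<Sum>k\<in>I. M i k * f k\<bar>) \<le> (\<Sum>i\<in>I. \<Sum>k\<in>I. \<bar>M i k\<bar> * \<bar>f k\<bar>)"
    by (intro sum_mono order_trans[OF sum_abs]) (simp add: abs_mult)
  also have "\<dots> \<le> (\<Sum>i\<in>I. \<Sum>k\<in>I. \<bar>M i k\<bar> * (\<Sum>k\<in>I. \<bar>f k\<bar>))"
    using that by (intro sum_mono mult_left_mono member_le_sum) auto
  finally show ?thesis by (simp add: sum_distrib_right)
qed

text \<open>
The leading part is bounded below because it has a left inverse, and grows one power of \<open>t\<close> faster
than everything else. The estimates are made in the \<open>\<ell>\<^sup>1\<close> norm, which is equivalent to the Euclidean
one.
\<close>

lemma injective_leading_part_grows: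
  fixes h :: "'g free_poly" and X :: "'g \<Rightarrow> 'i \<Rightarrow> 'i \<Rightarrow> real"
  assumes "finite I" "d \<ge> 1" and deg: "\<And>w. w \<in> Poly_Mapping.keys h \<Longrightarrow> length (letters w) \<le> d"
    and inj: "\<And>f. (\<And>i. i \<in> I \<Longrightarrow> (\<Sum>k\<in>I. homogeneous_kernel I X h d i k * f k) = 0) \<Longrightarrow> \<forall>k\<in>I. f k = 0"
  shows "\<exists>t0. \<forall>t f. \<bar>t\<bar> \<ge> t0 \<longrightarrow> B * (\<Sum>i\<in>I. (f i)\<^sup>2)
    \<le> (\<Sum>i\<in>I. (\<Sum>w\<in>Poly_Mapping.keys h. Poly_Mapping.lookup h w * act I (\<lambda>j i k. t * X j i k) (letters w) f i)\<^sup>2)"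
proof -
  let ?T = "homogeneous_kernel I X h"
  let ?n = "\<lambda>f. \<Sum>i\<in>I. \<bar>f i :: real\<bar>"
  let ?ap = "\<lambda>e f i. \<Sum>k\<in>I. ?T e i k * f k"
  let ?g = "\<lambda>t f i. \<Sum>w\<in>Poly_Mapping.keys h. Poly_Mapping.lookup h w * act I (\<lambda>j i k. t * X j i k) (letters w) f i"
  obtain C where C: "\<And>i k. i \<in> I \<Longrightarrow> k \<in> I \<Longrightarrow> (\<Sum>l\<in>I. C i l * ?T d l k) = (if i = k then 1 else 0)"
    using injective_kernel_inverse[of I "?T d", OF assms(1) inj] by metis
  define c0 where "c0 = (\<Sum>i\<in>I. \<Sum>k\<in>I. \<bar>C i k\<bar>) + 1"
  have c0: "c0 > 0" unfolding c0_def by (intro add_nonneg_pos sum_nonneg) auto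
  have lower: "?n f \<le> c0 * ?n (?ap d f)" for f
  proof -
    have inv: "f i = (\<Sum>l\<in>I. C i l * ?ap d f l)" if "i \<in> I" for i
    proof -
      have "(\<Sum>l\<in>I. C i l * ?ap d f l) = (\<Sum>k\<in>I. (\<Sum>l\<in>I. C i l * ?T d l k) * f k)"
        unfolding sum_distrib_left sum_distrib_right by (subst sum.swap) (simp add: mult.assoc)
      also have "\<dots> = (\<Sum>k\<in>I. if k = i then f k else 0)"
        using that by (intro sum.cong refl) (auto simp: C)
      finally show ?thesis using that assms(1) by simp
    qed
    have "?n f = (\<Sum>i\<in>I. \<bar>\<Sum>l\<in>I. C i l * ?ap d f l\<bar>)"
      by (rule sum.cong[OF refl], rule arg_cong[where f = abs], rule inv)
    also have "\<dots> \<le> (\<Sum>i\<in>I. \<Sum>k\<in>I. \<bar>C i k\<bar>) * ?n (?ap d f)" by (rule kernel_l1_bound[OF assms(1)])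
    also have "\<dots> \<le> c0 * ?n (?ap d f)" unfolding c0_def by (intro mult_right_mono sum_nonneg) auto
    finally show ?thesis .
  qed
  define c1 where "c1 = (\<Sum>e<d. \<Sum>i\<in>I. \<Sum>k\<in>I. \<bar>?T e i k\<bar>)"
  have split: "?g t f i = t ^ d * ?ap d f i + (\<Sum>e<d. t ^ e * ?ap e f i)" if "i \<in> I" for t f i
  proof -
    have "?g t f i = (\<Sum>w\<in>Poly_Mapping.keys h. t ^ length (letters w) * (Poly_Mapping.lookup h w * act I X (letters w) f i))"
      by (simp add: act_scale_kernels mult_ac)
    also have "\<dots> = (\<Sum>e\<in>{..d}. \<Sum>w\<in>{w \<in> Poly_Mapping.keys h. length (letters w) = e}. 
        t ^ length (letters w) * (Poly_Mapping.lookup h w * act I X (letters w) f i))"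
      by (rule sum.group[symmetric]) (use deg in auto)
    also have "\<dots> = (\<Sum>e\<in>{..d}. t ^ e * ?ap e f i)"
      unfolding homogeneous_kernel_apply[OF assms(1) that] sum_distrib_left
      by (intro sum.cong refl) auto
    also have "\<dots> = t ^ d * ?ap d f i + (\<Sum>e<d. t ^ e * ?ap e f i)"
      by (simp add: lessThan_Suc_atMost[symmetric])
    finally show ?thesis .
  qed
  have grow: "(\<bar>t\<bar> / c0 - c1) * ?n f \<le> ?n (?g t f)" if t: "\<bar>t\<bar> \<ge> 1" "\<bar>t\<bar> / c0 - c1 \<ge> 0" for t f
  proof -
    have p1: "\<bar>t\<bar> ^ (d - 1) \<ge> 1" using t(1) by (rule one_le_power)
    have low: "?n (\<lambda>i. \<Sum>e<d. t ^ e * ?ap e f i) \<le> \<bar>t\<bar> ^ (d - 1) * (c1 * ?n f)"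
    proof -
      have "?n (\<lambda>i. \<Sum>e<d. t ^ e * ?ap e f i) \<le> (\<Sum>i\<in>I. \<Sum>e<d. \<bar>t\<bar> ^ e * \<bar>?ap e f i\<bar>)"
        by (intro sum_mono order_trans[OF sum_abs]) (simp add: abs_mult power_abs)
      also have "\<dots> = (\<Sum>e<d. \<bar>t\<bar> ^ e * ?n (?ap e f))"
        by (subst sum.swap) (simp add: sum_distrib_left)
      also have "\<dots> \<le> (\<Sum>e<d. \<bar>t\<bar> ^ (d - 1) * ((\<Sum>i\<in>I. \<Sum>k\<in>I. \<bar>?T e i k\<bar>) * ?n f))"
        using t(1) by (intro sum_mono mult_mono power_increasing kernel_l1_bound[OF assms(1)] sum_nonneg) auto
      also have "\<dots> = \<bar>t\<bar> ^ (d - 1) * (c1 * ?n f)"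
      proof -
        have "(\<Sum>e<d. a * (b e * N)) = a * ((\<Sum>e<d. b e) * N)" for a N :: real and b
          by (simp add: sum_distrib_left sum_distrib_right)
        then show ?thesis by (simp only: c1_def)
      qed
      finally show ?thesis .
    qed
    have "\<bar>t\<bar> ^ (d - 1) * (\<bar>t\<bar> / c0 * ?n f) \<le> \<bar>t\<bar> ^ (d - 1) * (\<bar>t\<bar> / c0 * (c0 * ?n (?ap d f)))"
      using c0 by (intro mult_left_mono lower) auto
    also have "\<dots> = \<bar>t\<bar> ^ d * ?n (?ap d f)"
      using c0 assms(2) by (simp add: power_eq_if)
    also have "\<dots> = ?n (\<lambda>i. t ^ d * ?ap d f i)"
      by (subst sum_distrib_left) (simp only: abs_mult power_abs)
    also have "\<dots> \<le> (\<Sum>i\<in>I. \<bar>?g t f i\<bar> + \<bar>\<Sum>e<d. t ^ e * ?ap e f i\<bar>)"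
      by (intro sum_mono) (simp add: split)
    also have "\<dots> = ?n (?g t f) + ?n (\<lambda>i. \<Sum>e<d. t ^ e * ?ap e f i)" by (rule sum.distrib)
    finally have "\<bar>t\<bar> ^ (d - 1) * ((\<bar>t\<bar> / c0 - c1) * ?n f) \<le> ?n (?g t f)"
      using low by (simp add: algebra_simps)
    moreover have "1 * ((\<bar>t\<bar> / c0 - c1) * ?n f) \<le> \<bar>t\<bar> ^ (d - 1) * ((\<bar>t\<bar> / c0 - c1) * ?n f)"
      using p1 t(2) by (intro mult_right_mono mult_nonneg_nonneg sum_nonneg) auto
    ultimately show ?thesis by simp
  qed
  \<comment> \<open>the factor \<open>card I\<close> pays for passing from the \<open>\<ell>\<^sup>1\<close> norm back to squares\<close>
  define \<tau> where "\<tau> = real (card I) * \<bar>B\<bar> + 1"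
  have \<tau>: "\<tau> \<ge> 1" by (simp add: \<tau>_def)
  have "B * (\<Sum>i\<in>I. (f i)\<^sup>2) \<le> (\<Sum>i\<in>I. (?g t f i)\<^sup>2)" if t: "\<bar>t\<bar> \<ge> max 1 (c0 * (c1 + \<tau>))" for t f
  proof (cases "I = {}")
    case False
    then have card: "real (card I) > 0" using assms(1) by (simp add: card_gt_0_iff)
    have t\<tau>: "\<tau> \<le> \<bar>t\<bar> / c0 - c1" using t c0 by (simp add: field_simps)
    have "\<tau> * ?n f \<le> (\<bar>t\<bar> / c0 - c1) * ?n f" using t\<tau> by (intro mult_right_mono sum_nonneg) auto
    also have "\<dots> \<le> ?n (?g t f)" using t t\<tau> \<tau> by (intro grow) auto
    finally have "(\<tau> * ?n f)\<^sup>2 \<le> (?n (?g t f))\<^sup>2"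
      using \<tau> by (intro power_mono mult_nonneg_nonneg sum_nonneg) auto
    also have "\<dots> \<le> (\<Sum>i\<in>I. (?g t f i)\<^sup>2) * real (card I)"
      using Cauchy_Schwarz_ineq_sum[of "\<lambda>i. \<bar>?g t f i\<bar>" "\<lambda>_. 1" I] by simp
    finally have up: "\<tau>\<^sup>2 * (?n f)\<^sup>2 \<le> (\<Sum>i\<in>I. (?g t f i)\<^sup>2) * real (card I)" by (simp add: power_mult_distrib)
    have f2: "(\<Sum>i\<in>I. (f i)\<^sup>2) \<le> (?n f)\<^sup>2"
    proof -
      have "(\<Sum>i\<in>I. (f i)\<^sup>2) = (\<Sum>i\<in>I. \<bar>f i\<bar> * \<bar>f i\<bar>)" by (simp add: power2_eq_square)
      also have "\<dots> \<le> (\<Sum>i\<in>I. \<bar>f i\<bar> * ?n f)"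
        using assms(1) by (intro sum_mono mult_left_mono member_le_sum) auto
      finally show ?thesis by (simp add: power2_eq_square sum_distrib_right)
    qed
    have "real (card I) * B \<le> real (card I) * \<bar>B\<bar>" by (intro mult_left_mono) auto
    also have "\<dots> \<le> \<tau> * \<tau>" using \<tau> mult_left_mono[of 1 \<tau> \<tau>] by (simp add: \<tau>_def)
    finally have "real (card I) * B * (\<Sum>i\<in>I. (f i)\<^sup>2) \<le> \<tau> * \<tau> * (\<Sum>i\<in>I. (f i)\<^sup>2)"
      by (intro mult_right_mono sum_nonneg) auto
    also have "\<dots> \<le> \<tau> * \<tau> * (?n f)\<^sup>2" using f2 \<tau> by (intro mult_left_mono) auto
    finally have "real (card I) * (B * (\<Sum>i\<in>I. (f i)\<^sup>2)) \<le> real (card I) * (\<Sum>i\<in>I. (?g t f i)\<^sup>2)"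
      using up by (simp add: power2_eq_square mult_ac)
    then show ?thesis using card by (simp add: mult_le_cancel_left_pos)
  qed simp
  then show ?thesis by blast
qed

lemma act_zero_kernels: "act I (\<lambda>_ _ _. 0) w v = (if w = [] then v else (\<lambda>_. 0))"
  by (cases w) (auto simp: fun_eq_iff)

lemma pairing_zero_kernels:
  "pairing p (moment I (\<lambda>_ _ _. 0) v) = Poly_Mapping.lookup p 0 * (\<Sum>i\<in>I. (v i)\<^sup>2)"
proof -
  have "moment I (\<lambda>_ _ _. 0) v w = (\<Sum>i\<in>I. (v i)\<^sup>2) * (if w = [] then 1 else 0)" for w
    by (simp add: moment_def act_zero_kernels power2_eq_square)
  then have eq: "moment I (\<lambda>_ _ _. 0) v = (\<lambda>w. (\<Sum>i\<in>I. (v i)\<^sup>2) * (if w = [] then 1 else 0))" ..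
  show ?thesis
    unfolding eq pairing_scale_right pairing_delta by (simp add: zero_free_word_def)
qed

lemma quasi_convex_constant_term:
  assumes "quasi_convex p"
  shows "Poly_Mapping.lookup p 0 = 0"
proof -
  have "poly_kernel {..<1::nat} p (\<lambda>_ _ _. 0) 0 0 = 0"
  proof -
    have "eval_poly 1 p (\<lambda>_. 0\<^sub>m 1 1) = 0\<^sub>m 1 1" using assms by (simp add: quasi_convex_def)
    then have "poly_kernel {..<1::nat} p (\<lambda>j a b. (0\<^sub>m 1 1 :: real mat) $$ (a, b)) 0 0 = 0"
      using eval_poly_index[of "\<lambda>_. 0\<^sub>m 1 1" 1 0 0 p] by simp
    moreover have "quad {..<1::nat} (poly_kernel {..<1::nat} p (\<lambda>j a b. (0\<^sub>m 1 1 :: real mat) $$ (a, b))) (\<lambda>_. 1)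
       = quad {..<1::nat} (poly_kernel {..<1::nat} p (\<lambda>_ _ _. 0)) (\<lambda>_. 1)"
      unfolding quad_poly_kernel[OF finite_lessThan]
      by (intro arg_cong[where f = "pairing p"] ext moment_cong) auto
    ultimately show ?thesis by (simp add: quad_def)
  qed
  then have "quad {..<1::nat} (poly_kernel {..<1::nat} p (\<lambda>_ _ _. 0)) (\<lambda>_. 1) = 0" by (simp add: quad_def)
  then show ?thesis by (simp add: quad_poly_kernel pairing_zero_kernels)
qed

text \<open>
The tuples \<open>t X\<close> and \<open>- t X\<close> lie in the sublevel set for large \<open>t\<close>, because a single nonzero term \<open>h\<close>
of the sum of squares already dominates \<open>B\<close>; it has no constant term because \<open>p\<close> has none, so its
degree is at least one. The midpoint \<open>0\<close> of the two tuples does not lie in the sublevel set.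
\<close>

lemma zero_if_negative_is_sos_and_sublevel_convex:
  fixes p :: "'g::finite free_poly"
  assumes sym: "symmetric_poly p" and p0: "Poly_Mapping.lookup p 0 = 0" and sos: "sum_of_squares (- p)"
    and convex: "\<And>n. n \<ge> N \<Longrightarrow> \<exists>B\<in>sym_mats n. \<not> pos_semidef n B \<and> convex_tuples (sublevel_set n p B)"
  shows "p = 0"
proof (rule ccontr)
  assume "p \<noteq> 0"
  obtain hs where hs: "- p = (\<Sum>h\<leftarrow>hs. star h * h)" using sos by (auto simp: sum_of_squares_def)
  have "\<exists>h\<in>set hs. h \<noteq> 0"
  proof (rule ccontr)
    assume "\<not> ?thesis"
    then have "(\<Sum>h\<leftarrow>hs. star h * h) = (\<Sum>h\<leftarrow>hs. 0)" by (intro arg_cong[where f = sum_list] map_cong) auto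
    then show False using hs \<open>p \<noteq> 0\<close> by simp
  qed
  then obtain h where h: "h \<in> set hs" "h \<noteq> 0" by blast
  have pairing_p: "- pairing p (moment I X f) = (\<Sum>h\<leftarrow>hs. \<Sum>i\<in>I. (\<Sum>w\<in>Poly_Mapping.keys h. Poly_Mapping.lookup h w * act I X (letters w) f i)\<^sup>2)"
    if "sym_kernels I X" for I :: "'i set" and X f
    using hs by (simp add: pairing_uminus[symmetric] pairing_sum_list pairing_square[OF that] del: pairing_uminus)
  have pairing_le: "(\<Sum>i\<in>I. (\<Sum>w\<in>Poly_Mapping.keys h. Poly_Mapping.lookup h w * act I X (letters w) f i)\<^sup>2) \<le> - pairing p (moment I X f)"
    if "sym_kernels I X" for I :: "nat set" and X f
    unfolding pairing_p[OF that] by (rule member_le_sum_list) (use h in \<open>auto intro!: sum_nonneg\<close>)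
  have h0: "Poly_Mapping.lookup h 0 = 0"
  proof -
    have "(\<Sum>i\<in>{0::nat}. (\<Sum>w\<in>Poly_Mapping.keys h. Poly_Mapping.lookup h w * act {0} (\<lambda>_ _ _. 0) (letters w) (\<lambda>_. 1) i)\<^sup>2) \<le> 0"
      using pairing_le[of "{0}" "\<lambda>_ _ _. 0" "\<lambda>_. 1"] by (simp add: sym_kernels_def pairing_zero_kernels p0)
    moreover have "letters w = [] \<longleftrightarrow> w = 0" for w :: "'g free_word"
      by (cases w) (auto simp: zero_free_word_def)
    ultimately show ?thesis
      by (simp add: act_zero_kernels if_distrib[of "\<lambda>c. _ * c"] if_distrib[of "\<lambda>f. f 0"] in_keys_iff
          cong: if_cong split: if_splits)
  qed
  define d where "d = Max ((length \<circ> letters) ` Poly_Mapping.keys h)"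
  have "Poly_Mapping.keys h \<noteq> {}" using h(2) by simp
  then have "d \<in> (length \<circ> letters) ` Poly_Mapping.keys h" unfolding d_def by (intro Max_in) auto
  then obtain w0 where w0: "w0 \<in> Poly_Mapping.keys h" "length (letters w0) = d" by auto
  have deg: "length (letters w) \<le> d" if "w \<in> Poly_Mapping.keys h" for w
    unfolding d_def using that by (intro Max_ge) auto
  have "d \<ge> 1"
  proof (rule ccontr)
    assume "\<not> d \<ge> 1"
    then have "length (letters w0) = 0" using w0(2) by simp
    then have "w0 = 0" by (cases w0) (simp add: zero_free_word_def)
    then show False using w0(1) h0 by (simp add: in_keys_iff)
  qed
  define A where "A = letters ` {w \<in> Poly_Mapping.keys h. length (letters w) = d}"
  define m where "m = max N d"
  define n where "n = 2 * m"
  have n: "n \<ge> N" "n > 0" using \<open>d \<ge> 1\<close> by (auto simp: n_def m_def)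
  let ?I = "{..<n}"
  have "\<exists>X. sym_kernels {..<2 * m} X \<and> (\<forall>f. 
      (\<forall>i<2 * m. (\<Sum>w\<in>A. Poly_Mapping.lookup h (Word w) * act {..<2 * m} X w f i) = 0) \<longrightarrow> (\<forall>i<2 * m. f i = 0))"
  proof (rule generic_symmetric_injective)
    show "finite A" "A \<noteq> {}" using w0 by (auto simp: A_def)
    show "d \<le> m" by (simp add: m_def)
    fix w assume "w \<in> A"
    then obtain w' where w': "w = letters w'" "w' \<in> Poly_Mapping.keys h" "length (letters w') = d"
      by (auto simp: A_def)
    then show "length w = d" "Poly_Mapping.lookup h (Word w) \<noteq> 0" by (simp_all add: in_keys_iff)
  qed
  then obtain X where "sym_kernels {..<2 * m} X \<and> (\<forall>f. 
      (\<forall>i<2 * m. (\<Sum>w\<in>A. Poly_Mapping.lookup h (Word w) * act {..<2 * m} X w f i) = 0) \<longrightarrow> (\<forall>i<2 * m. f i = 0))" ..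
  then have X: "sym_kernels ?I X"
    and inj: "\<And>f. (\<forall>i<n. (\<Sum>w\<in>A. Poly_Mapping.lookup h (Word w) * act ?I X w f i) = 0) \<Longrightarrow> \<forall>i<n. f i = 0"
    unfolding n_def by simp_all
  have A_sum: "(\<Sum>w\<in>A. Poly_Mapping.lookup h (Word w) * act ?I X w f i) = (\<Sum>k\<in>?I. homogeneous_kernel ?I X h d i k * f k)"
    if "i < n" for f i
    unfolding A_def using that
    by (subst sum.reindex) (auto simp: homogeneous_kernel_apply inj_on_subset[OF inj_letters])
  obtain B where B: "B \<in> sym_mats n" "\<not> pos_semidef n B" "convex_tuples (sublevel_set n p B)"
    using convex[OF n(1)] by blast
  define \<beta> where "\<beta> = (\<Sum>i\<in>?I. \<Sum>k\<in>?I. \<bar>B $$ (i, k)\<bar>)"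
  have "\<exists>t0. \<forall>t f. \<bar>t\<bar> \<ge> t0 \<longrightarrow> (\<beta> + 1) * (\<Sum>i\<in>?I. (f i)\<^sup>2)
    \<le> (\<Sum>i\<in>?I. (\<Sum>w\<in>Poly_Mapping.keys h. Poly_Mapping.lookup h w * act ?I (\<lambda>j i k. t * X j i k) (letters w) f i)\<^sup>2)"
  proof (rule injective_leading_part_grows[OF finite_lessThan \<open>d \<ge> 1\<close> deg])
    fix f assume f: "\<And>i. i \<in> ?I \<Longrightarrow> (\<Sum>k\<in>?I. homogeneous_kernel ?I X h d i k * f k) = 0"
    have "\<forall>i<n. f i = 0" by (rule inj) (simp add: A_sum f)
    then show "\<forall>k\<in>?I. f k = 0" by simp
  qed
  then obtain t0 where t0: "\<And>t f. \<bar>t\<bar> \<ge> t0 \<Longrightarrow> (\<beta> + 1) * (\<Sum>i\<in>?I. (f i)\<^sup>2)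
    \<le> (\<Sum>i\<in>?I. (\<Sum>w\<in>Poly_Mapping.keys h. Poly_Mapping.lookup h w * act ?I (\<lambda>j i k. t * X j i k) (letters w) f i)\<^sup>2)"
    by blast
  let ?M = "\<lambda>t j. mat n n (\<lambda>(i, k). t * X j i k)"
  have tup: "?M t \<in> sym_tuples n" for t
    using X by (auto simp: sym_tuples_def sym_mats_iff sym_kernels_def)
  have mom: "moment ?I (\<lambda>j a b. ?M t j $$ (a, b)) f = moment ?I (\<lambda>j i k. t * X j i k) f" for t f
    by (rule ext, rule moment_cong) auto
  have mem: "?M t \<in> sublevel_set n p B" if "\<bar>t\<bar> \<ge> t0" for t
    unfolding sublevel_set_iff[OF sym B(1) tup] mom
  proof (intro allI impI)
    fix f :: "nat \<Rightarrow> real" assume "\<exists>i\<in>?I. f i \<noteq> 0"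
    then obtain i where "i \<in> ?I" "f i \<noteq> 0" by blast
    then have pos: "0 < (\<Sum>i\<in>?I. (f i)\<^sup>2)" by (intro sum_pos2[of _ i]) auto
    have "sym_kernels ?I (\<lambda>j i k. t * X j i k)" using X by (auto simp: sym_kernels_def)
    from order_trans[OF t0[OF that, of f] pairing_le[OF this, of f]]
    have "(\<beta> + 1) * (\<Sum>i\<in>?I. (f i)\<^sup>2) \<le> - pairing p (moment ?I (\<lambda>j i k. t * X j i k) f)" .
    moreover have "\<bar>quad ?I (\<lambda>i k. B $$ (i, k)) f\<bar> \<le> \<beta> * (\<Sum>i\<in>?I. (f i)\<^sup>2)"
      unfolding \<beta>_def by (rule abs_quad_le) simp
    ultimately show "pairing p (moment ?I (\<lambda>j i k. t * X j i k) f) < quad ?I (\<lambda>i k. B $$ (i, k)) f"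
      using pos by (simp add: distrib_right)
  qed
  have "(\<lambda>j. (1/2) \<cdot>\<^sub>m ?M \<bar>t0\<bar> j + (1/2) \<cdot>\<^sub>m ?M (- \<bar>t0\<bar>) j) \<in> sublevel_set n p B"
    using B(3)[unfolded convex_tuples_def, rule_format, OF mem mem, of "\<bar>t0\<bar>" "- \<bar>t0\<bar>" "1/2" "1/2"] by simp
  moreover have "(\<lambda>j. (1/2) \<cdot>\<^sub>m ?M \<bar>t0\<bar> j + (1/2) \<cdot>\<^sub>m ?M (- \<bar>t0\<bar>) j) = ?M 0"
    by (intro ext eq_matI) auto
  ultimately have "?M 0 \<in> sublevel_set n p B" by simp
  then have "\<forall>f. (\<exists>i\<in>?I. f i \<noteq> 0) \<longrightarrow> 0 < quad ?I (\<lambda>i k. B $$ (i, k)) f"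
    unfolding sublevel_set_iff[OF sym B(1) tup] mom by (simp add: pairing_zero_kernels p0)
  then have "pos_def n B" by (simp add: pos_def_iff_quad[OF B(1)])
  moreover have "0\<^sub>v n \<bullet> (B *\<^sub>v 0\<^sub>v n) = 0"
    using B(1) by (intro scalar_prod_left_zero mult_mat_vec_carrier[of B n n]) (auto simp: sym_mats_def)
  ultimately have "pos_semidef n B"
    unfolding pos_def_def pos_semidef_def by (metis less_imp_le order_refl)
  then show False using B(2) by simp
qed

section \<open>The dichotomy\<close>

theorem theorem1p1:
  fixes p :: "'g::finite free_poly"
  assumes "quasi_convex p"
  shows "(sum_of_squares (- p) \<or>
           (\<exists>(l :: 'g free_poly) (ss :: 'g free_poly list).
              linear_poly l \<and> (\<forall>s \<in> set ss. linear_poly s) \<and>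
              p = l + (\<Sum>s \<leftarrow> ss. star s * s)))
       \<and> ((\<exists>N > 0. \<forall>n \<ge> N. \<exists>B \<in> sym_mats n.
              \<not> pos_semidef n B \<and> convex_tuples (sublevel_set n p B))
           \<longrightarrow> (sum_of_squares (- p) \<longleftrightarrow> p = 0))"
proof (intro conjI impI)
  have sym: "symmetric_poly p" using assms by (simp add: quasi_convex_def)
  have p0: "Poly_Mapping.lookup p 0 = 0" by (rule quasi_convex_constant_term[OF assms])
  show "sum_of_squares (- p) \<or>
           (\<exists>(l :: 'g free_poly) (ss :: 'g free_poly list).
              linear_poly l \<and> (\<forall>s \<in> set ss. linear_poly s) \<and>
              p = l + (\<Sum>s \<leftarrow> ss. star s * s))"
  proof (cases "\<exists>(I :: 'g list set) X v. finite I \<and> sym_kernels I X \<and> pairing p (moment I X v) > 0")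
    case True
    then obtain I0 :: "'g list set" and X0 v0
      where X0: "finite I0" "sym_kernels I0 X0" "pairing p (moment I0 X0 v0) > 0" by blast
    have cut: "0 \<le> pairing p (cut_sum L [])" for L
      by (rule cut_sum_nonneg_if_midpoint_convex)
         (rule midpoint_convex_if_somewhere_positive[OF assms p0 X0])
    show ?thesis
      by (rule disjI2, rule linear_plus_squares[OF cubic_coefficients_vanish[OF sym cut] p0
            quadratic_part_psd[OF sym cut]])
  next
    case False
    have "sum_of_squares (- p)"
    proof (rule sum_of_squares_if_moments_nonneg)
      show "symmetric_poly (- p)"
        unfolding symmetric_poly_def
        by (rule poly_mapping_eqI) (simp add: lookup_star symmetric_poly_lookup[OF sym])
      show "0 \<le> pairing (- p) (moment I X v)" if "finite I" "sym_kernels I X" for I :: "'g list set" and X v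
        using False that unfolding pairing_uminus by (metis neg_0_le_iff_le not_le)
    qed
    then show ?thesis ..
  qed
  assume "\<exists>N>0. \<forall>n\<ge>N. \<exists>B\<in>sym_mats n. \<not> pos_semidef n B \<and> convex_tuples (sublevel_set n p B)"
  then obtain N where N: "\<And>n. n \<ge> N \<Longrightarrow> \<exists>B\<in>sym_mats n. \<not> pos_semidef n B \<and> convex_tuples (sublevel_set n p B)"
    by blast
  have "p = 0" if "sum_of_squares (- p)"
    by (rule zero_if_negative_is_sos_and_sublevel_convex[OF sym p0 that N])
  moreover have "sum_of_squares (- p)" if "p = 0"
    unfolding sum_of_squares_def using that by (intro exI[of _ "[]"]) simp
  ultimately show "sum_of_squares (- p) \<longleftrightarrow> p = 0" by blast
qed

end
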